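(* Let $A$ be an $r\times r$ indecomposable Cartan matrix of finite type. Then for every $l\ge0$ and every $P\in M_{l,r}(\mathbb{Z})$, every frieze pattern $f$ associated to $A$ with coefficient matrix $P$ is ${\bf F}$-invariant, i.e. $f({\bf F}(i,m))=f(i,m)$ for all $(i,m)\in[1,r]\times\mathbb{Z}$, where $${\bf F}:[1,r]\times\mathbb{Z}\to[1,r]\times\mathbb{Z},\qquad {\bf F}(i,m)=(i^*,\,m+h(i^*;c)+1).$$
   Context: $[1,r]=\{1,\dots,r\}$; $[a]_+=\max(a,0)$, applied entrywise; for ${\bf a}=(a_1,\dots,a_n)$ and an integer column vector $L=(l_1,\dots,l_n)^T$, ${\bf a}^L=a_1^{l_1}\cdots a_n^{l_n}$; $M_{l,r}(\mathbb{Z})$ is the set of $l\times r$ integer matrices. Root data. $A=(a_{i,j})$ is the Cartan matrix, $a_{i,j}=\alpha_i^\vee(\alpha_j)$, of a root system with simple roots $\alpha_1,\dots,\alpha_r$, simple coroots $\alpha_i^\vee$, fundamental weights $\omega_1,\dots,\omega_r$, Weyl group $W$ with simple reflections $s_i$ and longest element $w_0$. Let $c=s_1s_2\cdots s_r$. For $i\in[1,r]$, $i^*\in[1,r]$ is defined by $w_0\omega_i=-\omega_{i^*}$, and $h(i;c)\ge1$ is the integer such that $\omega_i>c\omega_i>\cdots>c^{h(i;c)}\omega_i=-\omega_{i^*}$, where $\delta>\gamma$ means that $\delta\ne\gamma$ and $\delta-\gamma$ is a non-negative integral combination of simple roots. Frieze patterns with coefficients. $B_A$ is the $r\times r$ matrix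 with $(i,j)$ entry $-a_{i,j}$ if $i<j$, $0$ if $i=j$, $a_{i,j}$ if $i>j$. For an $(r+l)\times r$ integer matrix $\widetilde B=(b_{i,j})$ and $k\in[1,r]$, $\mu_k(\widetilde B)=(b'_{i,j})$ with $b'_{i,j}=-b_{i,j}$ if $i=k$ or $j=k$, and $b'_{i,j}=b_{i,j}+[b_{i,k}]_+[b_{k,j}]_+-[-b_{i,k}]_+[-b_{k,j}]_+$ otherwise (an involution for the matrices below). Define matrices $\widetilde B_{t(i,m)}=\binom{B_{t(i,m)}}{P_{t(i,m)}}$, $(i,m)\in[1,r]\times\mathbb{Z}$, by $\widetilde B_{t(1,0)}=\binom{B_A}{P}$, $\widetilde B_{t(i+1,m)}=\mu_i(\widetilde B_{t(i,m)})$ for $i\in[1,r-1]$, and $\widetilde B_{t(1,m+1)}=\mu_r(\widetilde B_{t(r,m)})$, for all $m\in\mathbb{Z}$. Let $p(i,m)\in\mathbb{Z}^l$ be the $i$th column of $P_{t(i,m)}$. A frieze pattern associated to $A$ with coefficient matrix $P$ is a map $f:([1,r]\times\mathbb{Z})\cup\{p_1,\dots,p_l\}\to\mathbb{Z}_{>0}$ such that for all $(i,m)\in[1,r]\times\mathbb{Z}$, $$f(i,m)f(i,m+1)=f({\bf p})^{[p(i,m)]_+}+f({\bf p})^{[-p(i,m)]_+}\prod_{j=i+1}^rf(j,m)^{-a_{j,i}}\prod_{j=1}^{i-1}f(j,m+1)^{-a_{j,i}},$$ where $f({\bf p})=(f(p_1),\dots,f(p_l))$. *)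

theory Defs
  imports Complex_Main
begin

text \<open>
  An \<open>m \<times> n\<close> integer matrix is a function of type \<open>nat \<Rightarrow> nat \<Rightarrow> int\<close> of which only
  the entries with indices in \<open>{1..m} \<times> {1..n}\<close> are meaningful.
\<close>

section \<open>Cartan matrices of finite type\<close>

definition cartan_matrix_finite_type :: "nat \<Rightarrow> (nat \<Rightarrow> nat \<Rightarrow> int) \<Rightarrow> bool" where
  "cartan_matrix_finite_type r A \<longleftrightarrow>
     (\<forall>i\<in>{1..r}. A i i = 2) \<and>
     (\<forall>i\<in>{1..r}. \<forall>j\<in>{1..r}. i \<noteq> j \<longrightarrow> A i j \<le> 0) \<and>
     (\<exists>d :: nat \<Rightarrow> real.
        (\<forall>i\<in>{1..r}. d i > 0) \<and>
        (\<forall>i\<in>{1..r}. \<forall>j\<in>{1..r}. d i * of_int (A i j) = d j * of_int (A j i)) \<and>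
        (\<forall>x :: nat \<Rightarrow> real. (\<exists>i\<in>{1..r}. x i \<noteq> 0) \<longrightarrow>
           (\<Sum>i\<in>{1..r}. \<Sum>j\<in>{1..r}. x i * (d i * of_int (A i j)) * x j) > 0))"

definition indecomposable :: "nat \<Rightarrow> (nat \<Rightarrow> nat \<Rightarrow> int) \<Rightarrow> bool" where
  "indecomposable r A \<longleftrightarrow>
     \<not> (\<exists>I. I \<noteq> {} \<and> I \<subset> {1..r} \<and>
          (\<forall>i\<in>I. \<forall>j\<in>{1..r} - I. A i j = 0 \<and> A j i = 0))"


section \<open>Weights and the Weyl group\<close>

text \<open>
  An integral weight is given by its coordinates in the basis of fundamental weights: the
  \<open>k\<close>-th coordinate of \<open>v\<close> is \<open>\<alpha>\<^sub>k\<^sup>\<or>(v)\<close>. In particular the \<open>k\<close>-th coordinate of \<open>\<alpha>\<^sub>j\<close> is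
  \<open>\<alpha>\<^sub>k\<^sup>\<or>(\<alpha>\<^sub>j) = a\<^sub>k\<^sub>j\<close>. Coordinates outside \<open>{1..r}\<close> are left alone by the reflections, so that
  the group they generate as maps on \<open>nat \<Rightarrow> int\<close> is the Weyl group.
\<close>

type_synonym weight = "nat \<Rightarrow> int"

definition fund_weight :: "nat \<Rightarrow> weight" where
  "fund_weight i = (\<lambda>k. if k = i then 1 else 0)"

definition simple_root :: "nat \<Rightarrow> (nat \<Rightarrow> nat \<Rightarrow> int) \<Rightarrow> nat \<Rightarrow> weight" where
  "simple_root r A j = (\<lambda>k. if k \<in> {1..r} then A k j else 0)"

definition simple_refl :: "nat \<Rightarrow> (nat \<Rightarrow> nat \<Rightarrow> int) \<Rightarrow> nat \<Rightarrow> weight \<Rightarrow> weight" where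
  "simple_refl r A i v = (\<lambda>k. v k - v i * simple_root r A i k)"

definition refl_word :: "nat \<Rightarrow> (nat \<Rightarrow> nat \<Rightarrow> int) \<Rightarrow> nat list \<Rightarrow> weight \<Rightarrow> weight" where
  "refl_word r A is = foldr (\<lambda>i w. simple_refl r A i \<circ> w) is id"

definition weyl_group :: "nat \<Rightarrow> (nat \<Rightarrow> nat \<Rightarrow> int) \<Rightarrow> (weight \<Rightarrow> weight) set" where
  "weyl_group r A = {refl_word r A is | is. set is \<subseteq> {1..r}}"

definition weyl_length :: "nat \<Rightarrow> (nat \<Rightarrow> nat \<Rightarrow> int) \<Rightarrow> (weight \<Rightarrow> weight) \<Rightarrow> nat" where
  "weyl_length r A w =
     (LEAST n. \<exists>is. length is = n \<and> set is \<subseteq> {1..r} \<and> refl_word r A is = w)"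

definition longest_element :: "nat \<Rightarrow> (nat \<Rightarrow> nat \<Rightarrow> int) \<Rightarrow> weight \<Rightarrow> weight" where
  "longest_element r A =
     (THE w. w \<in> weyl_group r A \<and> (\<forall>v\<in>weyl_group r A. weyl_length r A v \<le> weyl_length r A w))"

definition coxeter_element :: "nat \<Rightarrow> (nat \<Rightarrow> nat \<Rightarrow> int) \<Rightarrow> weight \<Rightarrow> weight" where
  "coxeter_element r A = refl_word r A [1..<Suc r]"

definition weight_greater :: "nat \<Rightarrow> (nat \<Rightarrow> nat \<Rightarrow> int) \<Rightarrow> weight \<Rightarrow> weight \<Rightarrow> bool" where
  "weight_greater r A v u \<longleftrightarrow>
     v \<noteq> u \<and>
     (\<exists>n :: nat \<Rightarrow> nat. \<forall>k. v k - u k = (\<Sum>j\<in>{1..r}. int (n j) * simple_root r A j k))"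

definition star :: "nat \<Rightarrow> (nat \<Rightarrow> nat \<Rightarrow> int) \<Rightarrow> nat \<Rightarrow> nat" where
  "star r A i =
     (THE j. j \<in> {1..r} \<and> longest_element r A (fund_weight i) = (\<lambda>k. - fund_weight j k))"

definition hc :: "nat \<Rightarrow> (nat \<Rightarrow> nat \<Rightarrow> int) \<Rightarrow> nat \<Rightarrow> nat" where
  "hc r A i =
     (THE h. h \<ge> 1 \<and>
        (\<forall>n<h. weight_greater r A ((coxeter_element r A ^^ n) (fund_weight i))
                                  ((coxeter_element r A ^^ Suc n) (fund_weight i))) \<and>
        (coxeter_element r A ^^ h) (fund_weight i) = (\<lambda>k. - fund_weight (star r A i) k))"

definition F_map :: "nat \<Rightarrow> (nat \<Rightarrow> nat \<Rightarrow> int) \<Rightarrow> nat \<times> int \<Rightarrow> nat \<times> int" where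
  "F_map r A = (\<lambda>(i, m). (star r A i, m + int (hc r A (star r A i)) + 1))"


section \<open>Matrix mutation\<close>

definition pos_part :: "int \<Rightarrow> int" where
  "pos_part a = max a 0"

definition mutate :: "nat \<Rightarrow> (nat \<Rightarrow> nat \<Rightarrow> int) \<Rightarrow> nat \<Rightarrow> nat \<Rightarrow> int" where
  "mutate k B = (\<lambda>i j.
     if i = k \<or> j = k then - B i j
     else B i j + pos_part (B i k) * pos_part (B k j) - pos_part (- B i k) * pos_part (- B k j))"

lemma mutate_mutate [simp]: "mutate k (mutate k B) = B"
  by (intro ext) (auto simp: mutate_def)

definition B_matrix :: "(nat \<Rightarrow> nat \<Rightarrow> int) \<Rightarrow> nat \<Rightarrow> nat \<Rightarrow> int" where
  "B_matrix A i j = (if i < j then - A i j else if i = j then 0 else A i j)"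

text \<open>The matrix with upper block \<open>B\<^sub>A\<close> (rows \<open>1..r\<close>) and lower block \<open>P\<close> (rows \<open>r+1..r+l\<close>).\<close>

definition ext_matrix ::
  "nat \<Rightarrow> (nat \<Rightarrow> nat \<Rightarrow> int) \<Rightarrow> (nat \<Rightarrow> nat \<Rightarrow> int) \<Rightarrow> nat \<Rightarrow> nat \<Rightarrow> int" where
  "ext_matrix r A P i j = (if i \<le> r then B_matrix A i j else P (i - r) j)"

text \<open>
  \<open>B_tilde r A P i m\<close> is the matrix at \<open>t(i,m)\<close>. One first moves from \<open>t(1,0)\<close> to \<open>t(1,m)\<close> by
  \<open>m\<close> sweeps of mutations in directions \<open>1,\<dots>,r\<close> (for negative \<open>m\<close>, by \<open>-m\<close> sweeps in
  directions \<open>r,\<dots>,1\<close>, mutations being involutions), and then mutates in directions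
  \<open>1,\<dots>,i-1\<close>. The lemmas below are the recursion that characterises this family.
\<close>

definition B_tilde ::
  "nat \<Rightarrow> (nat \<Rightarrow> nat \<Rightarrow> int) \<Rightarrow> (nat \<Rightarrow> nat \<Rightarrow> int) \<Rightarrow> nat \<Rightarrow> int \<Rightarrow> nat \<Rightarrow> nat \<Rightarrow> int" where
  "B_tilde r A P i m =
     fold mutate [1..<i]
       (if m \<ge> 0 then (fold mutate [1..<Suc r] ^^ nat m) (ext_matrix r A P)
        else (fold mutate (rev [1..<Suc r]) ^^ nat (- m)) (ext_matrix r A P))"

lemma B_tilde_init: "B_tilde r A P 1 0 = ext_matrix r A P"
  by (simp add: B_tilde_def)

lemma B_tilde_step:
  assumes "i \<ge> 1"
  shows "B_tilde r A P (i + 1) m = mutate i (B_tilde r A P i m)"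
  using assms by (simp add: B_tilde_def)

lemma fold_mutate_rev: "fold mutate ks (fold mutate (rev ks) B) = B"
  by (induction ks arbitrary: B) simp_all

lemma B_tilde_wrap:
  assumes "r \<ge> 1"
  shows "B_tilde r A P 1 (m + 1) = mutate r (B_tilde r A P r m)"
proof -
  have sweep: "mutate r (fold mutate [1..<r] B) = fold mutate [1..<Suc r] B" for B
    using assms by simp
  show ?thesis
  proof (cases "m \<ge> 0")
    case True
    then have "nat (m + 1) = Suc (nat m)" by simp
    with True show ?thesis by (simp add: B_tilde_def sweep del: upt_Suc One_nat_def)
  next
    case False
    then have "nat (- m) = Suc (nat (- (m + 1)))" by simp
    with False show ?thesis
      by (cases "m = -1") (simp_all add: B_tilde_def sweep fold_mutate_rev del: upt_Suc One_nat_def)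
  qed
qed

text \<open>The \<open>k\<close>-th entry of \<open>p(i,m)\<close>.\<close>

definition p_vec ::
  "nat \<Rightarrow> (nat \<Rightarrow> nat \<Rightarrow> int) \<Rightarrow> (nat \<Rightarrow> nat \<Rightarrow> int) \<Rightarrow> nat \<Rightarrow> int \<Rightarrow> nat \<Rightarrow> int" where
  "p_vec r A P i m k = B_tilde r A P i m (r + k) i"


section \<open>Frieze patterns with coefficients\<close>

text \<open>
  The domain of a frieze pattern is a disjoint union, encoded by a sum type: \<open>Inl (i, m)\<close> is the
  point \<open>(i,m)\<close>, and \<open>Inr k\<close> is \<open>p\<^sub>k\<close>. All exponents below are non-negative
  integers when \<open>A\<close> is a Cartan matrix, so converting them to \<open>nat\<close> loses nothing.
\<close>

definition frieze_pattern ::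
  "nat \<Rightarrow> nat \<Rightarrow> (nat \<Rightarrow> nat \<Rightarrow> int) \<Rightarrow> (nat \<Rightarrow> nat \<Rightarrow> int) \<Rightarrow> (nat \<times> int + nat \<Rightarrow> int) \<Rightarrow> bool" where
  "frieze_pattern r l A P f \<longleftrightarrow>
     (\<forall>i\<in>{1..r}. \<forall>m. f (Inl (i, m)) > 0) \<and>
     (\<forall>k\<in>{1..l}. f (Inr k) > 0) \<and>
     (\<forall>i\<in>{1..r}. \<forall>m.
        f (Inl (i, m)) * f (Inl (i, m + 1)) =
          (\<Prod>k\<in>{1..l}. f (Inr k) ^ nat (pos_part (p_vec r A P i m k))) +
          (\<Prod>k\<in>{1..l}. f (Inr k) ^ nat (pos_part (- p_vec r A P i m k))) *
          (\<Prod>j\<in>{i+1..r}. f (Inl (j, m)) ^ nat (- A j i)) *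
          (\<Prod>j\<in>{1..<i}. f (Inl (j, m + 1)) ^ nat (- A j i)))"

end

theory Submission
  imports Defs "HOL-Computational_Algebra.Polynomial" "HOL-Analysis.Convex"
begin

text \<open>
  Adjoin one more row of coefficients, consisting of ones at \<open>t(1,0)\<close>, with value \<open>t\<close>. The
  values \<open>f(i,m)\<close>, \<open>m \<ge> 0\<close>, then become functions of \<open>t\<close>, and they are polynomials: modulo
  \<open>f(i,m)\<close> the relations at the neighbours of \<open>i\<close> collapse to monomials, and the tropical
  recursion of the columns \<open>p(i,m)\<close> makes the next right-hand side vanish.

  The entry of the extra row in column \<open>i\<close> of \<open>t(i,m)\<close> is the height of \<open>c\<^sup>m \<beta>\<^sub>i\<close>, where
  \<open>\<beta>\<^sub>i = (1 - c) \<omega>\<^sub>i\<close>, as long as this root stays positive. It is negative at the first \<open>m = h\<close> for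
  which the root is negative. There the root is \<open>- \<beta>\<^sub>k\<close> for some \<open>k\<close>, because only
  \<open>\<beta>\<^sub>1, \<dots>, \<beta>\<^sub>r\<close> are made negative by \<open>c\<^sup>-\<^sup>1\<close>. So \<open>c\<^sup>h \<omega>\<^sub>i = - \<omega>\<^sub>k\<close>, which forces \<open>k = i\<^sup>*\<close> and
  \<open>h = h(i;c)\<close>. Since \<open>deg f(i,m)\<close> is the height of \<open>c\<^sup>m\<^sup>-\<^sup>1 \<beta>\<^sub>i\<close> for \<open>1 \<le> m \<le> h\<close>, the degree
  of \<open>f(i,h+1)\<close> is \<open>0\<close>. Hence \<open>f(i,h+1)\<close> equals its value at \<open>t = 0\<close>, which is a monomial
  \<open>f(i\<^sup>*,0) \<Prod>\<^sub>k f(p\<^sub>k)\<^bsup>v\<^sub>k\<^esup>\<close>. The exponents \<open>v\<^sub>k\<close> vanish, since all values stay bounded away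
  from \<open>0\<close> and \<open>\<infinity>\<close> as \<open>f(p\<^sub>k)\<close> tends to \<open>0\<close>.
\<close>

text \<open>At \<open>t = 1\<close> the extra row is invisible and the given values reappear. At
  \<open>t = 0\<close> the first term of a relation dies while the extra entry is positive, and the
  surviving monomial recursion is that of the weights \<open>c\<^sup>m \<omega>\<^sub>i\<close>. The
  obstacle is the way back from \<open>t = 0\<close> to \<open>t = 1\<close>. A row of ones serves
  because degrees in \<open>t\<close> follow its recursion one step behind: the polynomial becomes
  constant at the very step where the monomial is reduced to one initial value. The delicate point
  is the sign of the extra entry at that step. Neighbours that have already turned negative count as
  zero in the recursion, so the entry may exceed the height of the root; only the order in which
  neighbours reach their ends keeps it negative. The exponents \<open>v\<^sub>k\<close> depend
  neither on the coefficients nor on the initial values. So the coefficients may be replaced by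
  arbitrary positive reals, which is why the argument runs over real data. Any sweep can serve as
  the start, since the recursion of the columns is the same for all \<open>m\<close>.\<close>

lemma pos_part_simps [simp]: "pos_part 0 = 0" "a \<ge> 0 \<Longrightarrow> pos_part a = a" "a \<le> 0 \<Longrightarrow> pos_part a = 0"
  "pos_part a \<ge> 0"
  by (auto simp: pos_part_def)

lemma pos_part_diff: "pos_part a - pos_part (- a) = a"
  by (auto simp: pos_part_def)

section \<open>The columns of the mutated matrices\<close>

text \<open>In \<open>t(i,m)\<close> the vertices \<open>1, \<dots>, i - 1\<close> have been mutated once more than the others.
  Vertex \<open>i\<close> is then a source, so a mutation in direction \<open>i\<close> or back only changes signs in
  the principal part.\<close>

definition sweep_pattern :: "nat \<Rightarrow> (nat \<Rightarrow> nat \<Rightarrow> int) \<Rightarrow> nat \<Rightarrow> (nat \<Rightarrow> nat \<Rightarrow> int) \<Rightarrow> bool" where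
  "sweep_pattern r A i M \<longleftrightarrow>
     (\<forall>x\<in>{1..r}. \<forall>y\<in>{1..r}. M x y = (if (x < i) = (y < i) then B_matrix A x y else - B_matrix A x y))"

text \<open>The sign pattern is what mutation and divisibility arguments use; positivity of the form
  enters with \<open>cartan\<close>.\<close>

locale sign_matrix =
  fixes r :: nat and A :: "nat \<Rightarrow> nat \<Rightarrow> int"
  assumes off_diag: "i \<in> {1..r} \<Longrightarrow> j \<in> {1..r} \<Longrightarrow> i \<noteq> j \<Longrightarrow> A i j \<le> 0"
    and zero_sym: "i \<in> {1..r} \<Longrightarrow> j \<in> {1..r} \<Longrightarrow> A i j = 0 \<Longrightarrow> A j i = 0"
begin

lemma pattern_row:
  assumes "sweep_pattern r A i M" "i \<in> {1..r}" "y \<in> {1..r}" "y \<noteq> i"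
  shows "M i y = - A i y" "M y i = A y i"
  using assms by (auto simp: sweep_pattern_def B_matrix_def)

lemma pattern_row_Suc:
  assumes "sweep_pattern r A (Suc i) M" "i \<in> {1..r}" "y \<in> {1..r}" "y \<noteq> i"
  shows "M i y = A i y" "M y i = - A y i"
  using assms by (auto simp: sweep_pattern_def B_matrix_def)

lemma sweep_pattern_mutate:
  assumes M: "sweep_pattern r A i M" and i: "i \<in> {1..r}"
  shows "sweep_pattern r A (Suc i) (mutate i M)"
  unfolding sweep_pattern_def
proof (intro ballI)
  fix x y assume xy: "x \<in> {1..r}" "y \<in> {1..r}"
  show "mutate i M x y = (if (x < Suc i) = (y < Suc i) then B_matrix A x y else - B_matrix A x y)"
  proof (cases "x = i \<or> y = i")
    case True
    then show ?thesis using M xy i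
      by (auto simp: mutate_def sweep_pattern_def B_matrix_def)
  next
    case False
    then have "M i y = - A i y" "M x i = A x i" "A i y \<le> 0" "A x i \<le> 0"
      using pattern_row[OF M i] off_diag i xy by auto
    then have "mutate i M x y = M x y" using False by (simp add: mutate_def)
    then show ?thesis using M xy False by (auto simp: sweep_pattern_def less_Suc_eq)
  qed
qed

text \<open>Sweeps with negative \<open>m\<close> are reached by undoing mutations, where the
  pattern is known only at the end of the sweep.\<close>

lemma sweep_pattern_mutate_back:
  assumes M: "sweep_pattern r A (Suc i) M" and i: "i \<in> {1..r}"
  shows "sweep_pattern r A i (mutate i M)"
  unfolding sweep_pattern_def
proof (intro ballI)
  fix x y assume xy: "x \<in> {1..r}" "y \<in> {1..r}"
  show "mutate i M x y = (if (x < i) = (y < i) then B_matrix A x y else - B_matrix A x y)"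
  proof (cases "x = i \<or> y = i")
    case True
    then show ?thesis using M xy i
      by (auto simp: mutate_def sweep_pattern_def B_matrix_def)
  next
    case False
    then have "M i y = A i y" "M x i = - A x i" "A i y \<le> 0" "A x i \<le> 0"
      using pattern_row_Suc[OF M i] off_diag i xy by auto
    then have "mutate i M x y = M x y" using False by (simp add: mutate_def)
    then show ?thesis using M xy False by (auto simp: sweep_pattern_def less_Suc_eq)
  qed
qed

text \<open>After a full sweep all vertices have been mutated equally often, so the principal part
  is \<open>B_matrix A\<close> again.\<close>

lemma sweep_pattern_wrap: "sweep_pattern r A (Suc r) M \<longleftrightarrow> sweep_pattern r A 1 M"
  unfolding sweep_pattern_def by (intro ball_cong refl) auto

lemma B_tilde_Suc:
  assumes "i \<ge> 1" shows "B_tilde r A P (Suc i) m = mutate i (B_tilde r A P i m)"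
  using B_tilde_step[OF assms] by simp

lemma B_tilde_Suc_r:
  assumes "r \<ge> 1" shows "B_tilde r A P (Suc r) m = B_tilde r A P 1 (m + 1)"
  using B_tilde_Suc[of r] B_tilde_wrap[of r] assms by simp

lemma sweep_pattern_B_tilde_1:
  assumes r: "r \<ge> 1"
  shows "sweep_pattern r A 1 (B_tilde r A P 1 m)"
proof -
  have up: "sweep_pattern r A 1 (B_tilde r A P 1 (m + 1))" if "sweep_pattern r A 1 (B_tilde r A P 1 m)" for m
  proof -
    have "i \<le> r \<Longrightarrow> sweep_pattern r A (Suc i) (B_tilde r A P (Suc i) m)" for i
    proof (induction i)
      case (Suc i)
      then show ?case using sweep_pattern_mutate[of "Suc i"] by (simp add: B_tilde_Suc[of "Suc i"])
    qed (use that in simp)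
    from this[of r] show ?thesis
      using B_tilde_Suc_r[OF r, of P m] by (simp only: sweep_pattern_wrap order_refl simp_thms)
  qed
  have down: "sweep_pattern r A 1 (B_tilde r A P 1 m)" if "sweep_pattern r A 1 (B_tilde r A P 1 (m + 1))" for m
  proof -
    have *: "sweep_pattern r A (Suc r) (B_tilde r A P (Suc r) m)"
      using that B_tilde_Suc_r[OF r, of P m] by (simp only: sweep_pattern_wrap)
    \<comment> \<open>Descending induction from the end of the sweep: each mutation is its own
      inverse.\<close>
    have "i \<le> r \<Longrightarrow> sweep_pattern r A (Suc i) (B_tilde r A P (Suc i) m)" for i
    proof (induction rule: inc_induct)
      case base then show ?case by (rule *)
    next
      case (step i)
      have "B_tilde r A P (Suc i) m = mutate (Suc i) (B_tilde r A P (Suc (Suc i)) m)"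
        by (subst B_tilde_Suc[of "Suc i"]) simp_all
      then show ?case using sweep_pattern_mutate_back[OF step.IH] step.hyps by simp
    qed
    from this[of 0] show ?thesis by simp
  qed
  show ?thesis
  proof (induction m rule: int_induct[where k = 0])
    case base
    then show ?case by (auto simp: B_tilde_init[unfolded One_nat_def] sweep_pattern_def ext_matrix_def)
  next
    case (step1 m) then show ?case using up by simp
  next
    case (step2 m) then show ?case using down[of "m - 1"] by simp
  qed
qed

lemma sweep_pattern_B_tilde:
  assumes "i \<in> {1..r}"
  shows "sweep_pattern r A i (B_tilde r A P i m)"
proof -
  have "i \<le> r \<Longrightarrow> sweep_pattern r A (Suc i) (B_tilde r A P (Suc i) m)" for i
  proof (induction i)
    case 0 then show ?case using sweep_pattern_B_tilde_1 assms by simp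
  next
    case (Suc i)
    then show ?case using sweep_pattern_mutate[of "Suc i"] by (simp add: B_tilde_Suc[of "Suc i"])
  qed
  moreover have "Suc (i - 1) = i" "i - 1 \<le> r" using assms by auto
  ultimately show ?thesis by metis
qed

text \<open>The principal entry \<open>- A j i\<close> is nonnegative, so only the product of
  positive parts survives in the mutation rule.\<close>

lemma B_tilde_column_step:
  assumes j: "j \<in> {1..r}" and i: "i \<in> {1..r}" "i \<noteq> j" and k: "k \<ge> 1"
  shows "B_tilde r A P (Suc j) m (r + k) i =
    B_tilde r A P j m (r + k) i - A j i * pos_part (p_vec r A P j m k)"
proof -
  have "B_tilde r A P j m j i = - A j i" "A j i \<le> 0"
    using pattern_row[OF sweep_pattern_B_tilde] off_diag j i by auto
  then show ?thesis using j i k by (simp add: B_tilde_Suc mutate_def p_vec_def)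
qed

lemma column_lower:
  assumes i: "i \<in> {1..r}" and k: "k \<ge> 1" and "1 \<le> n" "n \<le> i"
  shows "B_tilde r A P n m (r + k) i =
    B_tilde r A P 1 m (r + k) i + (\<Sum>j\<in>{1..<n}. - A j i * pos_part (p_vec r A P j m k))"
  using assms(3,4)
proof (induction n rule: dec_induct)
  case (step n)
  have "{1..<Suc n} = insert n {1..<n}" using step by auto
  then show ?case using B_tilde_column_step[of n i k P m] i k step by simp
qed simp

lemma column_upper:
  assumes i: "i \<in> {1..r}" and k: "k \<ge> 1" and "i \<le> n" "n \<le> r"
  shows "B_tilde r A P (Suc n) m (r + k) i =
    - p_vec r A P i m k + (\<Sum>j\<in>{i<..n}. - A j i * pos_part (p_vec r A P j m k))"
  using assms(3,4)
proof (induction n rule: dec_induct)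
  case base
  then show ?case using i by (simp add: B_tilde_Suc mutate_def p_vec_def)
next
  case (step n)
  have "{i<..Suc n} = insert (Suc n) {i<..n}" using step by auto
  then show ?case using B_tilde_column_step[of "Suc n" i k P m] i k step by simp
qed

lemma p_vec_initial:
  assumes i: "i \<in> {1..r}" and k: "k \<ge> 1"
  shows "p_vec r A P i 0 k = P k i + (\<Sum>j\<in>{1..<i}. - A j i * pos_part (p_vec r A P j 0 k))"
  using column_lower[OF i k, of i P 0] i k
  by (simp add: p_vec_def B_tilde_init[unfolded One_nat_def] ext_matrix_def)

text \<open>Mutation at \<open>i\<close> in sweep \<open>m\<close> negates column \<open>i\<close>;
  before its next turn the column collects the contributions of \<open>j > i\<close> in sweep
  \<open>m\<close> and of \<open>j < i\<close> in sweep \<open>m + 1\<close>. This is the tropical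
  shadow of the frieze relation.\<close>

lemma p_vec_step:
  assumes i: "i \<in> {1..r}" and k: "k \<ge> 1"
  shows "p_vec r A P i m k + p_vec r A P i (m + 1) k =
    (\<Sum>j\<in>{i<..r}. - A j i * pos_part (p_vec r A P j m k)) +
    (\<Sum>j\<in>{1..<i}. - A j i * pos_part (p_vec r A P j (m + 1) k))"
proof -
  have "r \<ge> 1" using i by auto
  have "B_tilde r A P i (m + 1) (r + k) i = B_tilde r A P (Suc r) m (r + k) i +
      (\<Sum>j\<in>{1..<i}. - A j i * pos_part (p_vec r A P j (m + 1) k))"
    using column_lower[OF i k, of i P "m + 1"] i B_tilde_Suc_r[OF \<open>r \<ge> 1\<close>, of P m] by simp
  then show ?thesis using column_upper[OF i k, of r P m] i by (simp add: p_vec_def)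
qed

end

section \<open>Laurent phenomenon for sweeps\<close>

text \<open>The order of the mutations: by sweep, then by vertex.\<close>

lemma sweep_induct [case_names less]:
  fixes P :: "nat \<Rightarrow> nat \<Rightarrow> bool"
  assumes "\<And>i m. (\<And>j k. k < m \<or> k = m \<and> j < i \<Longrightarrow> P j k) \<Longrightarrow> P i m"
  shows "P i m"
proof -
  have "P (snd x) (fst x)" for x :: "nat \<times> nat"
  proof (induction x rule: wf_induct[of "less_than <*lex*> less_than"])
    case (2 x)
    then show ?case using assms[of "fst x" "snd x"] by (cases x) auto
  qed auto
  from this[of "(m, i)"] show ?thesis by simp
qed

text \<open>A polynomial with nonzero constant term is coprime to the variable.\<close>

lemma dvd_monom_mult_cancel:
  fixes p q :: "'a :: field poly"
  assumes "p dvd monom a k * q" "a \<noteq> 0" "poly p 0 \<noteq> 0"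
  shows "p dvd q"
  using assms(1)
proof (induction k)
  case 0
  then show ?case using assms(2) by (simp add: monom_0 dvd_smult_iff)
next
  case (Suc k)
  obtain g where g: "monom a (Suc k) * q = p * g" using Suc.prems by (rule dvdE)
  have "poly (monom a (Suc k) * q) 0 = 0" by (simp add: poly_monom)
  then have "poly g 0 = 0" using g assms(3) by simp
  then obtain g' where g': "g = [:0, 1:] * g'" using poly_eq_0_iff_dvd[of g 0] by auto
  have "[:0, 1:] * (monom a k * q) = [:0, 1:] * (p * g')"
    using g unfolding g' monom_Suc by (simp add: mult.left_commute)
  then have "monom a k * q = p * g'" by (subst (asm) mult_cancel_left) simp
  then show ?case using Suc.IH by simp
qed

text \<open>Positive leading coefficients cannot cancel, so degrees obey the tropical rule.\<close>

lemma
  fixes p q :: "real poly"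
  assumes "lead_coeff p > 0" "lead_coeff q > 0"
  shows lead_coeff_add_pos: "lead_coeff (p + q) > 0"
    and degree_add_pos: "degree (p + q) = max (degree p) (degree q)"
proof -
  have eq: "degree (p + q) = max (degree p) (degree q) \<and> lead_coeff (p + q) > 0"
  proof (cases "degree p" "degree q" rule: linorder_cases)
    case less then show ?thesis using assms by (simp add: degree_add_eq_right coeff_eq_0)
  next
    case greater then show ?thesis using assms by (simp add: degree_add_eq_left coeff_eq_0)
  next
    case equal
    then have "coeff (p + q) (degree p) > 0" using assms by simp
    then have "degree p \<le> degree (p + q)" by (intro le_degree) simp
    moreover have "degree (p + q) \<le> degree p" using degree_add_le_max[of p q] equal by simp
    ultimately show ?thesis using equal assms by simp
  qed
  then show "lead_coeff (p + q) > 0" "degree (p + q) = max (degree p) (degree q)" by auto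
qed

lemma dvd_power_diff:
  fixes x y :: "'a :: comm_ring_1"
  assumes "d dvd x - y" shows "d dvd x ^ n - y ^ n"
proof (induction n)
  case (Suc n)
  have "x ^ Suc n - y ^ Suc n = x * (x ^ n - y ^ n) + (x - y) * y ^ n" by (simp add: algebra_simps)
  then show ?case using Suc assms by simp
qed simp

lemma dvd_prod_diff:
  fixes f g :: "'b \<Rightarrow> 'a :: comm_ring_1"
  assumes "\<And>j. j \<in> S \<Longrightarrow> d dvd f j - g j"
  shows "d dvd prod f S - prod g S"
  using assms
proof (induction S rule: infinite_finite_induct)
  case (insert j S)
  have "prod f (insert j S) - prod g (insert j S) =
      f j * (prod f S - prod g S) + (f j - g j) * prod g S"
    using insert.hyps by (simp add: algebra_simps)
  then show ?case using insert by simp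
qed simp_all

text \<open>Here \<open>a\<close>, \<open>b\<close> and \<open>c\<close>, \<open>d\<close> are the
  coefficients of two successive relations at a vertex, \<open>z\<close> and \<open>w\<close> their
  products over neighbours, and \<open>l\<close> is what \<open>z * w\<close> is congruent to. Each
  bracket on the right is zero or divisible when used in \<open>dvd_rhs\<close>.\<close>

lemma exchange_identity:
  fixes a b c d z w l :: "'a :: comm_ring_1"
  shows "a * (c + d * w) = (a + b * z) * (c + d * w) - (a + b * z) * c - b * d * (z * w - l) + (a * c - b * d * l)"
  by (simp add: algebra_simps)

section \<open>Products and sums over the neighbours of a vertex\<close>

context sign_matrix
begin

text \<open>Neighbours below \<open>i\<close> enter with \<open>Suc m\<close>: in the running sweep
  they have been mutated before \<open>i\<close>.\<close>

definition mesh_prod :: "(nat \<Rightarrow> nat \<Rightarrow> 'a :: comm_monoid_mult) \<Rightarrow> nat \<Rightarrow> nat \<Rightarrow> 'a" where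
  "mesh_prod u i m = (\<Prod>j\<in>{i<..r}. u j m ^ nat (- A j i)) * (\<Prod>j\<in>{1..<i}. u j (Suc m) ^ nat (- A j i))"

definition mesh_sum :: "(nat \<Rightarrow> nat \<Rightarrow> 'a :: ring_1) \<Rightarrow> nat \<Rightarrow> nat \<Rightarrow> 'a" where
  "mesh_sum u i m = (\<Sum>j\<in>{i<..r}. - of_int (A j i) * u j m) + (\<Sum>j\<in>{1..<i}. - of_int (A j i) * u j (Suc m))"

lemma mesh_prod_mult: "mesh_prod u i m * mesh_prod v i m = mesh_prod (\<lambda>j k. u j k * v j k) i m"
  by (simp add: mesh_prod_def power_mult_distrib prod.distrib mult_ac)

lemma mesh_prod_dvd_diff:
  fixes u v :: "nat \<Rightarrow> nat \<Rightarrow> 'a :: comm_ring_1"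
  assumes "\<And>j. j \<in> {i<..r} \<Longrightarrow> A j i \<noteq> 0 \<Longrightarrow> d dvd u j m - v j m"
    and "\<And>j. j \<in> {1..<i} \<Longrightarrow> A j i \<noteq> 0 \<Longrightarrow> d dvd u j (Suc m) - v j (Suc m)"
  shows "d dvd mesh_prod u i m - mesh_prod v i m"
proof -
  let ?U = "\<Prod>j\<in>{i<..r}. u j m ^ nat (- A j i)" and ?U' = "\<Prod>j\<in>{1..<i}. u j (Suc m) ^ nat (- A j i)"
  let ?V = "\<Prod>j\<in>{i<..r}. v j m ^ nat (- A j i)" and ?V' = "\<Prod>j\<in>{1..<i}. v j (Suc m) ^ nat (- A j i)"
  have 1: "d dvd ?U - ?V"
  proof (rule dvd_prod_diff)
    fix j assume "j \<in> {i<..r}"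
    then show "d dvd u j m ^ nat (- A j i) - v j m ^ nat (- A j i)"
      using assms(1)[of j] by (cases "A j i = 0") (auto intro: dvd_power_diff)
  qed
  have 2: "d dvd ?U' - ?V'"
  proof (rule dvd_prod_diff)
    fix j assume "j \<in> {1..<i}"
    then show "d dvd u j (Suc m) ^ nat (- A j i) - v j (Suc m) ^ nat (- A j i)"
      using assms(2)[of j] by (cases "A j i = 0") (auto intro: dvd_power_diff)
  qed
  have "mesh_prod u i m - mesh_prod v i m = ?U * (?U' - ?V') + (?U - ?V) * ?V'"
    by (simp add: mesh_prod_def algebra_simps)
  then show ?thesis using 1 2 by simp
qed

lemma mesh_prod_pos:
  fixes u :: "nat \<Rightarrow> nat \<Rightarrow> 'a :: linordered_semidom"
  assumes "\<And>j. j \<in> {i<..r} \<Longrightarrow> u j m > 0" "\<And>j. j \<in> {1..<i} \<Longrightarrow> u j (Suc m) > 0"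
  shows "mesh_prod u i m > 0"
  unfolding mesh_prod_def using assms by (intro mult_pos_pos prod_pos zero_less_power) auto

lemma mesh_prod_mono:
  fixes u v :: "nat \<Rightarrow> nat \<Rightarrow> real"
  assumes "\<And>j. j \<in> {i<..r} \<Longrightarrow> 0 \<le> u j m \<and> u j m \<le> v j m"
    and "\<And>j. j \<in> {1..<i} \<Longrightarrow> 0 \<le> u j (Suc m) \<and> u j (Suc m) \<le> v j (Suc m)"
  shows "mesh_prod u i m \<le> mesh_prod v i m"
  unfolding mesh_prod_def using assms
  by (intro mult_mono prod_mono prod_nonneg conjI power_mono zero_le_power) fastforce+

lemma poly_mesh_prod: "poly (mesh_prod u i m) t = mesh_prod (\<lambda>j k. poly (u j k) t) i m"
  by (simp add: mesh_prod_def poly_prod)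

lemma of_int_exponent:
  assumes "j \<in> {1..r}" "i \<in> {1..r}" "j \<noteq> i"
  shows "of_nat (nat (- A j i)) = (- of_int (A j i) :: 'a :: ring_1)"
  using off_diag[OF assms] by (metis nat_0_le neg_0_le_iff_le of_int_minus of_int_of_nat_eq)

lemma ln_mesh_prod:
  fixes u :: "nat \<Rightarrow> nat \<Rightarrow> real"
  assumes "i \<in> {1..r}"
  assumes "\<And>j. j \<in> {i<..r} \<Longrightarrow> u j m > 0" "\<And>j. j \<in> {1..<i} \<Longrightarrow> u j (Suc m) > 0"
  shows "ln (mesh_prod u i m) = mesh_sum (\<lambda>j k. ln (u j k)) i m"
proof -
  have "ln (\<Prod>j\<in>{i<..r}. u j m ^ nat (- A j i)) = (\<Sum>j\<in>{i<..r}. - of_int (A j i) * ln (u j m))"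
    using assms of_int_exponent[where i = i, where ?'a = real] by (subst ln_prod) (simp, rule less_imp_neq[THEN not_sym], simp, auto intro!: sum.cong simp: ln_realpow)
  moreover have "ln (\<Prod>j\<in>{1..<i}. u j (Suc m) ^ nat (- A j i)) = (\<Sum>j\<in>{1..<i}. - of_int (A j i) * ln (u j (Suc m)))"
    using assms of_int_exponent[where i = i, where ?'a = real] by (subst ln_prod) (simp, rule less_imp_neq[THEN not_sym], simp, auto intro!: sum.cong simp: ln_realpow)
  moreover have "(\<Prod>j\<in>{i<..r}. u j m ^ nat (- A j i)) > 0" "(\<Prod>j\<in>{1..<i}. u j (Suc m) ^ nat (- A j i)) > 0"
    using assms by (auto intro!: prod_pos)
  ultimately show ?thesis by (simp only: mesh_prod_def mesh_sum_def ln_mult_pos)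
qed

lemma degree_mesh_prod:
  fixes u :: "nat \<Rightarrow> nat \<Rightarrow> real poly"
  assumes "i \<in> {1..r}"
  assumes "\<And>j. j \<in> {i<..r} \<Longrightarrow> u j m \<noteq> 0" "\<And>j. j \<in> {1..<i} \<Longrightarrow> u j (Suc m) \<noteq> 0"
  shows "int (degree (mesh_prod u i m)) = mesh_sum (\<lambda>j k. int (degree (u j k))) i m"
proof -
  have "int (degree (\<Prod>j\<in>{i<..r}. u j m ^ nat (- A j i))) = (\<Sum>j\<in>{i<..r}. - A j i * int (degree (u j m)))"
    using assms of_int_exponent[where i = i, where ?'a = int]
    by (subst degree_prod_eq_sum_degree) (auto intro!: sum.cong simp: degree_power_eq)
  moreover have "int (degree (\<Prod>j\<in>{1..<i}. u j (Suc m) ^ nat (- A j i))) = (\<Sum>j\<in>{1..<i}. - A j i * int (degree (u j (Suc m))))"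
    using assms of_int_exponent[where i = i, where ?'a = int]
    by (subst degree_prod_eq_sum_degree) (auto intro!: sum.cong simp: degree_power_eq)
  moreover have "(\<Prod>j\<in>{i<..r}. u j m ^ nat (- A j i)) \<noteq> 0" "(\<Prod>j\<in>{1..<i}. u j (Suc m) ^ nat (- A j i)) \<noteq> 0"
    using assms by auto
  ultimately show ?thesis by (simp add: mesh_prod_def mesh_sum_def degree_mult_eq)
qed

lemma lead_coeff_mesh_prod_pos:
  fixes u :: "nat \<Rightarrow> nat \<Rightarrow> real poly"
  assumes "\<And>j. j \<in> {i<..r} \<Longrightarrow> lead_coeff (u j m) > 0" "\<And>j. j \<in> {1..<i} \<Longrightarrow> lead_coeff (u j (Suc m)) > 0"
  shows "lead_coeff (mesh_prod u i m) > 0"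
  unfolding mesh_prod_def lead_coeff_mult lead_coeff_prod lead_coeff_power using assms
  by (intro mult_pos_pos prod_pos zero_less_power) auto

text \<open>Division is written as \<open>div\<close>, so that the values exist as polynomials from
  the start; that it is exact for the data at hand is the Laurent phenomenon, part of
  \<open>good\<close>.\<close>

function mesh_solution ::
  "(nat \<Rightarrow> nat \<Rightarrow> 'a) \<Rightarrow> (nat \<Rightarrow> nat \<Rightarrow> 'a) \<Rightarrow> (nat \<Rightarrow> 'a) \<Rightarrow> nat \<Rightarrow> nat \<Rightarrow> 'a :: idom_divide" where
  "mesh_solution a b X i 0 = X i"
| "mesh_solution a b X i (Suc m) =
     (a i m + b i m *
       ((\<Prod>j\<in>{i<..r}. mesh_solution a b X j m ^ nat (- A j i)) *
        (\<Prod>j\<in>{1..<i}. mesh_solution a b X j (Suc m) ^ nat (- A j i))))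
     div mesh_solution a b X i m"
  by pat_completeness auto
termination by (relation "inv_image (less_than <*lex*> less_than) (\<lambda>(a, b, X, i, m). (m, i))") auto

declare mesh_solution.simps(2) [simp del]

lemma mesh_solution_Suc:
  "mesh_solution a b X i (Suc m) =
     (a i m + b i m * mesh_prod (mesh_solution a b X) i m) div mesh_solution a b X i m"
  unfolding mesh_prod_def by (rule mesh_solution.simps(2))

lemma prod_monom_power:
  "(\<Prod>j\<in>S. monom (c j) (d j) ^ e j) = monom (\<Prod>j\<in>S. c j ^ e j :: 'a :: comm_ring_1) (\<Sum>j\<in>S. e j * d j)"
  by (induction S rule: infinite_finite_induct)
    (simp_all add: monom_0 monom_power mult_monom mult.commute one_pCons)

lemma mesh_prod_monom:
  assumes "i \<in> {1..r}"
  shows "mesh_prod (\<lambda>j k. monom (c j k) (d j k)) i m =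
    (monom (mesh_prod c i m) (nat (mesh_sum (\<lambda>j k. int (d j k)) i m)) :: 'a :: comm_ring_1 poly)"
proof -
  have "int ((\<Sum>j\<in>{i<..r}. nat (- A j i) * d j m) + (\<Sum>j\<in>{1..<i}. nat (- A j i) * d j (Suc m))) =
      mesh_sum (\<lambda>j k. int (d j k)) i m"
    using of_int_exponent[where i = i, where ?'a = int] assms
    by (auto simp: mesh_sum_def intro!: arg_cong2[where f = "(+)"] sum.cong)
  then have "nat (mesh_sum (\<lambda>j k. int (d j k)) i m) =
      (\<Sum>j\<in>{i<..r}. nat (- A j i) * d j m) + (\<Sum>j\<in>{1..<i}. nat (- A j i) * d j (Suc m))"
    by linarith
  then show ?thesis by (simp add: mesh_prod_def prod_monom_power mult_monom)
qed

end

section \<open>Polynomiality and degrees in the extra variable\<close>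

locale laurent_mesh = sign_matrix +
  fixes a b :: "nat \<Rightarrow> nat \<Rightarrow> real" and n :: "nat \<Rightarrow> nat \<Rightarrow> int" and X :: "nat \<Rightarrow> real"
  assumes a_pos: "a i m > 0" and b_pos: "b i m > 0" and X_pos: "i \<in> {1..r} \<Longrightarrow> X i > 0"
    and coeff_rel: "i \<in> {1..r} \<Longrightarrow> a i m * a i (Suc m) = b i m * b i (Suc m) * mesh_prod a i m"
    and n_rel: "i \<in> {1..r} \<Longrightarrow> n i m + n i (Suc m) = mesh_sum (\<lambda>j k. pos_part (n j k)) i m"
begin

text \<open>The coefficients after adjoining the extra row \<open>n\<close>, whose value is the
  indeterminate; \<open>a\<close> and \<open>b\<close> carry the remaining rows.\<close>

definition a_mon where "a_mon i m = monom (a i m) (nat (pos_part (n i m)))"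
definition b_mon where "b_mon i m = monom (b i m) (nat (pos_part (- n i m)))"
definition F where "F = mesh_solution a_mon b_mon (\<lambda>i. [:X i:])"
definition rhs where "rhs i m = a_mon i m + b_mon i m * mesh_prod F i m"

text \<open>\<open>coeff_rel\<close> compares the scalars of the two monomials and
  \<open>n_rel\<close> their exponents.\<close>

lemma mon_rel:
  assumes i: "i \<in> {1..r}"
  shows "a_mon i m * a_mon i (Suc m) = b_mon i m * b_mon i (Suc m) * mesh_prod a_mon i m"
proof -
  let ?s = "mesh_sum (\<lambda>j k. pos_part (n j k)) i m"
  have "?s \<ge> 0" unfolding mesh_sum_def
    using off_diag i by (intro add_nonneg_nonneg sum_nonneg mult_nonneg_nonneg) auto
  then have "nat (pos_part (n i m)) + nat (pos_part (n i (Suc m))) =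
      nat (pos_part (- n i m)) + nat (pos_part (- n i (Suc m))) + nat ?s"
    using n_rel[OF i, of m] by (auto simp: pos_part_def max_def)
  then show ?thesis using coeff_rel[OF i, of m]
    by (simp add: a_mon_def [abs_def] b_mon_def mesh_prod_monom[OF i] mult_monom)
qed

lemma mon_nonneg: "t \<ge> 0 \<Longrightarrow> poly (a_mon i m) t \<ge> 0" "t \<ge> 0 \<Longrightarrow> poly (b_mon i m) t \<ge> 0"
  using a_pos[of i m] b_pos[of i m] by (auto simp: a_mon_def b_mon_def poly_monom)

text \<open>One of the two exponents is always \<open>0\<close>, so the two terms cannot both
  vanish, even at \<open>t = 0\<close>.\<close>

lemma mon_pos: "t \<ge> 0 \<Longrightarrow> poly (a_mon i m) t > 0 \<or> poly (b_mon i m) t > 0"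
  using a_pos[of i m] b_pos[of i m]
  by (cases "n i m \<ge> 0") (auto simp: a_mon_def b_mon_def poly_monom)

text \<open>Positivity yields the nonzero constant term needed to cancel monomials, the leading
  coefficient controls degrees, and the last clause says that the division was exact.\<close>

definition good :: "nat \<Rightarrow> nat \<Rightarrow> bool" where
  "good i m \<longleftrightarrow> (\<forall>t\<ge>0. poly (F i m) t > 0) \<and> lead_coeff (F i m) > 0 \<and>
     (\<forall>k. m = Suc k \<longrightarrow> F i k * F i m = rhs i k)"

lemma dvd_rhs:
  assumes i: "i \<in> {1..r}"
    and IH: "\<And>j k. j \<in> {1..r} \<Longrightarrow> k < Suc m \<or> k = Suc m \<and> j < i \<Longrightarrow> good j k"
  shows "F i m dvd rhs i m"
proof (cases m)
  case 0
  then have "is_unit (F i m)" using X_pos[OF i] by (simp add: F_def is_unit_pCons_iff)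
  then show ?thesis by (rule unit_imp_dvd)
next
  case (Suc k)
  let ?d = "F i m" and ?Z = "mesh_prod F i k" and ?Z' = "mesh_prod F i m"
  have "F i k * ?d = rhs i k" using IH[OF i, of m] Suc by (simp add: good_def)
  then have 1: "?d dvd a_mon i k + b_mon i k * ?Z" 
    using dvd_triv_right[of ?d "F i k"] by (simp only: rhs_def)
  \<comment> \<open>Between the two values in this product vertex \<open>j\<close> meets
    \<open>F i m\<close> as a neighbour: in the already updated part of its mesh if
    \<open>i < j\<close>, in the other part if \<open>j < i\<close>.\<close>
  have nb: "?d dvd F j k' * F j (Suc k') - a_mon j k'"
    if j: "j \<in> {1..r}" "j \<noteq> i" "A j i \<noteq> 0" and k': "j > i \<and> k' = k \<or> j < i \<and> k' = m" for j k'
  proof -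
    have "F j k' * F j (Suc k') = rhs j k'" using IH[OF j(1), of "Suc k'"] k' Suc by (auto simp: good_def)
    moreover have "?d dvd mesh_prod F j k'"
    proof -
      have "A i j \<le> 0" "A i j \<noteq> 0" using off_diag[of i j] zero_sym[of i j] i j by auto
      then have "nat (- A i j) > 0" by linarith
      then have 0: "?d dvd F i m ^ nat (- A i j)" by (rule dvd_power[OF disjI1])
      show ?thesis
      proof (cases "j > i")
        case True
        then have "?d dvd (\<Prod>x\<in>{1..<j}. F x (Suc k') ^ nat (- A x j))"
          using dvd_trans[OF 0] dvd_prodI[of "{1..<j}" i "\<lambda>x. F x (Suc k') ^ nat (- A x j)"]
            k' Suc i True by simp
        then show ?thesis by (simp add: mesh_prod_def)
      next
        case False
        then have "?d dvd (\<Prod>x\<in>{j<..r}. F x k' ^ nat (- A x j))"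
          using dvd_trans[OF 0] dvd_prodI[of "{j<..r}" i "\<lambda>x. F x k' ^ nat (- A x j)"]
            k' j i False by simp
        then show ?thesis by (simp add: mesh_prod_def)
      qed
    qed
    ultimately show ?thesis by (simp add: rhs_def)
  qed
  have 2: "?d dvd ?Z * ?Z' - mesh_prod a_mon i k"
  proof -
    \<comment> \<open>The mesh at \<open>(i, m)\<close> is the mesh at \<open>(i, k)\<close> with
      every neighbour advanced by one step.\<close>
    have "?Z * ?Z' = mesh_prod (\<lambda>j k. F j k * F j (Suc k)) i k"
      by (simp add: mesh_prod_mult[symmetric]) (simp add: mesh_prod_def Suc)
    moreover have "?d dvd mesh_prod (\<lambda>j k. F j k * F j (Suc k)) i k - mesh_prod a_mon i k"
      using i Suc by (intro mesh_prod_dvd_diff nb) auto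
    ultimately show ?thesis by simp
  qed
  \<comment> \<open>Multiplication by \<open>a_mon i k\<close> makes \<open>rhs i m\<close> a
    combination of known congruences; the monomial is cancelled afterwards, because
    \<open>F i m\<close> does not vanish at \<open>0\<close>.\<close>
  have "a_mon i k * rhs i m = (a_mon i k + b_mon i k * ?Z) * rhs i m
      - (a_mon i k + b_mon i k * ?Z) * a_mon i m
      - b_mon i k * b_mon i m * (?Z * ?Z' - mesh_prod a_mon i k)
      + (a_mon i k * a_mon i m - b_mon i k * b_mon i m * mesh_prod a_mon i k)"
    unfolding rhs_def by (rule exchange_identity)
  also have "a_mon i k * a_mon i m - b_mon i k * b_mon i m * mesh_prod a_mon i k = 0"
    using mon_rel[OF i, of k] Suc by simp
  finally have "?d dvd a_mon i k * rhs i m" using 1 2 by simp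
  then have "?d dvd monom (a i k) (nat (pos_part (n i k))) * rhs i m" unfolding a_mon_def .
  moreover have "poly ?d 0 > 0" using IH[OF i, of m] by (simp add: good_def)
  ultimately show ?thesis
    using a_pos[of i k] by (elim dvd_monom_mult_cancel) simp_all
qed

lemma good: "i \<in> {1..r} \<Longrightarrow> good i m"
proof (induction i m rule: sweep_induct)
  case (less i m)
  show ?case
  proof (cases m)
    case 0
    then show ?thesis using X_pos[OF less.prems] by (simp add: good_def F_def)
  next
    case (Suc k)
    have IH: "good j l" if "j \<in> {1..r}" "l < Suc k \<or> l = Suc k \<and> j < i" for j l
      using less.IH less.prems that Suc by blast
    have nb: "good j k" if "j \<in> {i<..r}" for j using IH that by auto
    have nb': "good j (Suc k)" if "j \<in> {1..<i}" for j using IH less.prems that by auto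
    have g: "good i k" using IH less.prems by auto
    have pos: "poly (rhs i k) t > 0" if t: "t \<ge> 0" for t
    proof -
      have "poly (mesh_prod F i k) t > 0" unfolding poly_mesh_prod
        using nb nb' t by (intro mesh_prod_pos) (auto simp: good_def)
      then show ?thesis
        using mon_nonneg[OF t, of i k] mon_pos[OF t, of i k]
        by (auto simp: rhs_def add_nonneg_pos add_pos_nonneg)
    qed
    have lead: "lead_coeff (rhs i k) > 0" unfolding rhs_def
    proof (rule lead_coeff_add_pos)
      show "lead_coeff (a_mon i k) > 0" using a_pos[of i k] by (simp add: a_mon_def degree_monom_eq)
      have "lead_coeff (mesh_prod F i k) > 0"
        using nb nb' by (intro lead_coeff_mesh_prod_pos) (auto simp: good_def)
      then show "lead_coeff (b_mon i k * mesh_prod F i k) > 0"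
        using b_pos[of i k] by (simp add: lead_coeff_mult) (simp add: b_mon_def degree_monom_eq)
    qed
    have "F i k dvd rhs i k" using dvd_rhs[OF less.prems IH] by simp
    moreover have "F i (Suc k) = rhs i k div F i k" by (simp add: F_def rhs_def mesh_solution_Suc)
    ultimately have eq: "F i k * F i (Suc k) = rhs i k" by simp
    have "poly (F i (Suc k)) t > 0" if t: "t \<ge> 0" for t
      using pos[OF t] g t unfolding eq[symmetric] by (auto simp: good_def zero_less_mult_iff)
    moreover have "lead_coeff (F i (Suc k)) > 0"
      using lead g unfolding eq[symmetric] lead_coeff_mult by (auto simp: good_def zero_less_mult_iff)
    ultimately show ?thesis using eq Suc by (simp add: good_def)
  qed
qed

lemma
  assumes i: "i \<in> {1..r}"
  shows F_pos: "t \<ge> 0 \<Longrightarrow> poly (F i m) t > 0"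
    and F_lead_pos: "lead_coeff (F i m) > 0"
    and F_mult: "F i m * F i (Suc m) = rhs i m"
  using good[OF i, of m] good[OF i, of "Suc m"] by (auto simp: good_def)

lemma degree_F_add:
  assumes i: "i \<in> {1..r}"
  shows "int (degree (F i m)) + int (degree (F i (Suc m))) =
    max (pos_part (n i m)) (pos_part (- n i m) + mesh_sum (\<lambda>j k. int (degree (F j k))) i m)"
proof -
  have nz: "F j k \<noteq> 0" if "j \<in> {1..r}" for j k using F_lead_pos[OF that, of k] by auto
  have lead: "lead_coeff (mesh_prod F i m) > 0"
    using F_lead_pos i by (intro lead_coeff_mesh_prod_pos) auto
  have "degree (F i m) + degree (F i (Suc m)) = degree (rhs i m)"
    using nz[OF i] by (simp add: degree_mult_eq F_mult[OF i, symmetric])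
  also have "\<dots> = max (degree (a_mon i m)) (degree (b_mon i m * mesh_prod F i m))"
    unfolding rhs_def
  proof (rule degree_add_pos)
    show "lead_coeff (a_mon i m) > 0" using a_pos[of i m] by (simp add: a_mon_def degree_monom_eq)
    show "lead_coeff (b_mon i m * mesh_prod F i m) > 0"
      using lead b_pos[of i m] by (simp add: lead_coeff_mult) (simp add: b_mon_def degree_monom_eq)
  qed
  also have "degree (b_mon i m * mesh_prod F i m) = degree (b_mon i m) + degree (mesh_prod F i m)"
    using lead b_pos[of i m] by (intro degree_mult_eq) (auto simp: b_mon_def)
  finally have "int (degree (F i m)) + int (degree (F i (Suc m))) =
      max (pos_part (n i m)) (pos_part (- n i m) + int (degree (mesh_prod F i m)))"
    using a_pos[of i m] b_pos[of i m]
    by (simp add: a_mon_def b_mon_def degree_monom_eq of_nat_max flip: of_nat_add) simp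
  then show ?thesis using degree_mesh_prod[OF i, of F m] nz i by auto
qed

end

context sign_matrix
begin

lemma mesh_sum_of_int: "mesh_sum (\<lambda>j k. of_int (c j k)) i m = (of_int (mesh_sum c i m) :: 'a :: ring_1)"
  by (simp add: mesh_sum_def)

lemma mesh_sum_add: "mesh_sum (\<lambda>j k. c j k + d j k) i m = mesh_sum c i m + mesh_sum d i m"
  by (simp add: mesh_sum_def algebra_simps sum.distrib sum_subtractf sum_negf)

lemma mesh_sum_sum: "mesh_sum (\<lambda>j k. \<Sum>x\<in>S. c j k x) i m = (\<Sum>x\<in>S. mesh_sum (\<lambda>j k. c j k x) i m)"
  by (induction S rule: infinite_finite_induct) (simp_all add: mesh_sum_add, simp_all add: mesh_sum_def)

lemma mesh_sum_mult_right: "mesh_sum (\<lambda>j k. c j k * y) i m = mesh_sum c i m * y"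
  by (simp add: mesh_sum_def sum_distrib_right distrib_right mult.assoc)

lemma mesh_sum_cong:
  assumes "\<And>j. j \<in> {i<..r} \<Longrightarrow> A j i \<noteq> 0 \<Longrightarrow> c j m = d j m"
    and "\<And>j. j \<in> {1..<i} \<Longrightarrow> A j i \<noteq> 0 \<Longrightarrow> c j (Suc m) = d j (Suc m)"
  shows "mesh_sum c i m = (mesh_sum d i m :: 'a :: ring_1)"
proof -
  have "of_int (A j i) * c j m = of_int (A j i) * d j m" if "j \<in> {i<..r}" for j
    using assms(1)[OF that] by (cases "A j i = 0") auto
  moreover have "of_int (A j i) * c j (Suc m) = of_int (A j i) * d j (Suc m)" if "j \<in> {1..<i}" for j
    using assms(2)[OF that] by (cases "A j i = 0") auto
  ultimately show ?thesis unfolding mesh_sum_def mult_minus_left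
    by (intro arg_cong2[where f = "(+)"] sum.cong arg_cong[where f = uminus]) auto
qed

end

lemma (in laurent_mesh) poly_F_step:
  assumes "i \<in> {1..r}"
  shows "poly (F i m) t * poly (F i (Suc m)) t =
    poly (a_mon i m) t + poly (b_mon i m) t * mesh_prod (\<lambda>j k. poly (F j k) t) i m"
  using arg_cong[OF F_mult[OF assms, of m], of "\<lambda>p. poly p t"] by (simp add: rhs_def poly_mesh_prod)

text \<open>What the root system has to supply: \<open>n\<close> is the row of ones,
  \<open>h i\<close> the step at which its entry turns negative, \<open>e i m\<close> the
  coordinates of \<open>c\<^sup>m \<omega>\<^sub>i\<close>, which become the exponents at
  \<open>t = 0\<close>, and \<open>st i\<close> the vertex where the orbit ends.
  \<open>h_adjacent\<close> keeps neighbours inside the region.\<close>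

locale coxeter_region = sign_matrix +
  fixes h st :: "nat \<Rightarrow> nat" and n :: "nat \<Rightarrow> nat \<Rightarrow> int" and e :: "nat \<Rightarrow> nat \<Rightarrow> nat \<Rightarrow> int"
  assumes h_adjacent: "i \<in> {1..r} \<Longrightarrow> j \<in> {1..r} \<Longrightarrow> i < j \<Longrightarrow> A j i \<noteq> 0 \<Longrightarrow> h j \<le> h i \<and> h i \<le> Suc (h j)"
    and h_pos: "i \<in> {1..r} \<Longrightarrow> h i > 0"
    and n_mesh: "i \<in> {1..r} \<Longrightarrow> n i m + n i (Suc m) = mesh_sum (\<lambda>j k. pos_part (n j k)) i m"
    and n_initial: "i \<in> {1..r} \<Longrightarrow> (\<Sum>j\<in>{1..<i}. - A j i * pos_part (n j 0)) \<le> n i 0"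
    and n_pos: "i \<in> {1..r} \<Longrightarrow> m < h i \<Longrightarrow> n i m > 0"
    and n_neg: "i \<in> {1..r} \<Longrightarrow> n i (h i) < 0"
    and e_initial: "i \<in> {1..r} \<Longrightarrow> k \<in> {1..r} \<Longrightarrow> e i 0 k = (if k = i then 1 else 0)"
    and e_mesh: "i \<in> {1..r} \<Longrightarrow> k \<in> {1..r} \<Longrightarrow> m < h i \<Longrightarrow>
      e i m k + e i (Suc m) k = mesh_sum (\<lambda>j m. e j m k) i m"
    and e_final: "i \<in> {1..r} \<Longrightarrow> k \<in> {1..r} \<Longrightarrow> e i (h i) k = (if k = st i then - 1 else 0)"
    and st_range: "i \<in> {1..r} \<Longrightarrow> st i \<in> {1..r}"

section \<open>Periodicity over one region, for arbitrary coefficient rows\<close>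

locale region_data = coxeter_region +
  fixes l :: nat and p :: "nat \<Rightarrow> nat \<Rightarrow> nat \<Rightarrow> int"
  assumes p_mesh: "i \<in> {1..r} \<Longrightarrow> k \<in> {1..l} \<Longrightarrow> p i m k + p i (Suc m) k = mesh_sum (\<lambda>j m. pos_part (p j m k)) i m"
begin

text \<open>The values \<open>q\<close> of the coefficient variables stay free positive reals,
  because the exponents are determined later by varying them.\<close>

definition cf :: "(nat \<Rightarrow> real) \<Rightarrow> nat \<Rightarrow> nat \<Rightarrow> real" where
  "cf q i m = (\<Prod>k\<in>{1..l}. q k ^ nat (pos_part (p i m k)))"
definition cf' :: "(nat \<Rightarrow> real) \<Rightarrow> nat \<Rightarrow> nat \<Rightarrow> real" where
  "cf' q i m = (\<Prod>k\<in>{1..l}. q k ^ nat (pos_part (- p i m k)))"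

definition positive :: "nat \<Rightarrow> (nat \<Rightarrow> real) \<Rightarrow> bool" where
  "positive N q \<longleftrightarrow> (\<forall>k\<in>{1..N}. q k > 0)"

lemma
  assumes q: "positive l q"
  shows cf_pos: "cf q i m > 0" "cf' q i m > 0"
    and ln_cf: "ln (cf q i m) = (\<Sum>k\<in>{1..l}. pos_part (p i m k) * ln (q k))"
    and ln_cf': "ln (cf' q i m) = (\<Sum>k\<in>{1..l}. pos_part (- p i m k) * ln (q k))"
proof -
  have q': "q k > 0" "q k \<noteq> 0" if "k \<in> {1..l}" for k using q that by (auto simp: positive_def less_le)
  show "cf q i m > 0" "cf' q i m > 0" using q' by (auto simp: cf_def cf'_def intro!: prod_pos)
  show "ln (cf q i m) = (\<Sum>k\<in>{1..l}. pos_part (p i m k) * ln (q k))"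
    unfolding cf_def using q' by (subst ln_prod) (simp, simp, rule sum.cong, auto simp: ln_realpow)
  show "ln (cf' q i m) = (\<Sum>k\<in>{1..l}. pos_part (- p i m k) * ln (q k))"
    unfolding cf'_def using q' by (subst ln_prod) (simp, simp, rule sum.cong, auto simp: ln_realpow)
qed

text \<open>Logarithms turn the claim into the linear recursion \<open>p_mesh\<close>, one
  coefficient row at a time.\<close>

lemma cf_mesh:
  assumes q: "positive l q" and i: "i \<in> {1..r}"
  shows "cf q i m * cf q i (Suc m) = cf' q i m * cf' q i (Suc m) * mesh_prod (cf q) i m"
proof -
  note pos = cf_pos[OF q]
  have mp: "mesh_prod (cf q) i m > 0" using pos by (intro mesh_prod_pos) auto
  have "ln (mesh_prod (cf q) i m) = mesh_sum (\<lambda>j k. ln (cf q j k)) i m"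
    using pos i by (intro ln_mesh_prod) auto
  also have "\<dots> = (\<Sum>k\<in>{1..l}. real_of_int (mesh_sum (\<lambda>j m. pos_part (p j m k)) i m) * ln (q k))"
    by (simp add: ln_cf[OF q] mesh_sum_sum mesh_sum_mult_right mesh_sum_of_int)
  also have "\<dots> = (\<Sum>k\<in>{1..l}. real_of_int (p i m k + p i (Suc m) k) * ln (q k))"
    using p_mesh[OF i] by (intro sum.cong refl) metis
  also have "\<dots> = ln (cf q i m) + ln (cf q i (Suc m)) - ln (cf' q i m) - ln (cf' q i (Suc m))"
    unfolding ln_cf[OF q] ln_cf'[OF q] sum.distrib[symmetric] sum_subtractf[symmetric]
  proof (intro sum.cong refl)
    fix k
    have "p i m k = pos_part (p i m k) - pos_part (- p i m k)"
      "p i (Suc m) k = pos_part (p i (Suc m) k) - pos_part (- p i (Suc m) k)"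
      by (simp_all add: pos_part_diff)
    then have "real_of_int (p i m k + p i (Suc m) k) = real_of_int (pos_part (p i m k))
      + real_of_int (pos_part (p i (Suc m) k)) - real_of_int (pos_part (- p i m k)) - real_of_int (pos_part (- p i (Suc m) k))"
      by linarith
    then show "real_of_int (p i m k + p i (Suc m) k) * ln (q k) = pos_part (p i m k) * ln (q k) + pos_part (p i (Suc m) k) * ln (q k)
      - pos_part (- p i m k) * ln (q k) - pos_part (- p i (Suc m) k) * ln (q k)"
      by (simp only: left_diff_distrib distrib_right)
  qed
  finally have "ln (cf q i m * cf q i (Suc m)) = ln (cf' q i m * cf' q i (Suc m) * mesh_prod (cf q) i m)"
    using pos mp by (simp add: ln_mult_pos)
  then show ?thesis using pos mp by (subst (asm) ln_inj_iff) auto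
qed

lemma laurent_mesh:
  assumes "positive l q" "positive r X"
  shows "laurent_mesh r A (cf q) (cf' q) n X"
  using cf_pos[OF assms(1)] cf_mesh[OF assms(1)] n_mesh assms(2)
  by unfold_locales (auto simp: positive_def)

definition G where "G q X = laurent_mesh.F r A (cf q) (cf' q) n X"

text \<open>At \<open>t = 0\<close> a positive extra entry removes the first term; at step
  \<open>h i\<close> the entry is negative and the term with the neighbours disappears
  instead.\<close>

lemma G_simps:
  assumes qX: "positive l q" "positive r X" and i: "i \<in> {1..r}"
  shows G_0: "G q X i 0 = [:X i:]"
    and G_pos: "t \<ge> 0 \<Longrightarrow> poly (G q X i m) t > 0"
    and G_at_1: "poly (G q X i m) 1 * poly (G q X i (Suc m)) 1 =
      cf q i m + cf' q i m * mesh_prod (\<lambda>j k. poly (G q X j k) 1) i m"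
    and G_at_0: "m < h i \<Longrightarrow> poly (G q X i m) 0 * poly (G q X i (Suc m)) 0 =
      cf' q i m * mesh_prod (\<lambda>j k. poly (G q X j k) 0) i m"
    and G_at_0_final: "poly (G q X i (h i)) 0 * poly (G q X i (Suc (h i))) 0 = cf q i (h i)"
    and degree_G_add: "int (degree (G q X i m)) + int (degree (G q X i (Suc m))) =
      max (pos_part (n i m)) (pos_part (- n i m) + mesh_sum (\<lambda>j k. int (degree (G q X j k))) i m)"
proof -
  interpret L: laurent_mesh r A "cf q" "cf' q" n X by (rule laurent_mesh[OF qX])
  have G: "G q X = L.F" by (simp add: G_def)
  show "G q X i 0 = [:X i:]" by (simp add: G L.F_def)
  show "t \<ge> 0 \<Longrightarrow> poly (G q X i m) t > 0" unfolding G by (rule L.F_pos[OF i])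
  show "poly (G q X i m) 1 * poly (G q X i (Suc m)) 1 =
      cf q i m + cf' q i m * mesh_prod (\<lambda>j k. poly (G q X j k) 1) i m"
    unfolding G L.poly_F_step[OF i] by (simp add: L.a_mon_def L.b_mon_def poly_monom)
  show "poly (G q X i m) 0 * poly (G q X i (Suc m)) 0 =
      cf' q i m * mesh_prod (\<lambda>j k. poly (G q X j k) 0) i m" if "m < h i"
    unfolding G L.poly_F_step[OF i] using n_pos[OF i that]
    by (simp add: L.a_mon_def L.b_mon_def poly_monom)
  show "poly (G q X i (h i)) 0 * poly (G q X i (Suc (h i))) 0 = cf q i (h i)"
    unfolding G L.poly_F_step[OF i] using n_neg[OF i]
    by (simp add: L.a_mon_def L.b_mon_def poly_monom)
  show "int (degree (G q X i m)) + int (degree (G q X i (Suc m))) =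
      max (pos_part (n i m)) (pos_part (- n i m) + mesh_sum (\<lambda>j k. int (degree (G q X j k))) i m)"
    unfolding G by (rule L.degree_F_add[OF i])
qed

lemma neighbour_index:
  assumes i: "i \<in> {1..r}" "m \<le> h i" and A: "A j i \<noteq> 0"
  shows "j \<in> {i<..r} \<Longrightarrow> m \<le> Suc (h j)" "j \<in> {1..<i} \<Longrightarrow> m \<le> h j"
proof -
  show "m \<le> Suc (h j)" if "j \<in> {i<..r}" using h_adjacent[of i j] i A that by force
  show "m \<le> h j" if "j \<in> {1..<i}" using h_adjacent[of j i] zero_sym[of i j] i A that by force
qed

text \<open>Write \<open>m = Suc k\<close>. By induction the neighbours contribute
  \<open>n i k + n i m\<close>, so the maximum in \<open>degree_G_add\<close> is
  \<open>n i k + pos_part (n i m)\<close>, and \<open>n i k\<close> is the degree of the previous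
  value. For \<open>m = 0\<close> the values \<open>G q X j 0\<close> are constants and
  \<open>n_initial\<close> decides the maximum.\<close>

lemma degree_G:
  assumes qX: "positive l q" "positive r X"
  shows "i \<in> {1..r} \<Longrightarrow> m \<le> h i \<Longrightarrow> int (degree (G q X i (Suc m))) = pos_part (n i m)"
proof (induction i m rule: sweep_induct)
  case (less i m)
  have i: "i \<in> {1..r}" by (rule less.prems)
  let ?d = "\<lambda>j k. int (degree (G q X j k))"
  have deg: "?d i m + ?d i (Suc m) = max (pos_part (n i m)) (pos_part (- n i m) + mesh_sum ?d i m)"
    by (rule degree_G_add[OF qX i])
  have lower: "?d j (Suc m) = pos_part (n j m)" if "j \<in> {1..<i}" "A j i \<noteq> 0" for j
    using less.IH[of m j] neighbour_index(2)[OF i less.prems(2) that(2,1)] that i by auto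
  show ?case
  proof (cases m)
    case 0
    have "mesh_sum ?d i m = (\<Sum>j\<in>{1..<i}. - A j i * pos_part (n j 0))"
    proof -
      have "?d j 0 = 0" if "j \<in> {i<..r}" for j using G_0[OF qX, of j] that i by auto
      then have "mesh_sum ?d i m = mesh_sum (\<lambda>j k. if k = 0 then 0 else pos_part (n j 0)) i m"
        using lower 0 by (intro mesh_sum_cong) auto
      then show ?thesis by (simp add: mesh_sum_def 0)
    qed
    moreover have "n i 0 > 0" using n_pos[OF i] h_pos[OF i] by simp
    ultimately show ?thesis using deg n_initial[OF i] G_0[OF qX i] 0 by simp
  next
    case (Suc k)
    have "?d j m = pos_part (n j k)" if "j \<in> {i<..r}" "A j i \<noteq> 0" for j
      using less.IH[of k j] neighbour_index(1)[OF i less.prems(2) that(2,1)] that i Suc by auto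
    then have "mesh_sum ?d i m = mesh_sum (\<lambda>j k. pos_part (n j (k - 1))) i m"
      using lower Suc by (intro mesh_sum_cong) auto
    also have "\<dots> = mesh_sum (\<lambda>j k. pos_part (n j k)) i k" by (simp add: mesh_sum_def Suc)
    also have "\<dots> = n i k + n i m" using n_mesh[OF i, of k] Suc by simp
    finally have s: "mesh_sum ?d i m = n i k + n i m" .
    have k: "n i k > 0" using n_pos[OF i, of k] less.prems Suc by simp
    have "?d i m = n i k" using less.IH[of k i] less.prems Suc k by simp
    then show ?thesis using deg s k by (auto simp: pos_part_def)
  qed
qed

lemma G_final_const:
  assumes qX: "positive l q" "positive r X" and i: "i \<in> {1..r}"
  shows "poly (G q X i (Suc (h i))) s = poly (G q X i (Suc (h i))) t"
proof -
  have "degree (G q X i (Suc (h i))) = 0" using degree_G[OF qX i, of "h i"] n_neg[OF i] by simp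
  then show ?thesis by (auto elim!: degree_eq_zeroE)
qed

text \<open>The relations at \<open>t = 0\<close> are monomial, hence linear after taking
  logarithms; the part in \<open>X\<close> follows \<open>e_mesh\<close>. The exponents
  \<open>v\<close> are chosen before \<open>q\<close> and \<open>X\<close>, which is what makes the
  later limit argument possible.\<close>

lemma ln_G_at_0:
  "i \<in> {1..r} \<Longrightarrow> m \<le> h i \<Longrightarrow> \<exists>v :: nat \<Rightarrow> int. \<forall>q X. positive l q \<longrightarrow> positive r X \<longrightarrow>
     ln (poly (G q X i m) 0) = (\<Sum>k\<in>{1..r}. e i m k * ln (X k)) + (\<Sum>k\<in>{1..l}. v k * ln (q k))"
proof (induction i m rule: sweep_induct)
  case (less i m)
  have i: "i \<in> {1..r}" by (rule less.prems)
  show ?case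
  proof (cases m)
    case 0
    have "ln (poly (G q X i m) 0) = (\<Sum>k\<in>{1..r}. e i m k * ln (X k)) + (\<Sum>k\<in>{1..l}. 0 * ln (q k))"
      if "positive l q" "positive r X" for q X
    proof -
      have "(\<Sum>k\<in>{1..r}. e i m k * ln (X k)) = (\<Sum>k\<in>{1..r}. if k = i then ln (X k) else 0)"
        using e_initial[OF i] 0 by (intro sum.cong) auto
      then show ?thesis using G_0[OF that i] i 0 by (simp add: sum.delta)
    qed
    then show ?thesis by (intro exI[of _ "\<lambda>_. 0"]) simp
  next
    case (Suc m')
    let ?P = "\<lambda>j k v. \<forall>q X. positive l q \<longrightarrow> positive r X \<longrightarrow>
      ln (poly (G q X j k) 0) = (\<Sum>x\<in>{1..r}. e j k x * ln (X x)) + (\<Sum>x\<in>{1..l}. real_of_int (v x) * ln (q x))"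
    define V where "V j k = (SOME v. ?P j k v)" for j k
    have V: "?P j k (V j k)" if "j \<in> {1..r}" "k < m \<or> k = m \<and> j < i" "k \<le> h j" for j k
      unfolding V_def using less.IH[OF that(2,1,3)] by (rule someI_ex)
    let ?v = "\<lambda>k. pos_part (- p i m' k) + mesh_sum (\<lambda>j m. V j m k) i m' - V i m' k"
    have "ln (poly (G q X i m) 0) = (\<Sum>x\<in>{1..r}. e i m x * ln (X x)) + (\<Sum>x\<in>{1..l}. ?v x * ln (q x))"
      if qX: "positive l q" "positive r X" for q X
    proof -
      let ?g = "\<lambda>j k. poly (G q X j k) 0"
      have pos: "?g j k > 0" if "j \<in> {1..r}" for j k by (rule G_pos[OF qX that]) simp
      have m': "m' < h i" using less.prems Suc by simp
      have mp: "mesh_prod ?g i m' > 0" using pos i by (intro mesh_prod_pos) auto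
      have "ln (?g i m') + ln (?g i m) = ln (cf' q i m' * mesh_prod ?g i m')"
        using G_at_0[OF qX i m'] pos[OF i] Suc by (simp flip: ln_mult_pos)
      also have "\<dots> = ln (cf' q i m') + mesh_sum (\<lambda>j k. ln (?g j k)) i m'"
        using mp cf_pos(2)[OF qX(1)] pos i by (subst ln_mult_pos) (auto intro!: ln_mesh_prod)
      also have "mesh_sum (\<lambda>j k. ln (?g j k)) i m' =
        mesh_sum (\<lambda>j k. (\<Sum>x\<in>{1..r}. e j k x * ln (X x)) + (\<Sum>x\<in>{1..l}. V j k x * ln (q x))) i m'"
      proof (rule mesh_sum_cong)
        fix j assume "j \<in> {i<..r}" "A j i \<noteq> 0"
        then show "ln (?g j m') = (\<Sum>x\<in>{1..r}. e j m' x * ln (X x)) + (\<Sum>x\<in>{1..l}. V j m' x * ln (q x))"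
          using V[of j m'] neighbour_index(1)[OF i less.prems(2), of j] qX i Suc by auto
      next
        fix j assume "j \<in> {1..<i}" "A j i \<noteq> 0"
        then show "ln (?g j (Suc m')) = (\<Sum>x\<in>{1..r}. e j (Suc m') x * ln (X x)) + (\<Sum>x\<in>{1..l}. V j (Suc m') x * ln (q x))"
          using V[of j m] neighbour_index(2)[OF i less.prems(2), of j] qX i Suc by auto
      qed
      also have "\<dots> = (\<Sum>x\<in>{1..r}. mesh_sum (\<lambda>j k. e j k x) i m' * ln (X x)) +
          (\<Sum>x\<in>{1..l}. mesh_sum (\<lambda>j k. V j k x) i m' * ln (q x))"
        by (simp add: mesh_sum_add mesh_sum_sum mesh_sum_mult_right mesh_sum_of_int)
      also have "(\<Sum>x\<in>{1..r}. mesh_sum (\<lambda>j k. e j k x) i m' * ln (X x)) =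
          (\<Sum>x\<in>{1..r}. e i m' x * ln (X x)) + (\<Sum>x\<in>{1..r}. e i m x * ln (X x))"
        unfolding sum.distrib[symmetric]
      proof (intro sum.cong refl)
        fix x assume "x \<in> {1..r}"
        then show "mesh_sum (\<lambda>j k. e j k x) i m' * ln (X x) = e i m' x * ln (X x) + e i m x * ln (X x)"
          using e_mesh[OF i _ m', of x] Suc by (simp flip: distrib_right of_int_add)
      qed
      finally have "ln (?g i m') + ln (?g i m) = ln (cf' q i m') +
        ((\<Sum>x\<in>{1..r}. e i m' x * ln (X x)) + (\<Sum>x\<in>{1..r}. e i m x * ln (X x)) +
         (\<Sum>x\<in>{1..l}. mesh_sum (\<lambda>j k. V j k x) i m' * ln (q x)))" .
      moreover have "ln (?g i m') = (\<Sum>x\<in>{1..r}. e i m' x * ln (X x)) + (\<Sum>x\<in>{1..l}. V i m' x * ln (q x))"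
        using V[OF i, of m'] m' Suc qX by simp
      ultimately show ?thesis
        by (simp add: ln_cf'[OF qX(1)] distrib_right left_diff_distrib sum.distrib sum_subtractf)
    qed
    then show ?thesis by (intro exI[of _ ?v]) blast
  qed
qed

text \<open>At step \<open>h i\<close> the product of two consecutive values at \<open>t = 0\<close>
  is a pure coefficient, so the last value inverts the previous one, whose \<open>X\<close>-part is
  the inverse of \<open>X (st i)\<close>.\<close>

lemma ln_G_final:
  assumes i: "i \<in> {1..r}"
  obtains v :: "nat \<Rightarrow> int" where "\<And>q X t. positive l q \<Longrightarrow> positive r X \<Longrightarrow>
     ln (poly (G q X i (Suc (h i))) t) = ln (X (st i)) + (\<Sum>k\<in>{1..l}. v k * ln (q k))"
proof -
  obtain v :: "nat \<Rightarrow> int" where v: "\<And>q X. positive l q \<Longrightarrow> positive r X \<Longrightarrow>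
     ln (poly (G q X i (h i)) 0) = (\<Sum>k\<in>{1..r}. e i (h i) k * ln (X k)) + (\<Sum>k\<in>{1..l}. v k * ln (q k))"
    using ln_G_at_0[OF i, of "h i"] by auto
  let ?v = "\<lambda>k. pos_part (p i (h i) k) - v k"
  have "ln (poly (G q X i (Suc (h i))) t) = ln (X (st i)) + (\<Sum>k\<in>{1..l}. ?v k * ln (q k))"
    if qX: "positive l q" "positive r X" for q X t
  proof -
    have "(\<Sum>k\<in>{1..r}. e i (h i) k * ln (X k)) = (\<Sum>k\<in>{1..r}. if k = st i then - ln (X k) else 0)"
      using e_final[OF i] by (intro sum.cong) auto
    then have "ln (poly (G q X i (h i)) 0) = - ln (X (st i)) + (\<Sum>k\<in>{1..l}. v k * ln (q k))"
      using v[OF qX] st_range[OF i] by (simp add: sum.delta)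
    moreover have "ln (poly (G q X i (h i)) 0) + ln (poly (G q X i (Suc (h i))) 0) = ln (cf q i (h i))"
      using G_at_0_final[OF qX i] G_pos[OF qX i, of 0] by (simp flip: ln_mult_pos)
    ultimately have "ln (poly (G q X i (Suc (h i))) 0) = ln (X (st i)) + (\<Sum>k\<in>{1..l}. ?v k * ln (q k))"
      by (simp add: ln_cf[OF qX(1)] left_diff_distrib sum_subtractf)
    then show ?thesis using G_final_const[OF qX i, of t 0] by simp
  qed
  then show ?thesis by (rule that)
qed

text \<open>One of the two coefficients of every exchange relation is \<open>1\<close> at \<open>q\<^sub>k = 0\<close>, so the
  solution stays bounded and bounded away from zero as \<open>q\<^sub>k\<close> tends to \<open>0\<close>.\<close>

lemma bounded_near_zero:
  assumes X: "positive r X" and \<kappa>: "\<kappa> \<in> {1..l}"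
  shows "i \<in> {1..r} \<Longrightarrow> \<exists>K>0. \<forall>s\<in>{0<..1}.
    inverse K \<le> poly (G (\<lambda>k. if k = \<kappa> then s else 1) X i m) 1 \<and> poly (G (\<lambda>k. if k = \<kappa> then s else 1) X i m) 1 \<le> K"
proof (induction i m rule: sweep_induct)
  case (less i m)
  have i: "i \<in> {1..r}" by (rule less.prems)
  let ?q = "\<lambda>s k. if k = \<kappa> then s else (1 :: real)"
  let ?g = "\<lambda>s j k. poly (G (?q s) X j k) 1"
  have q: "positive l (?q s)" if "s \<in> {0<..1}" for s using that by (simp add: positive_def)
  show ?case
  proof (cases m)
    case 0
    have "?g s i m = X i" if "s \<in> {0<..1}" for s using G_0[OF q[OF that] X i] 0 by simp
    moreover have "X i > 0" using X i by (simp add: positive_def)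
    moreover have "inverse (max (X i) (inverse (X i))) \<le> X i"
      using \<open>X i > 0\<close> by (metis inverse_inverse_eq inverse_positive_iff_positive le_imp_inverse_le max.cobounded2)
    ultimately show ?thesis
      by (intro exI[of _ "max (X i) (inverse (X i))"]) (auto simp: less_max_iff_disj)
  next
    case (Suc m')
    let ?P = "\<lambda>j k K. K > 0 \<and> (\<forall>s\<in>{0<..1}. inverse K \<le> ?g s j k \<and> ?g s j k \<le> K)"
    define K where "K j k = (SOME K. ?P j k K)" for j k
    have K: "?P j k (K j k)" if "j \<in> {1..r}" "k < m \<or> k = m \<and> j < i" for j k
      unfolding K_def using less.IH[OF that(2,1)] by (rule someI_ex)
    have near: "?P j m' (K j m')" if "j \<in> {i..r}" for j using K[of j m'] that i Suc by simp
    have near': "?P j (Suc m') (K j (Suc m'))" if "j \<in> {1..<i}" for j using K[of j m] that i Suc by simp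
    let ?L = "mesh_prod (\<lambda>j k. inverse (K j k)) i m'" and ?U = "mesh_prod K i m'"
    \<comment> \<open>The right-hand side lies between \<open>inverse (1 + inverse ?L)\<close>, a
      common lower bound of \<open>1\<close> and \<open>?L\<close>, and \<open>1 + ?U\<close>;
      dividing by the previous value costs the factor \<open>K i m'\<close>. \<open>M\<close>
      dominates both resulting bounds.\<close>
    define M where "M = (1 + ?U + inverse ?L) * K i m'"
    have L: "?L > 0" "?U > 0" using near near' by (auto intro!: mesh_prod_pos)
    have Ki: "K i m' > 0" using near i by simp
    then have M: "M > 0" using L by (simp add: M_def add_pos_pos)
    have "inverse M \<le> ?g s i m \<and> ?g s i m \<le> M" if s: "s \<in> {0<..1}" for s
    proof -
      let ?\<Pi> = "mesh_prod (?g s) i m'"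
      let ?a = "cf (?q s) i m'" and ?b = "cf' (?q s) i m'"
      have bd: "0 \<le> inverse (K j k) \<and> inverse (K j k) \<le> ?g s j k" "0 \<le> ?g s j k \<and> ?g s j k \<le> K j k"
        if "?P j k (K j k)" for j k
      proof -
        have "0 < inverse (K j k)" "inverse (K j k) \<le> ?g s j k" "?g s j k \<le> K j k" using that s by auto
        then show "0 \<le> inverse (K j k) \<and> inverse (K j k) \<le> ?g s j k" "0 \<le> ?g s j k \<and> ?g s j k \<le> K j k"
          by linarith+
      qed
      have \<Pi>: "?L \<le> ?\<Pi>" "?\<Pi> \<le> ?U"
        by (intro mesh_prod_mono bd near near'; simp)+
      have "?a = s ^ nat (pos_part (p i m' \<kappa>))" "?b = s ^ nat (pos_part (- p i m' \<kappa>))"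
        using \<kappa> by (simp_all add: cf_def cf'_def if_distrib[of "\<lambda>x. x ^ _"] cong: if_cong)
      then have ab: "0 \<le> ?a" "?a \<le> 1" "0 \<le> ?b" "?b \<le> 1" "?a = 1 \<or> ?b = 1"
        using s by (simp_all add: power_le_one) (cases "p i m' \<kappa> \<ge> 0"; simp)
      have rel: "?g s i m' * ?g s i m = ?a + ?b * ?\<Pi>"
        using G_at_1[OF q[OF s] X i, of m'] Suc by simp
      have g: "?g s i m' > 0" "?g s i m > 0" using G_pos[OF q[OF s] X i] by auto
      have up: "?a + ?b * ?\<Pi> \<le> 1 + ?U"
        using ab \<Pi> L mult_mono[of ?b 1 ?\<Pi> ?U] by simp
      have low: "inverse (1 + inverse ?L) \<le> ?a + ?b * ?\<Pi>"
      proof -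
        have "inverse (1 + inverse ?L) \<le> 1" "inverse (1 + inverse ?L) \<le> ?L"
          using L by (simp_all add: field_simps)
        moreover have "?a + ?b * ?\<Pi> \<ge> 1 \<or> ?a + ?b * ?\<Pi> \<ge> ?L"
          using ab \<Pi> L by (auto intro: mult_nonneg_nonneg add_increasing)
        ultimately show ?thesis by linarith
      qed
      have nb: "inverse (K i m') \<le> ?g s i m'" "?g s i m' \<le> K i m'" using near s i by auto
      have "inverse M \<le> inverse (1 + inverse ?L) * inverse (K i m')"
        unfolding M_def inverse_mult_distrib[symmetric] using L Ki
        by (intro le_imp_inverse_le mult_right_mono) (auto intro!: mult_pos_pos add_pos_pos)
      also have "\<dots> \<le> (?g s i m' * ?g s i m) * inverse (?g s i m')"
        unfolding rel using low nb g L Ki ab \<Pi>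
        by (intro mult_mono le_imp_inverse_le) (auto intro!: add_nonneg_nonneg mult_nonneg_nonneg)
      also have "\<dots> = ?g s i m" using g by simp
      finally have 1: "inverse M \<le> ?g s i m" .
      have "?g s i m = (?g s i m' * ?g s i m) * inverse (?g s i m')" using g by simp
      also have "\<dots> \<le> (1 + ?U) * K i m'"
      proof (rule mult_mono)
        show "inverse (?g s i m') \<le> K i m'"
          using le_imp_inverse_le[OF nb(1)] Ki by simp
      qed (use rel up g L in auto)
      also have "\<dots> \<le> M" unfolding M_def using L Ki by (intro mult_right_mono) auto
      finally show ?thesis using 1 by simp
    qed
    then show ?thesis using M by blast
  qed
qed

lemma G_final:
  assumes qX: "positive l q" "positive r X" and i: "i \<in> {1..r}"
  shows "poly (G q X i (Suc (h i))) t = X (st i)"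
proof -
  obtain v :: "nat \<Rightarrow> int" where v: "\<And>q X t. positive l q \<Longrightarrow> positive r X \<Longrightarrow>
     ln (poly (G q X i (Suc (h i))) t) = ln (X (st i)) + (\<Sum>k\<in>{1..l}. v k * ln (q k))"
    using ln_G_final[OF i] by blast
  have "v \<kappa> = 0" if \<kappa>: "\<kappa> \<in> {1..l}" for \<kappa>
  proof (rule ccontr)
    assume "v \<kappa> \<noteq> 0"
    obtain K where K: "K > 0" "\<And>s. s \<in> {0<..1} \<Longrightarrow>
      inverse K \<le> poly (G (\<lambda>k. if k = \<kappa> then s else 1) X i (Suc (h i))) 1 \<and>
      poly (G (\<lambda>k. if k = \<kappa> then s else 1) X i (Suc (h i))) 1 \<le> K"
      using bounded_near_zero[OF qX(2) \<kappa> i, of "Suc (h i)"] by blast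
    define M where "M = \<bar>ln K\<bar> + \<bar>ln (X (st i))\<bar>"
    \<comment> \<open>As \<open>ln ?s = - (M + 1)\<close>, a nonzero integer
      \<open>v \<kappa>\<close> would move \<open>ln ?g\<close> by at least \<open>M + 1\<close>
      away from \<open>ln (X (st i))\<close>, while the bounds allow at most \<open>M\<close>. All
      other coefficients are \<open>1\<close>, so only \<open>v \<kappa>\<close> is seen.\<close>
    let ?s = "exp (- (M + 1))"
    let ?q = "\<lambda>k. if k = \<kappa> then ?s else (1 :: real)"
    let ?g = "poly (G ?q X i (Suc (h i))) 1"
    have s: "?s \<in> {0<..1}" by (simp add: M_def)
    have q: "positive l ?q" by (simp add: positive_def)
    have g: "?g > 0" by (rule G_pos[OF q qX(2) i]) simp
    have "ln (inverse K) \<le> ln ?g" "ln ?g \<le> ln K"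
      using K(1) K(2)[OF s] g by (intro ln_mono, simp_all)+
    then have "\<bar>ln ?g\<bar> \<le> \<bar>ln K\<bar>" using K(1) by (simp add: ln_inverse)
    moreover have "ln ?g = ln (X (st i)) + v \<kappa> * ln ?s"
      using v[OF q qX(2)] \<kappa> by (simp add: if_distrib[of ln] if_distrib[of "\<lambda>x. _ * x"] cong: if_cong)
    then have "v \<kappa> * (M + 1) = ln (X (st i)) - ln ?g" by (simp add: algebra_simps)
    ultimately have "\<bar>v \<kappa> * (M + 1)\<bar> \<le> M" by (simp add: M_def)
    moreover have "1 * (M + 1) \<le> \<bar>real_of_int (v \<kappa>)\<bar> * (M + 1)"
      using \<open>v \<kappa> \<noteq> 0\<close> by (intro mult_right_mono) (auto simp: M_def)
    moreover have "\<bar>real_of_int (v \<kappa>) * (M + 1)\<bar> = \<bar>real_of_int (v \<kappa>)\<bar> * (M + 1)"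
      by (simp add: abs_mult M_def)
    ultimately show False by simp
  qed
  then have "ln (poly (G q X i (Suc (h i))) t) = ln (X (st i))" for t using v[OF qX, of t] by simp
  from this[of 0] have "poly (G q X i (Suc (h i))) 0 = X (st i)"
    using G_pos[OF qX i, of 0] qX(2) st_range[OF i] by (subst (asm) ln_inj_iff) (auto simp: positive_def)
  then show ?thesis using G_final_const[OF qX i, of t 0] by simp
qed

text \<open>A positive solution is determined by its values at \<open>m = 0\<close>, so it coincides
  with the polynomials \<open>G\<close> at \<open>t = 1\<close>.\<close>

lemma region_periodicity:
  fixes u :: "nat \<Rightarrow> nat \<Rightarrow> real"
  assumes q: "positive l q" and i: "i \<in> {1..r}"
    and pos: "\<And>j m. j \<in> {1..r} \<Longrightarrow> u j m > 0"
    and rel: "\<And>j m. j \<in> {1..r} \<Longrightarrow> u j m * u j (Suc m) = cf q j m + cf' q j m * mesh_prod u j m"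
  shows "u i (Suc (h i)) = u (st i) 0"
proof -
  let ?X = "\<lambda>j. u j 0"
  have X: "positive r ?X" using pos by (simp add: positive_def)
  have "j \<in> {1..r} \<Longrightarrow> poly (G q ?X j m) 1 = u j m" for j m
  proof (induction j m rule: sweep_induct)
    case (less j m)
    show ?case
    proof (cases m)
      case 0 then show ?thesis using G_0[OF q X less.prems] by simp
    next
      case (Suc m')
      have IH: "poly (G q ?X x k) 1 = u x k" if "x \<in> {1..r}" "k < m \<or> k = m \<and> x < j" for x k
        by (rule less.IH[OF that(2,1)])
      have "mesh_prod (\<lambda>j k. poly (G q ?X j k) 1) j m' = mesh_prod u j m'"
        unfolding mesh_prod_def using IH less.prems Suc
        by (intro arg_cong2[where f = "(*)"] prod.cong refl arg_cong2[where f = "(^)"]) auto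
      then have "u j m' * poly (G q ?X j m) 1 = u j m' * u j m"
        using G_at_1[OF q X less.prems, of m'] rel[OF less.prems, of m'] IH[OF less.prems, of m'] Suc by simp
      then show ?thesis using pos[OF less.prems, of m'] by simp
    qed
  qed
  from this[OF i, of "Suc (h i)"] show ?thesis using G_final[OF q X i, of 1] by simp
qed

end

section \<open>Root systems\<close>

text \<open>Off-diagonal terms occur in equal pairs. In \<open>root_sign\<close> this makes a
  positive norm at least twice its unit.\<close>

lemma even_sum_symmetric:
  fixes N :: "'b \<Rightarrow> 'b \<Rightarrow> int"
  assumes "finite S" "\<And>k l. k \<in> S \<Longrightarrow> l \<in> S \<Longrightarrow> N k l = N l k" "\<And>k. k \<in> S \<Longrightarrow> even (N k k)"
  shows "even (\<Sum>k\<in>S. \<Sum>l\<in>S. N k l)"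
  using assms
proof (induction S rule: finite_induct)
  case (insert x S)
  have "(\<Sum>k\<in>S. N k x) = (\<Sum>l\<in>S. N x l)" using insert.prems by (intro sum.cong) auto
  then have "(\<Sum>k\<in>insert x S. \<Sum>l\<in>insert x S. N k l) = N x x + 2 * (\<Sum>l\<in>S. N x l) + (\<Sum>k\<in>S. \<Sum>l\<in>S. N k l)"
    using insert.hyps by (simp add: sum.distrib)
  then show ?case using insert by simp
qed simp

text \<open>Completing the square in one variable reduces the dimension.\<close>

lemma pos_def_form_bound:
  fixes q :: "'b \<Rightarrow> 'b \<Rightarrow> real"
  assumes "finite S" "\<And>i j. i \<in> S \<Longrightarrow> j \<in> S \<Longrightarrow> q i j = q j i"
    and "\<And>x. (\<exists>i\<in>S. x i \<noteq> 0) \<Longrightarrow> (\<Sum>i\<in>S. \<Sum>j\<in>S. q i j * x i * x j) > 0"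
  shows "\<exists>\<epsilon>>0. \<forall>x. \<epsilon> * (\<Sum>i\<in>S. (x i)\<^sup>2) \<le> (\<Sum>i\<in>S. \<Sum>j\<in>S. q i j * x i * x j)"
  using assms
proof (induction S arbitrary: q rule: finite_induct)
  case empty
  show ?case by (intro exI[of _ 1]) simp
next
  case (insert k S)
  let ?Q = "\<lambda>x. \<Sum>i\<in>insert k S. \<Sum>j\<in>insert k S. q i j * x i * x j"
  define L where "L x = (\<Sum>i\<in>S. q k i * x i) / q k k" for x
  define q' where "q' i j = q i j - q k i * q k j / q k k" for i j
  let ?Q' = "\<lambda>x. \<Sum>i\<in>S. \<Sum>j\<in>S. q' i j * x i * x j"
  have "?Q (\<lambda>i. if i = k then 1 else 0) > 0" by (rule insert.prems(2)) auto
  moreover have "?Q (\<lambda>i. if i = k then 1 else 0) = q k k"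
    using insert.hyps by (simp add: if_distrib sum.If_cases cong: if_cong) (auto intro!: sum.neutral)
  ultimately have qk: "q k k > 0" by simp
  have split: "?Q x = q k k * (x k + L x)\<^sup>2 + ?Q' x" for x
  proof -
    have "(\<Sum>i\<in>S. q i k * x i * x k) = (\<Sum>i\<in>S. q k i * x i) * x k"
      using insert.prems(1) by (auto simp: sum_distrib_right intro!: sum.cong)
    moreover have "(\<Sum>i\<in>S. q k i * x k * x i) = (\<Sum>i\<in>S. q k i * x i) * x k"
      by (simp add: sum_distrib_left mult_ac)
    ultimately have "?Q x = q k k * (x k)\<^sup>2 + 2 * ((\<Sum>i\<in>S. q k i * x i) * x k) + (\<Sum>i\<in>S. \<Sum>j\<in>S. q i j * x i * x j)"
      using insert.hyps by (simp add: sum.distrib power2_eq_square)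
    moreover have "?Q' x = (\<Sum>i\<in>S. \<Sum>j\<in>S. q i j * x i * x j) - (\<Sum>i\<in>S. q k i * x i)\<^sup>2 / q k k"
      by (simp add: q'_def left_diff_distrib right_diff_distrib sum_subtractf power2_eq_square sum_product sum_divide_distrib mult_ac)
    moreover have "q k k * (x k + L x)\<^sup>2 = q k k * (x k)\<^sup>2 + 2 * ((\<Sum>i\<in>S. q k i * x i) * x k) + (\<Sum>i\<in>S. q k i * x i)\<^sup>2 / q k k"
      using qk by (simp add: L_def power2_sum field_simps power2_eq_square)
    ultimately show ?thesis by simp
  qed
  have "\<exists>\<epsilon>>0. \<forall>x. \<epsilon> * (\<Sum>i\<in>S. (x i)\<^sup>2) \<le> ?Q' x"
  proof (rule insert.IH)
    show "q' i j = q' j i" if "i \<in> S" "j \<in> S" for i j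
      using insert.prems(1)[of i j] that by (simp add: q'_def mult.commute)
    fix x :: "'b \<Rightarrow> real" assume x: "\<exists>i\<in>S. x i \<noteq> 0"
    \<comment> \<open>The value at \<open>k\<close> that makes the completed square vanish, leaving
      the reduced form.\<close>
    let ?y = "\<lambda>i. if i = k then - L x else x i"
    have *: "L ?y = L x" "?Q' ?y = ?Q' x"
      unfolding L_def using insert.hyps by (auto intro!: arg_cong2[where f = "(/)"] sum.cong)
    have "?Q ?y > 0" using x insert.hyps by (intro insert.prems(2)) auto
    then show "?Q' x > 0" unfolding split * by simp
  qed
  then obtain \<epsilon> where \<epsilon>: "\<epsilon> > 0" "\<And>x. \<epsilon> * (\<Sum>i\<in>S. (x i)\<^sup>2) \<le> ?Q' x" by blast
  define M where "M = (\<Sum>i\<in>S. (q k i / q k k)\<^sup>2)"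
  have M: "M \<ge> 0" by (simp add: M_def sum_nonneg)
  have L: "(L x)\<^sup>2 \<le> M * (\<Sum>i\<in>S. (x i)\<^sup>2)" for x
    using Cauchy_Schwarz_ineq_sum[of "\<lambda>i. q k i / q k k" x S]
    by (simp add: L_def M_def sum_divide_distrib)
  \<comment> \<open>Trading \<open>x k\<close> for \<open>x k + L x\<close> costs a factor 2 and a
    multiple of \<open>(L x)\<^sup>2\<close>. Then \<open>2 * \<delta>\<close> must stay below
    \<open>q k k\<close>, and \<open>\<delta> * (2 * M + 1)\<close> below
    \<open>\<epsilon>\<close>.\<close>
  define \<delta> where "\<delta> = min (q k k / 2) (\<epsilon> / (2 * M + 1))"
  have "\<delta> > 0" using qk \<epsilon> M by (simp add: \<delta>_def)
  moreover have "\<delta> * (\<Sum>i\<in>insert k S. (x i)\<^sup>2) \<le> ?Q x" for x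
  proof -
    let ?s = "\<Sum>i\<in>S. (x i)\<^sup>2"
    have s: "?s \<ge> 0" by (simp add: sum_nonneg)
    have "(x k)\<^sup>2 \<le> 2 * (x k + L x)\<^sup>2 + 2 * (L x)\<^sup>2"
      using zero_le_power2[of "x k + 2 * L x"] by (simp add: power2_eq_square algebra_simps)
    then have "(x k)\<^sup>2 + ?s \<le> 2 * (x k + L x)\<^sup>2 + (2 * M + 1) * ?s"
      using L[of x] by (simp add: algebra_simps)
    then have "\<delta> * ((x k)\<^sup>2 + ?s) \<le> \<delta> * (2 * (x k + L x)\<^sup>2 + (2 * M + 1) * ?s)"
      using \<open>\<delta> > 0\<close> by (intro mult_left_mono) auto
    also have "\<dots> = (2 * \<delta>) * (x k + L x)\<^sup>2 + (\<delta> * (2 * M + 1)) * ?s" by (simp add: algebra_simps)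
    also have "\<dots> \<le> q k k * (x k + L x)\<^sup>2 + \<epsilon> * ?s"
    proof (intro add_mono mult_right_mono)
      have "\<delta> \<le> q k k / 2" unfolding \<delta>_def by (rule min.cobounded1)
      then show "2 * \<delta> \<le> q k k" by simp
      have "\<delta> * (2 * M + 1) \<le> (\<epsilon> / (2 * M + 1)) * (2 * M + 1)"
        using M by (intro mult_right_mono) (auto simp: \<delta>_def)
      then show "\<delta> * (2 * M + 1) \<le> \<epsilon>" using M by simp
    qed (use s in auto)
    also have "\<dots> \<le> ?Q x" unfolding split using \<epsilon>(2)[of x] by simp
    finally show ?thesis using insert.hyps by simp
  qed
  ultimately show ?case by blast
qed

section \<open>Reflections on weights and on the root lattice, and the invariant form\<close>

locale cartan =
  fixes r :: nat and A :: "nat \<Rightarrow> nat \<Rightarrow> int" and d :: "nat \<Rightarrow> real"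
  assumes diag: "i \<in> {1..r} \<Longrightarrow> A i i = 2"
    and off_diag': "i \<in> {1..r} \<Longrightarrow> j \<in> {1..r} \<Longrightarrow> i \<noteq> j \<Longrightarrow> A i j \<le> 0"
    and d_pos: "i \<in> {1..r} \<Longrightarrow> d i > 0"
    and d_sym: "i \<in> {1..r} \<Longrightarrow> j \<in> {1..r} \<Longrightarrow> d i * of_int (A i j) = d j * of_int (A j i)"
    and pos_def: "(\<exists>i\<in>{1..r}. x i \<noteq> 0) \<Longrightarrow>
      (\<Sum>i\<in>{1..r}. \<Sum>j\<in>{1..r}. x i * (d i * of_int (A i j)) * x j) > 0"

sublocale cartan \<subseteq> sign_matrix r A
proof
  show "A j i = 0" if "i \<in> {1..r}" "j \<in> {1..r}" "A i j = 0" for i j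
    using d_sym[OF that(1,2)] that d_pos[OF that(2)] by simp
qed (rule off_diag')

context cartan
begin

text \<open>Elements of the root lattice are given by their coordinates in the basis of simple roots.
  As a function, the simple root \<open>\<alpha>\<^sub>i\<close> is then the same as the fundamental weight \<open>\<omega>\<^sub>i\<close>.\<close>

definition coroot :: "nat \<Rightarrow> (nat \<Rightarrow> int) \<Rightarrow> int" where
  "coroot i x = (\<Sum>j\<in>{1..r}. A i j * x j)"

text \<open>The inclusion of the root lattice into the weight lattice, from simple-root coordinates
  to fundamental-weight coordinates.\<close>

definition wt :: "(nat \<Rightarrow> int) \<Rightarrow> weight" where
  "wt x = (\<lambda>k. if k \<in> {1..r} then coroot k x else 0)"

definition refl :: "nat \<Rightarrow> (nat \<Rightarrow> int) \<Rightarrow> nat \<Rightarrow> int" where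
  "refl i x = x(i := x i - coroot i x)"

definition root_word :: "nat list \<Rightarrow> (nat \<Rightarrow> int) \<Rightarrow> nat \<Rightarrow> int" where
  "root_word is = foldr (\<lambda>i w. refl i \<circ> w) is id"

text \<open>The Weyl-invariant form between weights and root lattice, normalised so that the simple
  root \<open>i\<close> has norm \<open>2 * d i\<close>.\<close>

definition pairing :: "weight \<Rightarrow> (nat \<Rightarrow> int) \<Rightarrow> real" where
  "pairing v x = (\<Sum>k\<in>{1..r}. d k * of_int (v k * x k))"

abbreviation simple :: "nat \<Rightarrow> nat \<Rightarrow> int" where "simple \<equiv> fund_weight"

abbreviation weight_word :: "nat list \<Rightarrow> weight \<Rightarrow> weight" where "weight_word \<equiv> refl_word r A"

abbreviation word :: "nat list \<Rightarrow> bool" where "word is \<equiv> set is \<subseteq> {1..r}"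

lemma root_word_simps [simp]: "root_word [] x = x" "root_word (i # is) x = refl i (root_word is x)" "root_word (is @ js) x = root_word is (root_word js x)"
  by (simp_all add: root_word_def) (induction "is"; simp)

lemma weight_word_simps [simp]: "weight_word [] v = v" "weight_word (i # is) v = simple_refl r A i (weight_word is v)"
  "weight_word (is @ js) v = weight_word is (weight_word js v)"
  by (simp_all add: refl_word_def) (induction "is"; simp)

lemma simple_refl_linear:
  "simple_refl r A i (\<lambda>k. a * v k + b * w k) = (\<lambda>k. a * simple_refl r A i v k + b * simple_refl r A i w k)"
  by (auto simp: simple_refl_def algebra_simps)

lemma weight_word_linear: "weight_word is (\<lambda>k. a * v k + b * w k) = (\<lambda>k. a * weight_word is v k + b * weight_word is w k)"
  by (induction "is") (simp_all add: simple_refl_linear)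

lemma coroot_linear: "coroot i (\<lambda>k. a * x k + b * y k) = a * coroot i x + b * coroot i y"
  by (simp add: coroot_def sum_distrib_left sum.distrib algebra_simps)

lemma wt_linear: "wt (\<lambda>k. a * x k + b * y k) = (\<lambda>k. a * wt x k + b * wt y k)"
  by (auto simp: wt_def coroot_linear)

lemma refl_linear: "refl i (\<lambda>k. a * x k + b * y k) = (\<lambda>k. a * refl i x k + b * refl i y k)"
  by (auto simp: refl_def coroot_linear algebra_simps)

lemma root_word_linear: "root_word is (\<lambda>k. a * x k + b * y k) = (\<lambda>k. a * root_word is x k + b * root_word is y k)"
  by (induction "is") (simp_all add: refl_linear)

lemma root_word_uminus: "root_word is (\<lambda>k. - x k) = (\<lambda>k. - root_word is x k)"
  using root_word_linear[of "is" "-1" x 0 x] by simp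

lemma weight_word_uminus: "weight_word is (\<lambda>k. - x k) = (\<lambda>k. - weight_word is x k)"
  using weight_word_linear[of "is" "-1" x 0 x] by simp

lemma weight_word_diff: "weight_word is (\<lambda>k. v k - w k) = (\<lambda>k. weight_word is v k - weight_word is w k)"
  using weight_word_linear[of "is" 1 v "-1" w] by simp

lemma root_word_zero: "root_word is (\<lambda>k. 0) = (\<lambda>k. 0)"
  using root_word_linear[of "is" 0 "\<lambda>_. 0" 0 "\<lambda>_. 0"] by simp

lemma weight_word_zero: "weight_word is (\<lambda>k. 0) = (\<lambda>k. 0)"
  using weight_word_linear[of "is" 0 "\<lambda>_. 0" 0 "\<lambda>_. 0"] by simp

lemma root_word_sum: "root_word is (\<lambda>k. \<Sum>j\<in>S. c j * x j k) = (\<lambda>k. \<Sum>j\<in>S. c j * root_word is (x j) k)"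
proof (induction S rule: infinite_finite_induct)
  case (insert y S)
  then show ?case using root_word_linear[of "is" "c y" "x y" 1 "\<lambda>k. \<Sum>j\<in>S. c j * x j k"] by simp
qed (simp_all add: root_word_zero)

lemma weight_word_sum: "weight_word is (\<lambda>k. \<Sum>j\<in>S. c j * x j k) = (\<lambda>k. \<Sum>j\<in>S. c j * weight_word is (x j) k)"
proof (induction S rule: infinite_finite_induct)
  case (insert y S)
  then show ?case using weight_word_linear[of "is" "c y" "x y" 1 "\<lambda>k. \<Sum>j\<in>S. c j * x j k"] by simp
qed (simp_all add: weight_word_zero)

lemma coroot_simple: "j \<in> {1..r} \<Longrightarrow> coroot i (simple j) = A i j"
  by (simp add: coroot_def fund_weight_def if_distrib[of "\<lambda>x. _ * x"] cong: if_cong)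

lemma wt_simple: "j \<in> {1..r} \<Longrightarrow> wt (simple j) = simple_root r A j"
  by (auto simp: wt_def simple_root_def coroot_simple)

lemma refl_eq: "refl i x = (\<lambda>k. x k - coroot i x * simple i k)"
  by (auto simp: refl_def fund_weight_def)

lemma coroot_refl: "i \<in> {1..r} \<Longrightarrow> coroot k (refl i x) = coroot k x - coroot i x * A k i"
  using coroot_linear[of k 1 x "- coroot i x" "simple i"] by (simp add: refl_eq coroot_simple)

lemma refl_refl [simp]: "i \<in> {1..r} \<Longrightarrow> refl i (refl i x) = x"
  by (auto simp: refl_def[of i "refl i x"] coroot_refl diag) (auto simp: refl_def)

lemma simple_refl_wt: "i \<in> {1..r} \<Longrightarrow> simple_refl r A i (wt x) = wt (refl i x)"
  by (auto simp: simple_refl_def simple_root_def wt_def coroot_refl)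

lemma weight_word_wt: "word is \<Longrightarrow> weight_word is (wt x) = wt (root_word is x)"
  by (induction "is") (simp_all add: simple_refl_wt)

lemma simple_refl_simple_refl [simp]:
  "i \<in> {1..r} \<Longrightarrow> simple_refl r A i (simple_refl r A i v) = v"
  by (auto simp: simple_refl_def simple_root_def diag)

lemma weight_word_rev [simp]: "word is \<Longrightarrow> weight_word (rev is) (weight_word is v) = v" "word is \<Longrightarrow> weight_word is (weight_word (rev is) v) = v"
proof -
  show *: "word is \<Longrightarrow> weight_word (rev is) (weight_word is v) = v" for "is" by (induction "is") auto
  show "word is \<Longrightarrow> weight_word is (weight_word (rev is) v) = v" using *[of "rev is"] by simp
qed

lemma root_word_rev [simp]: "word is \<Longrightarrow> root_word (rev is) (root_word is x) = x" "word is \<Longrightarrow> root_word is (root_word (rev is) x) = x"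
proof -
  show *: "word is \<Longrightarrow> root_word (rev is) (root_word is x) = x" for "is" by (induction "is") auto
  show "word is \<Longrightarrow> root_word is (root_word (rev is) x) = x" using *[of "rev is"] by simp
qed

lemma root_word_support: "word is \<Longrightarrow> k \<notin> {1..r} \<Longrightarrow> root_word is x k = x k"
  by (induction "is") (auto simp: refl_def)

lemma weight_word_support: "word is \<Longrightarrow> k \<notin> {1..r} \<Longrightarrow> weight_word is v k = v k"
  by (induction "is") (auto simp: simple_refl_def simple_root_def)

lemma coroot_sym: "i \<in> {1..r} \<Longrightarrow> d i * of_int (coroot i x) = pairing (simple_root r A i) x"
proof -
  assume i: "i \<in> {1..r}"
  have "d i * of_int (coroot i x) = (\<Sum>j\<in>{1..r}. (d i * of_int (A i j)) * of_int (x j))"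
    by (simp add: coroot_def sum_distrib_left mult.assoc)
  also have "\<dots> = (\<Sum>j\<in>{1..r}. (d j * of_int (A j i)) * of_int (x j))"
    using d_sym[OF i] by (intro sum.cong) auto
  finally show ?thesis by (simp add: pairing_def simple_root_def mult.assoc)
qed

lemma pairing_linear_left: "pairing (\<lambda>k. a * v k + b * w k) x = of_int a * pairing v x + of_int b * pairing w x"
  by (simp add: pairing_def sum_distrib_left sum.distrib algebra_simps)

lemma pairing_linear_right: "pairing v (\<lambda>k. a * x k + b * y k) = of_int a * pairing v x + of_int b * pairing v y"
  by (simp add: pairing_def sum_distrib_left sum.distrib algebra_simps)

lemma pairing_uminus: "pairing (\<lambda>k. - v k) x = - pairing v x" "pairing v (\<lambda>k. - x k) = - pairing v x"
  by (simp_all add: pairing_def sum_negf)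

lemma pairing_simple: "i \<in> {1..r} \<Longrightarrow> pairing v (simple i) = d i * of_int (v i)"
  by (simp add: pairing_def fund_weight_def if_distrib[of "\<lambda>x. _ * x"] if_distrib[of of_int] cong: if_cong)

lemma pairing_fund: "i \<in> {1..r} \<Longrightarrow> pairing (fund_weight i) x = d i * of_int (x i)"
  by (simp add: pairing_def fund_weight_def if_distrib[of "\<lambda>y. y * _"] if_distrib[of of_int]
      if_distrib[of "\<lambda>x. _ * x"] cong: if_cong)

lemma pairing_refl:
  assumes i: "i \<in> {1..r}"
  shows "pairing (simple_refl r A i v) (refl i x) = pairing v x"
proof -
  have s: "simple_refl r A i v = (\<lambda>k. 1 * v k + (- v i) * simple_root r A i k)"
    by (simp add: simple_refl_def)
  have x: "refl i x = (\<lambda>k. 1 * x k + (- coroot i x) * simple i k)" by (simp add: refl_eq)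
  have "pairing (simple_root r A i) (simple i) = 2 * d i"
    using i by (simp add: pairing_simple simple_root_def diag)
  moreover have "pairing (simple_root r A i) x = d i * of_int (coroot i x)" using coroot_sym[OF i] by simp
  moreover have "simple_root r A i i = 2" using i by (simp add: simple_root_def diag)
  ultimately show ?thesis
    unfolding s x pairing_linear_left pairing_linear_right pairing_simple[OF i]
    by (simp add: algebra_simps)
qed

lemma pairing_word: "word is \<Longrightarrow> pairing (weight_word is v) (root_word is x) = pairing v x"
  by (induction "is") (simp_all add: pairing_refl)

lemma pairing_wt: "pairing (wt x) y = (\<Sum>i\<in>{1..r}. \<Sum>j\<in>{1..r}. d i * of_int (A i j) * of_int (y i) * of_int (x j))"
  by (simp add: pairing_def wt_def coroot_def sum_distrib_left sum_distrib_right mult_ac)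

lemma pairing_wt_sym: "pairing (wt x) y = pairing (wt y) x"
  unfolding pairing_wt
  by (subst sum.swap) (intro sum.cong refl, use d_sym in \<open>auto simp: mult_ac\<close>)

lemma pairing_wt_diff:
  "pairing (wt (\<lambda>k. u k - v k)) (\<lambda>k. u k - v k) = pairing (wt u) u + pairing (wt v) v - 2 * pairing (wt u) v"
  using wt_linear[of 1 u "-1" v] pairing_linear_left[of 1 "wt u" "-1" "wt v"]
    pairing_linear_right[of _ 1 u "-1" v] pairing_wt_sym[of v u] by simp

lemma pairing_wt_pos: "\<exists>k\<in>{1..r}. x k \<noteq> 0 \<Longrightarrow> pairing (wt x) x > 0"
  using pos_def[of "\<lambda>k. of_int (x k)"] by (simp add: pairing_wt mult_ac)

text \<open>Positive definiteness makes the Cartan matrix injective, so identities in the root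
  lattice can be checked on weights.\<close>

lemma wt_inj:
  assumes "wt x = wt y" "\<And>k. k \<notin> {1..r} \<Longrightarrow> x k = y k"
  shows "x = y"
proof (rule ccontr)
  assume "x \<noteq> y"
  then obtain k where "x k \<noteq> y k" by auto
  then have "\<exists>k\<in>{1..r}. x k - y k \<noteq> 0" using assms(2)[of k] by (intro bexI[of _ k]) auto
  then have "pairing (wt (\<lambda>k. x k - y k)) (\<lambda>k. x k - y k) > 0" by (rule pairing_wt_pos)
  moreover have "wt (\<lambda>k. x k - y k) = (\<lambda>k. 0)" using wt_linear[of 1 x "-1" y] assms(1) by simp
  ultimately show False by (simp add: pairing_def)
qed

section \<open>Roots and their signs\<close>

definition root_of :: "nat \<Rightarrow> (nat \<Rightarrow> int) \<Rightarrow> bool" where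
  "root_of j x \<longleftrightarrow> j \<in> {1..r} \<and> (\<exists>is. word is \<and> x = root_word is (simple j))"

definition root :: "(nat \<Rightarrow> int) \<Rightarrow> bool" where "root x \<longleftrightarrow> (\<exists>j. root_of j x)"

definition nonneg :: "(nat \<Rightarrow> int) \<Rightarrow> bool" where "nonneg x \<longleftrightarrow> (\<forall>k. x k \<ge> 0)"

lemma root_of_root_word: "root_of j x \<Longrightarrow> word is \<Longrightarrow> root_of j (root_word is x)"
  unfolding root_of_def by (metis le_sup_iff root_word_simps(3) set_append)

lemma root_root_word: "root x \<Longrightarrow> word is \<Longrightarrow> root (root_word is x)"
  unfolding root_def using root_of_root_word by blast

lemma root_simple: "j \<in> {1..r} \<Longrightarrow> root_of j (simple j)" "j \<in> {1..r} \<Longrightarrow> root (simple j)"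
  unfolding root_def root_of_def by (auto intro!: exI[of _ "[]"] exI[of _ j])

lemma root_support: "root x \<Longrightarrow> k \<notin> {1..r} \<Longrightarrow> x k = 0"
  unfolding root_def root_of_def using root_word_support by (auto simp: fund_weight_def)

lemma root_norm: "root_of j x \<Longrightarrow> pairing (wt x) x = 2 * d j"
proof -
  assume "root_of j x"
  then obtain "is" where "is": "word is" "x = root_word is (simple j)" "j \<in> {1..r}" by (auto simp: root_of_def)
  then have "pairing (wt x) x = pairing (wt (simple j)) (simple j)"
    using weight_word_wt[of "is"] pairing_word[of "is"] by metis
  then show ?thesis using "is" by (simp add: pairing_simple wt_simple simple_root_def diag)
qed

lemma root_nonzero: "root x \<Longrightarrow> \<exists>k. x k \<noteq> 0"
proof (rule ccontr)
  assume "root x" "\<not> (\<exists>k. x k \<noteq> 0)"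
  then obtain j where "root_of j x" "pairing (wt x) x = 0" by (auto simp: root_def pairing_def)
  then show False using root_norm[of j x] d_pos[of j] by (simp add: root_of_def)
qed

text \<open>The integers \<open>z\<close> are the coordinates of the coroot of \<open>x\<close> in
  the basis of simple coroots.\<close>

lemma root_integral:
  assumes "root_of j x" "k \<in> {1..r}"
  shows "\<exists>z::int. d k * of_int (x k) = d j * of_int z"
proof -
  have "j \<in> {1..r} \<Longrightarrow> word is \<Longrightarrow> \<forall>k\<in>{1..r}. \<exists>z::int. d k * of_int (root_word is (simple j) k) = d j * of_int z" for "is"
  proof (induction "is")
    case Nil
    then show ?case by (auto simp: fund_weight_def intro: exI[of _ 0] exI[of _ 1])
  next
    case (Cons i "is")
    let ?x = "root_word is (simple j)"
    have "\<forall>k\<in>{1..r}. \<exists>z::int. d k * of_int (?x k) = d j * of_int z" using Cons by simp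
    then obtain z where z: "\<And>k. k \<in> {1..r} \<Longrightarrow> d k * of_int (?x k) = d j * of_int (z k :: int)"
      by metis
    have "d i * of_int (coroot i ?x) = (\<Sum>k\<in>{1..r}. of_int (A k i) * (d k * of_int (?x k)))"
      using coroot_sym[of i ?x] Cons.prems by (simp add: pairing_def simple_root_def mult_ac)
    also have "\<dots> = d j * of_int (\<Sum>k\<in>{1..r}. A k i * z k)"
      using z by (simp add: sum_distrib_left mult_ac)
    finally have "d i * of_int (?x i - coroot i ?x) = d j * of_int (z i - (\<Sum>k\<in>{1..r}. A k i * z k))"
      using z[of i] Cons.prems by (simp add: right_diff_distrib)
    then show ?case using z by (auto simp: refl_def simp del: of_int_diff of_int_sum)
  qed
  then show ?thesis using assms by (auto simp: root_of_def)
qed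

text \<open>For a root \<open>x = u - v\<close> with positive part \<open>u\<close> and negative part \<open>v\<close>, the norms of \<open>u\<close> and
  \<open>v\<close> are multiples of the norm of \<open>x\<close>, while \<open>(u, v) \<le> 0\<close>. So \<open>u\<close> or \<open>v\<close> vanishes.\<close>

lemma root_sign:
  assumes x: "root x"
  shows "nonneg x \<or> nonneg (\<lambda>k. - x k)"
proof (rule ccontr)
  assume "\<not> ?thesis"
  then obtain k k' where k: "x k < 0" "x k' > 0" by (auto simp: nonneg_def not_le)
  obtain j where j: "root_of j x" using x by (auto simp: root_def)
  then have j': "j \<in> {1..r}" by (simp add: root_of_def)
  have kr: "k \<in> {1..r}" "k' \<in> {1..r}" using root_support[OF x, of k] root_support[OF x, of k'] k by auto
  obtain z where z: "\<And>k. k \<in> {1..r} \<Longrightarrow> d k * of_int (x k) = d j * of_int (z k :: int)"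
    using root_integral[OF j] by metis
  \<comment> \<open>Replacing one factor of the form by the integers \<open>w\<close> exhibits the
    norm of \<open>y\<close> as \<open>d j\<close> times an even integer; being positive, that
    integer is at least 2.\<close>
  have big: "2 * d j \<le> pairing (wt y) y"
    if y: "\<And>k. y k = 0 \<or> y k = x k \<or> y k = - x k" "\<exists>k\<in>{1..r}. y k \<noteq> 0" for y
  proof -
    have "\<exists>w::int. d k * of_int (y k) = d j * of_int w" if "k \<in> {1..r}" for k
    proof -
      consider "y k = 0" | "y k = x k" | "y k = - x k" using y(1) by blast
      then show ?thesis
      proof cases
        case 1 then show ?thesis by (intro exI[of _ 0]) simp
      next
        case 2 then show ?thesis using z[OF that] by (intro exI[of _ "z k"]) simp
      next
        case 3 then show ?thesis using z[OF that] by (intro exI[of _ "- z k"]) simp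
      qed
    qed
    then obtain w where w: "\<And>k. k \<in> {1..r} \<Longrightarrow> d k * of_int (y k) = d j * of_int (w k :: int)" by metis
    let ?N = "\<lambda>k l. w k * A k l * y l"
    have N: "d j * of_int (?N k l) = d k * of_int (A k l) * of_int (y k) * of_int (y l)" if "k \<in> {1..r}" for k l
      using w[OF that] by (simp add: mult_ac)
    have "pairing (wt y) y = d j * of_int (\<Sum>k\<in>{1..r}. \<Sum>l\<in>{1..r}. ?N k l)"
      unfolding pairing_wt of_int_sum sum_distrib_left by (intro sum.cong refl) (rule N[symmetric], simp)
    moreover have "even (\<Sum>k\<in>{1..r}. \<Sum>l\<in>{1..r}. ?N k l)"
    proof (rule even_sum_symmetric)
      fix k l assume kl: "k \<in> {1..r}" "l \<in> {1..r}"
      have "d j * of_int (?N k l) = d j * of_int (?N l k)"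
        unfolding N[OF kl(1)] N[OF kl(2)] d_sym[OF kl] by simp
      then show "?N k l = ?N l k" using d_pos[OF j'] by (simp del: of_int_mult)
    qed (auto simp: diag)
    moreover have "pairing (wt y) y > 0" by (rule pairing_wt_pos[OF y(2)])
    moreover define c where "c = (\<Sum>k\<in>{1..r}. \<Sum>l\<in>{1..r}. ?N k l)"
    ultimately have c: "pairing (wt y) y = d j * of_int c" "even c" "d j * of_int c > 0" by simp_all
    then have "c > 0" using d_pos[OF j'] by (simp add: zero_less_mult_iff)
    then have "c \<ge> 2" using c(2) by presburger
    then have "d j * 2 \<le> d j * of_int c" using d_pos[OF j'] by (intro mult_left_mono) auto
    then show ?thesis using c(1) by simp
  qed
  let ?u = "\<lambda>k. max (x k) 0" and ?v = "\<lambda>k. max (- x k) 0"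
  have "(\<lambda>k. ?u k - ?v k) = x" by (auto simp: max_def)
  then have "pairing (wt x) x = pairing (wt ?u) ?u + pairing (wt ?v) ?v - 2 * pairing (wt ?u) ?v"
    using pairing_wt_diff[of ?u ?v] by simp
  moreover have "pairing (wt ?u) ?v \<le> 0"
    unfolding pairing_wt
  proof (intro sum_nonpos)
    fix k l assume kl: "k \<in> {1..r}" "l \<in> {1..r}"
    show "d k * of_int (A k l) * of_int (?v k) * of_int (?u l) \<le> 0"
    proof (cases "k = l")
      case False
      then have "d k * of_int (A k l) \<le> 0" using off_diag[OF kl] d_pos[OF kl(1)] by (simp add: mult_nonneg_nonpos)
      then have "d k * of_int (A k l) * of_int (?v k) \<le> 0" by (rule mult_nonpos_nonneg) simp
      then show ?thesis by (rule mult_nonpos_nonneg) simp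
    qed (auto simp: max_def)
  qed
  moreover have "2 * d j \<le> pairing (wt ?u) ?u" "2 * d j \<le> pairing (wt ?v) ?v"
  proof -
    show "2 * d j \<le> pairing (wt ?u) ?u"
      by (rule big) (use k kr in \<open>auto intro!: bexI[of _ k'] split: split_max\<close>)
    show "2 * d j \<le> pairing (wt ?v) ?v"
      by (rule big) (use k kr in \<open>auto intro!: bexI[of _ k] split: split_max\<close>)
  qed
  ultimately show False using root_norm[OF j] d_pos[OF j'] by simp
qed

text \<open>The reflection changes coordinate \<open>i\<close> only, so all other coordinates of
  \<open>x\<close> vanish; comparing lengths through \<open>root_integral\<close> makes the
  remaining one \<open>1\<close>.\<close>

lemma refl_negative:
  assumes x: "root x" "nonneg x" and i: "i \<in> {1..r}" and neg: "\<not> nonneg (refl i x)"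
  shows "x = simple i"
proof -
  have rt: "root (refl i x)" using root_root_word[OF x(1), of "[i]"] i by simp
  then have n: "nonneg (\<lambda>k. - refl i x k)" using root_sign neg by blast
  have 0: "x k = 0" if "k \<noteq> i" for k
    using n x(2) that by (auto simp: nonneg_def refl_def dest!: spec[of _ k])
  then have xi: "x = (\<lambda>k. x i * simple i k + 0 * x k)" by (auto simp: fund_weight_def)
  obtain j where j: "root_of j x" using x by (auto simp: root_def)
  obtain z :: int where z: "d i * of_int (x i) = d j * of_int z" using root_integral[OF j i] by blast
  have "pairing (wt x) x = (of_int (x i))\<^sup>2 * (2 * d i)"
  proof -
    have "pairing (wt x) x = of_int (x i) * pairing (wt x) (simple i)"
      by (subst (2) xi, subst pairing_linear_right) simp
    also have "pairing (wt x) (simple i) = of_int (x i) * pairing (wt (simple i)) (simple i)"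
      by (subst xi, subst wt_linear, subst pairing_linear_left) simp
    also have "pairing (wt (simple i)) (simple i) = 2 * d i"
      using i by (simp add: pairing_simple wt_simple simple_root_def diag)
    finally show ?thesis by (simp add: power2_eq_square)
  qed
  then have "d j = (d i * of_int (x i)) * of_int (x i)"
    using root_norm[OF j] by (simp add: power2_eq_square)
  then have "d j = d j * of_int (z * x i)" unfolding z by simp
  moreover have "d j > 0" using d_pos j by (auto simp: root_of_def)
  ultimately have "of_int (z * x i) = (1 :: real)" by simp
  then have "z * x i = 1" by (simp only: of_int_eq_1_iff)
  moreover have "x i \<ge> 0" using x(2) by (simp add: nonneg_def)
  ultimately have "x i = 1" by (auto simp: zmult_eq_1_iff)
  then show ?thesis using 0 by (auto simp: fund_weight_def)
qed

text \<open>Some letter turns a positive root into a negative one, and by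
  \<open>refl_negative\<close> a letter does this only to its own simple root. Both the exchange
  condition and the root at the end of a Coxeter orbit come from here.\<close>

lemma crossing:
  assumes "word is" "root x" "nonneg x" "\<not> nonneg (root_word is x)"
  obtains us k vs where "is = us @ k # vs" "root_word vs x = simple k"
proof -
  have "\<exists>us k vs. is = us @ k # vs \<and> root_word vs x = simple k" using assms
  proof (induction "is")
    case (Cons i "is")
    show ?case
    proof (cases "nonneg (root_word is x)")
      case True
      then have "root_word is x = simple i" using refl_negative[of "root_word is x" i] root_root_word Cons.prems by simp
      then show ?thesis by (intro exI[of _ "[]"]) auto
    next
      case False
      then obtain us k vs where "is = us @ k # vs" "root_word vs x = simple k" using Cons by auto
      then show ?thesis by (intro exI[of _ "i # us"]) auto
    qed
  qed simp
  then show ?thesis using that by blast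
qed

lemma not_both_signs: "root x \<Longrightarrow> nonneg x \<Longrightarrow> \<not> nonneg (\<lambda>k. - x k)"
  using root_nonzero[of x] by (auto simp: nonneg_def) (metis order_antisym)

lemma root_uminus: "root x \<Longrightarrow> root (\<lambda>k. - x k)"
proof -
  assume "root x"
  then obtain j "is" where j: "j \<in> {1..r}" "word is" "x = root_word is (simple j)" by (auto simp: root_def root_of_def)
  have "(\<lambda>k. - simple j k) = refl j (simple j)"
    using j by (simp add: refl_eq coroot_simple diag)
  then have "(\<lambda>k. - x k) = root_word (is @ [j]) (simple j)" using root_word_uminus[of "is" "simple j"] j by simp
  moreover have "word (is @ [j])" using j by simp
  ultimately show ?thesis using j unfolding root_def root_of_def by blast
qed

end

section \<open>Orbits of the Coxeter element\<close>

lemma upt_split: "i \<le> j \<Longrightarrow> j \<le> k \<Longrightarrow> [i..<k] = [i..<j] @ [j..<k]"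
  by (metis le_add_diff_inverse upt_add_eq_append)

lemma upt_split_Cons: "i \<le> j \<Longrightarrow> j < k \<Longrightarrow> [i..<k] = [i..<j] @ j # [Suc j..<k]"
  using upt_split[of i j k] by (simp add: upt_conv_Cons)

lemma upt_eq_append_ConsD:
  assumes "[1..<n] = us @ k # vs"
  shows "us = [1..<k]"
proof -
  have len: "length us < length [1..<n]" unfolding assms by simp
  have "k = [1..<n] ! length us" unfolding assms by simp
  then have k: "k = 1 + length us" using len by simp
  have "us = take (length us) [1..<n]" unfolding assms by simp
  also have "\<dots> = [1..<1 + length us]" using len by (intro take_upt) auto
  finally show ?thesis using k by simp
qed

declare One_nat_def [simp del]

lemma fund_weight_simps [simp]: "fund_weight i i = 1" "i \<noteq> j \<Longrightarrow> fund_weight i j = 0"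
  by (simp_all add: fund_weight_def)

context cartan
begin

definition cox :: "nat list" where "cox = [1..<Suc r]"
definition cpow :: "nat \<Rightarrow> nat list" where "cpow m = concat (replicate m cox)"
text \<open>One letter for each mutation between \<open>t(1,0)\<close> and
  \<open>t(i,m)\<close>.\<close>

definition cword :: "nat \<Rightarrow> nat \<Rightarrow> nat list" where "cword m i = cpow m @ [1..<i]"
definition weight_orbit :: "nat \<Rightarrow> nat \<Rightarrow> weight" where "weight_orbit i m = weight_word (cpow m) (fund_weight i)"
definition root_orbit :: "nat \<Rightarrow> nat \<Rightarrow> nat \<Rightarrow> int" where "root_orbit i m = root_word (cword m i) (simple i)"
definition first_root :: "nat \<Rightarrow> nat \<Rightarrow> int" where "first_root i = root_word [1..<i] (simple i)"

lemma word_simps [simp]: "word cox" "word (cpow m)" "i \<in> {1..r} \<Longrightarrow> word (cword m i)"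
  "i \<in> {1..r} \<Longrightarrow> word [1..<i]"
proof -
  show *: "word cox" by (auto simp: cox_def)
  then show "word (cpow m)" by (auto simp: cpow_def)
  then show "i \<in> {1..r} \<Longrightarrow> word (cword m i)" by (auto simp: cword_def)
  show "i \<in> {1..r} \<Longrightarrow> word [1..<i]" by auto
qed

lemma cpow_Suc: "cpow (Suc m) = cox @ cpow m" "cpow (Suc m) = cpow m @ cox"
proof -
  show *: "cpow (Suc m) = cox @ cpow m" for m by (simp add: cpow_def)
  show "cpow (Suc m) = cpow m @ cox" by (induction m) (simp_all add: *, simp add: cpow_def)
qed

lemma coxeter_power: "(coxeter_element r A ^^ m) v = weight_word (cpow m) v"
proof (induction m)
  case (Suc m)
  then show ?case unfolding cpow_Suc(1) by (simp add: coxeter_element_def cox_def)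
qed (simp add: cpow_def)

lemma weight_word_fix: "i \<notin> set is \<Longrightarrow> weight_word is (fund_weight i) = fund_weight i"
  by (induction "is") (auto simp: simple_refl_def fund_weight_def)

lemma root_word_coord: "i \<notin> set is \<Longrightarrow> root_word is x i = x i"
  by (induction "is") (auto simp: refl_def)

lemma weight_orbit_above: "j \<ge> i \<Longrightarrow> weight_orbit j m = weight_word (cword m i) (fund_weight j)"
  by (simp add: weight_orbit_def cword_def weight_word_fix)

text \<open>The letters \<open>i, ..., r\<close> that complete the sweep fix
  \<open>\<omega>\<^sub>j\<close>. This matches the index \<open>Suc m\<close> of lower neighbours
  in a mesh.\<close>

lemma weight_orbit_below:
  assumes i: "i \<in> {1..r}" and "j < i"
  shows "weight_orbit j (Suc m) = weight_word (cword m i) (fund_weight j)"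
proof -
  have "cpow (Suc m) = cword m i @ [i..<Suc r]"
    using upt_split[of 1 i "Suc r"] i by (simp add: cpow_Suc(2) cword_def cox_def)
  then show ?thesis using assms by (simp add: weight_orbit_def weight_word_fix del: upt_Suc)
qed

lemma weight_orbit_Suc:
  assumes i: "i \<in> {1..r}"
  shows "weight_orbit i (Suc m) = weight_word (cword m i) (simple_refl r A i (fund_weight i))"
proof -
  have "cpow (Suc m) = cword m i @ i # [Suc i..<Suc r]"
    using upt_split_Cons[of 1 i "Suc r"] i by (simp add: cpow_Suc(2) cword_def cox_def)
  then show ?thesis using assms by (simp add: weight_orbit_def weight_word_fix)
qed

lemma simple_refl_fund: "simple_refl r A i (fund_weight i) = (\<lambda>k. fund_weight i k - simple_root r A i k)"
  by (simp add: simple_refl_def fund_weight_def)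

lemma wt_root_orbit:
  assumes i: "i \<in> {1..r}"
  shows "wt (root_orbit i m) = (\<lambda>k. weight_orbit i m k - weight_orbit i (Suc m) k)"
proof -
  have "weight_orbit i (Suc m) = (\<lambda>k. weight_orbit i m k - wt (root_orbit i m) k)"
    using i by (simp add: weight_orbit_Suc simple_refl_fund weight_word_diff weight_orbit_above[of i i] root_orbit_def flip: wt_simple weight_word_wt)
  then show ?thesis by simp
qed

text \<open>Apply \<open>cword m i\<close> to \<open>\<omega>\<^sub>i + s\<^sub>i \<omega>\<^sub>i =
  - \<Sum>\<^sub>j A j i \<omega>\<^sub>j\<close> with \<open>j \<noteq> i\<close>, which is the
  expansion of the simple root in fundamental weights.\<close>

lemma weight_orbit_mesh:
  assumes i: "i \<in> {1..r}"
  shows "weight_orbit i m k + weight_orbit i (Suc m) k = mesh_sum (\<lambda>j m. weight_orbit j m k) i m"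
proof -
  let ?w = "cword m i"
  have S: "{1..r} = insert i ({i<..r} \<union> {1..<i})" using i by auto
  have "simple_root r A i = (\<lambda>k. \<Sum>j\<in>{1..r}. A j i * fund_weight j k)"
    by (auto simp: simple_root_def fund_weight_def if_distrib[of "\<lambda>x. _ * x"] cong: if_cong)
  then have sr: "simple_root r A i = (\<lambda>k. 2 * fund_weight i k + (\<Sum>j\<in>{i<..r} \<union> {1..<i}. A j i * fund_weight j k))"
    unfolding S using i by (subst (asm) sum.insert) (auto simp: diag)
  have "(\<lambda>k. weight_orbit i m k - weight_orbit i (Suc m) k) = weight_word ?w (simple_root r A i)"
    using i by (simp add: weight_orbit_Suc simple_refl_fund weight_word_diff weight_orbit_above[of i i])
  also have "\<dots> = (\<lambda>k. 2 * weight_word ?w (fund_weight i) k + (\<Sum>j\<in>{i<..r} \<union> {1..<i}. A j i * weight_word ?w (fund_weight j) k))"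
    using weight_word_linear[of ?w 2 "fund_weight i" 1 "\<lambda>k. \<Sum>j\<in>{i<..r} \<union> {1..<i}. A j i * fund_weight j k"]
    by (simp add: sr weight_word_sum)
  finally have "weight_orbit i m k - weight_orbit i (Suc m) k =
      2 * weight_orbit i m k + (\<Sum>j\<in>{i<..r} \<union> {1..<i}. A j i * weight_word ?w (fund_weight j) k)"
    by (simp add: weight_orbit_above[of i i] fun_eq_iff)
  also have "(\<Sum>j\<in>{i<..r} \<union> {1..<i}. A j i * weight_word ?w (fund_weight j) k) = - mesh_sum (\<lambda>j m. weight_orbit j m k) i m"
    using i by (subst sum.union_disjoint)
      (auto simp: mesh_sum_def weight_orbit_above[of i] weight_orbit_below sum_negf intro!: arg_cong2[where f = "(+)"] sum.cong)
  finally show ?thesis by simp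
qed

lemma root_root_orbit: "i \<in> {1..r} \<Longrightarrow> root (root_orbit i m)"
  by (simp add: root_orbit_def root_root_word root_simple)

lemma coroot_mesh_sum: "coroot x (\<lambda>k. mesh_sum (\<lambda>j m. c j m k) i m) = mesh_sum (\<lambda>j m. coroot x (c j m)) i m"
  using mesh_sum_sum[of "\<lambda>j m k. A x k * c j m k"]
  by (simp add: coroot_def mult.commute[of "A x _"] mesh_sum_mult_right)

text \<open>The difference of two consecutive weight meshes, lifted back to the root lattice by
  \<open>wt_inj\<close>.\<close>

lemma root_orbit_mesh:
  assumes i: "i \<in> {1..r}"
  shows "root_orbit i m k + root_orbit i (Suc m) k = mesh_sum (\<lambda>j m. root_orbit j m k) i m"
proof -
  have "(\<lambda>k. root_orbit i m k + root_orbit i (Suc m) k) = (\<lambda>k. mesh_sum (\<lambda>j m. root_orbit j m k) i m)"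
  proof (rule wt_inj)
    fix k assume "k \<notin> {1..r}"
    then show "root_orbit i m k + root_orbit i (Suc m) k = mesh_sum (\<lambda>j m. root_orbit j m k) i m"
      using root_support[OF root_root_orbit] i by (auto simp: mesh_sum_def)
  next
    have wt_mesh: "wt (\<lambda>k. mesh_sum (\<lambda>j m. root_orbit j m k) i m) k = mesh_sum (\<lambda>j m. wt (root_orbit j m) k) i m" for k
    proof (cases "k \<in> {1..r}")
      case True then show ?thesis by (simp add: wt_def coroot_mesh_sum)
    next
      case False then show ?thesis by (simp only: wt_def if_False) (simp add: mesh_sum_def)
    qed
    have "wt (\<lambda>k. mesh_sum (\<lambda>j m. root_orbit j m k) i m) k = mesh_sum (\<lambda>j m. weight_orbit j m k + - weight_orbit j (Suc m) k) i m" for k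
      unfolding wt_mesh using i by (intro mesh_sum_cong) (auto simp: wt_root_orbit)
    moreover have "mesh_sum (\<lambda>j m. weight_orbit j m k + - weight_orbit j (Suc m) k) i m = (weight_orbit i m k - weight_orbit i (Suc m) k) + (weight_orbit i (Suc m) k - weight_orbit i (Suc (Suc m)) k)" for k
    proof -
      have "mesh_sum (\<lambda>j m. - weight_orbit j (Suc m) k) i m = - mesh_sum (\<lambda>j m. weight_orbit j m k) i (Suc m)"
        by (simp add: mesh_sum_def sum_negf)
      then show ?thesis unfolding mesh_sum_add using weight_orbit_mesh[OF i, of m k] weight_orbit_mesh[OF i, of "Suc m" k] by simp
    qed
    ultimately show "wt (\<lambda>k. root_orbit i m k + root_orbit i (Suc m) k) = wt (\<lambda>k. mesh_sum (\<lambda>j m. root_orbit j m k) i m)"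
      using wt_linear[of 1 "root_orbit i m" 1 "root_orbit i (Suc m)"] i by (simp add: wt_root_orbit fun_eq_iff)
  qed
  then show ?thesis by (simp add: fun_eq_iff)
qed

lemma root_orbit_0: "root_orbit i 0 = first_root i"
  by (simp add: root_orbit_def first_root_def cword_def cpow_def)

lemma root_orbit_cpow: "root_orbit i m = root_word (cpow m) (first_root i)"
  by (simp add: root_orbit_def first_root_def cword_def)

lemma root_orbit_Suc: "root_orbit i (Suc m) = root_word cox (root_orbit i m)"
  by (simp add: root_orbit_cpow cpow_Suc(1))

lemma nonneg_root: "root x \<Longrightarrow> x k > 0 \<Longrightarrow> nonneg x"
  using root_sign[of x] by (auto simp: nonneg_def) (metis neg_0_le_iff_le not_less)

lemma root_first_root: "i \<in> {1..r} \<Longrightarrow> root (first_root i)"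
  unfolding first_root_def by (intro root_root_word root_simple word_simps)

lemma first_root_diag: "first_root i i = 1"
  by (simp add: first_root_def root_word_coord)

lemma first_root_above: "k > i \<Longrightarrow> first_root i k = 0"
  by (simp add: first_root_def root_word_coord)

lemma nonneg_first_root: "i \<in> {1..r} \<Longrightarrow> nonneg (first_root i)"
  using nonneg_root[OF root_first_root, of i i] by (simp add: first_root_diag)

section \<open>Expansion in the first roots of the orbits\<close>

lemma root_word_upt:
  "n \<le> r \<Longrightarrow> root_word [1..<Suc n] x = (\<lambda>k. x k - (\<Sum>l\<in>{1..<Suc n}. coroot l x * first_root l k))"
proof (induction n arbitrary: x)
  case (Suc n)
  have "root_word [1..<Suc (Suc n)] x = root_word [1..<Suc n] (refl (Suc n) x)" by simp
  also have "refl (Suc n) x = (\<lambda>k. 1 * x k + (- coroot (Suc n) x) * simple (Suc n) k)"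
    by (simp add: refl_eq)
  also have "root_word [1..<Suc n] \<dots> = (\<lambda>k. root_word [1..<Suc n] x k - coroot (Suc n) x * first_root (Suc n) k)"
    unfolding root_word_linear by (simp add: first_root_def)
  finally have "root_word [1..<Suc (Suc n)] x = (\<lambda>k. root_word [1..<Suc n] x k - coroot (Suc n) x * first_root (Suc n) k)" .
  moreover have "{1..<Suc (Suc n)} = insert (Suc n) {1..<Suc n}" by auto
  ultimately show ?case using Suc.IH[of x] Suc.prems by (simp add: fun_eq_iff del: upt_Suc)
qed simp

lemma weight_word_upt:
  "n \<le> r \<Longrightarrow> weight_word [1..<Suc n] v = (\<lambda>k. v k - (\<Sum>l\<in>{1..<Suc n}. v l * wt (first_root l) k))"
proof (induction n arbitrary: v)
  case (Suc n)
  have "weight_word [1..<Suc (Suc n)] v = weight_word [1..<Suc n] (simple_refl r A (Suc n) v)" by simp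
  also have "simple_refl r A (Suc n) v = (\<lambda>k. 1 * v k + (- v (Suc n)) * wt (simple (Suc n)) k)"
    using Suc.prems by (simp add: simple_refl_def wt_simple)
  also have "weight_word [1..<Suc n] \<dots> = (\<lambda>k. weight_word [1..<Suc n] v k - v (Suc n) * wt (first_root (Suc n)) k)"
  proof -
    have "word [1..<Suc n]" using Suc.prems by auto
    then have "weight_word [1..<Suc n] (wt (simple (Suc n))) = wt (first_root (Suc n))" by (simp only: weight_word_wt first_root_def)
    then show ?thesis unfolding weight_word_linear by (simp del: upt_Suc)
  qed
  finally have "weight_word [1..<Suc (Suc n)] v = (\<lambda>k. weight_word [1..<Suc n] v k - v (Suc n) * wt (first_root (Suc n)) k)" .
  moreover have "{1..<Suc (Suc n)} = insert (Suc n) {1..<Suc n}" by auto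
  ultimately show ?case using Suc.IH[of v] Suc.prems by (simp add: fun_eq_iff del: upt_Suc)
qed simp

text \<open>Summed over the coordinates, this is the recursion of \<open>p_vec_initial\<close> for a
  row of ones; hence the heights.\<close>

lemma first_root_recursion:
  assumes "i \<in> {1..r}"
  shows "first_root i k = simple i k + (\<Sum>l\<in>{1..<i}. - A l i * first_root l k)"
proof -
  obtain n where n: "i = Suc n" using assms by (cases i) auto
  have "first_root i = (\<lambda>k. simple i k - (\<Sum>l\<in>{1..<i}. coroot l (simple i) * first_root l k))"
    using root_word_upt[of n "simple i"] assms unfolding n first_root_def[of "Suc n"] by simp
  then show ?thesis by (simp add: coroot_simple[OF assms] sum_negf fun_eq_iff)
qed

text \<open>Unitriangularity: \<open>first_root l\<close> has coordinate \<open>1\<close> at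
  \<open>l\<close> and \<open>0\<close> above, so the largest index with a nonzero coefficient can
  be read off.\<close>

lemma first_root_independent:
  assumes zero: "\<And>k. k \<in> {1..r} \<Longrightarrow> (\<Sum>l\<in>{1..r}. c l * first_root l k) = 0" and i: "i \<in> {1..r}"
  shows "c i = 0"
proof (rule ccontr)
  assume "c i \<noteq> 0"
  define S where "S = {l \<in> {1..r}. c l \<noteq> 0}"
  have "finite S" "S \<noteq> {}" using i \<open>c i \<noteq> 0\<close> by (auto simp: S_def)
  define n where "n = Max S"
  have n: "n \<in> {1..r}" "c n \<noteq> 0" using Max_in[OF \<open>finite S\<close> \<open>S \<noteq> {}\<close>] by (auto simp: n_def S_def)
  have "(\<Sum>l\<in>{1..r}. c l * first_root l n) = (\<Sum>l\<in>{1..r}. if l = n then c n else 0)"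
  proof (intro sum.cong refl)
    fix l assume l: "l \<in> {1..r}"
    show "c l * first_root l n = (if l = n then c n else 0)"
    proof (cases l n rule: linorder_cases)
      case greater
      then have "l \<notin> S" using Max_ge[OF \<open>finite S\<close>, of l] by (auto simp: n_def)
      then show ?thesis using l greater by (simp add: S_def)
    qed (use first_root_above first_root_diag in auto)
  qed
  then show False using zero[OF n(1)] n by simp
qed

lemma wt_zero: "wt (\<lambda>_. 0) = (\<lambda>_. 0)"
  by (auto simp: wt_def coroot_def)

section \<open>Every orbit of roots turns negative\<close>

lemma form_bound:
  obtains \<epsilon> where "\<epsilon> > 0" "\<And>x. \<epsilon> * (\<Sum>i\<in>{1..r}. of_int (x i ^ 2)) \<le> pairing (wt x) x"
proof -
  have "\<exists>\<epsilon>>0. \<forall>x :: nat \<Rightarrow> real. \<epsilon> * (\<Sum>i\<in>{1..r}. (x i)\<^sup>2) \<le> (\<Sum>i\<in>{1..r}. \<Sum>j\<in>{1..r}. (d i * of_int (A i j)) * x i * x j)"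
    using d_sym pos_def by (intro pos_def_form_bound) (auto simp: mult_ac)
  then obtain \<epsilon> where \<epsilon>: "\<epsilon> > 0" "\<And>x :: nat \<Rightarrow> real. \<epsilon> * (\<Sum>i\<in>{1..r}. (x i)\<^sup>2) \<le>
      (\<Sum>i\<in>{1..r}. \<Sum>j\<in>{1..r}. (d i * of_int (A i j)) * x i * x j)" by blast
  show ?thesis
    using \<epsilon>(2)[of "\<lambda>i. of_int (x i)" for x] by (intro that[OF \<epsilon>(1)]) (simp add: pairing_wt)
qed

text \<open>Invariance of the norm of \<open>\<omega>\<^sub>i - R\<close> in a form that needs no
  product of two weights: the norm of \<open>R\<close> is twice its pairing with
  \<open>\<omega>\<^sub>i\<close>.\<close>

lemma orbit_norm:
  assumes i: "i \<in> {1..r}" and "word is"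
  shows "\<exists>R. (\<forall>k. k \<notin> {1..r} \<longrightarrow> R k = 0) \<and> weight_word is (fund_weight i) = (\<lambda>k. fund_weight i k - wt R k) \<and>
    pairing (wt R) R = 2 * (d i * of_int (R i))"
  using assms(2)
proof (induction "is")
  case Nil
  show ?case by (intro exI[of _ "\<lambda>_. 0"]) (auto simp: wt_zero pairing_def)
next
  case (Cons k "is")
  then obtain R where R: "\<And>k. k \<notin> {1..r} \<Longrightarrow> R k = 0" "weight_word is (fund_weight i) = (\<lambda>k. fund_weight i k - wt R k)"
    "pairing (wt R) R = 2 * (d i * of_int (R i))" by auto
  have k: "k \<in> {1..r}" using Cons by simp
  \<comment> \<open>The coordinate \<open>k\<close> of the current weight; the reflection adds this
    multiple of the simple root to \<open>R\<close>.\<close>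
  define x where "x = fund_weight i k - wt R k"
  let ?R = "\<lambda>j. 1 * R j + x * simple k j"
  have "weight_word (k # is) (fund_weight i) = (\<lambda>j. fund_weight i j - wt ?R j)"
    unfolding wt_linear using k by (simp add: R(2) simple_refl_def x_def wt_simple algebra_simps)
  moreover have "pairing (wt ?R) ?R = 2 * (d i * of_int (?R i))"
  proof -
    have "pairing (wt ?R) ?R = pairing (wt R) R + 2 * of_int x * (d k * of_int (wt R k)) + (of_int x)\<^sup>2 * (2 * d k)"
      unfolding wt_linear pairing_linear_left pairing_linear_right
      using k pairing_wt_sym[of "simple k" R]
      by (simp add: pairing_simple wt_simple simple_root_def diag power2_eq_square algebra_simps)
    also have "\<dots> = 2 * (d i * of_int (R i)) + 2 * of_int x * d k * of_int (wt R k + x)"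
      by (simp add: R(3) power2_eq_square algebra_simps)
    also have "wt R k + x = fund_weight i k" by (simp add: x_def)
    finally show ?thesis by (auto simp: fund_weight_def algebra_simps)
  qed
  moreover have "\<forall>j. j \<notin> {1..r} \<longrightarrow> ?R j = 0" using R(1) k by (auto simp: fund_weight_def)
  ultimately show ?case by (intro exI[of _ ?R] conjI)
qed

text \<open>Otherwise \<open>\<omega>\<^sub>i - c\<^sup>m \<omega>\<^sub>i\<close> would be a sum of
  \<open>m\<close> positive roots and grow with \<open>m\<close>, whereas \<open>orbit_norm\<close>
  bounds it.\<close>

lemma negative_root_orbit_exists:
  assumes i: "i \<in> {1..r}"
  shows "\<exists>m. \<not> nonneg (root_orbit i m)"
proof (rule ccontr)
  assume "\<not> ?thesis"
  then have ones_row: "root_orbit i m k \<ge> 0" for m k by (auto simp: nonneg_def)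
  obtain \<epsilon> where \<epsilon>: "\<epsilon> > 0" "\<And>x. \<epsilon> * (\<Sum>i\<in>{1..r}. of_int (x i ^ 2)) \<le> pairing (wt x) x"
    using form_bound by blast
  \<comment> \<open>\<open>C\<close> bounds \<open>R i\<close>, then \<open>C * C\<close> bounds the
    sum of the squares of the coordinates of \<open>R\<close>. That sum is at least
    \<open>m\<close>, so \<open>m\<close> is taken beyond \<open>C * C\<close>.\<close>
  define C where "C = 2 * d i / \<epsilon>"
  define m where "m = Suc (nat \<lceil>C * C\<rceil>)"
  define R where "R k = (\<Sum>m'<m. root_orbit i m' k)" for k
  have wtR: "weight_orbit i m = (\<lambda>k. fund_weight i k - wt R k)"
  proof -
    have "weight_orbit i n = (\<lambda>k. fund_weight i k - wt (\<lambda>k. \<Sum>m'<n. root_orbit i m' k) k)" for n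
    proof (induction n)
      case 0 show ?case by (simp add: weight_orbit_def cpow_def wt_zero)
    next
      case (Suc n)
      have "wt (\<lambda>k. \<Sum>m'<Suc n. root_orbit i m' k) = (\<lambda>k. wt (\<lambda>k. \<Sum>m'<n. root_orbit i m' k) k + wt (root_orbit i n) k)"
        using wt_linear[of 1 "\<lambda>k. \<Sum>m'<n. root_orbit i m' k" 1 "root_orbit i n"] by simp
      then show ?case using Suc by (simp add: wt_root_orbit[OF i] fun_eq_iff)
    qed
    then show ?thesis by (simp add: R_def [abs_def])
  qed
  obtain R' where R': "\<And>k. k \<notin> {1..r} \<Longrightarrow> R' k = 0" "weight_orbit i m = (\<lambda>k. fund_weight i k - wt R' k)"
    "pairing (wt R') R' = 2 * (d i * of_int (R' i))"
    using orbit_norm[OF i, of "cpow m"] by (auto simp: weight_orbit_def)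
  have "R = R'"
  proof (rule wt_inj)
    show "wt R = wt R'" using wtR R'(2) by (auto simp: fun_eq_iff)
    show "R k = R' k" if "k \<notin> {1..r}" for k
      using R'(1)[OF that] root_support[OF root_root_orbit[OF i] that] by (simp add: R_def)
  qed
  let ?s = "\<Sum>k\<in>{1..r}. of_int (R k ^ 2) :: real"
  have le: "\<epsilon> * ?s \<le> 2 * (d i * of_int (R i))" using \<epsilon>(2)[of R] R'(3) \<open>R = R'\<close> by simp
  have R0: "R k \<ge> 0" for k using ones_row by (simp add: R_def sum_nonneg)
  have "of_int (R i ^ 2) \<le> ?s" using i by (intro member_le_sum) auto
  then have "\<epsilon> * of_int (R i ^ 2) \<le> \<epsilon> * ?s" using \<epsilon>(1) by (intro mult_left_mono) auto
  then have 1: "\<epsilon> * of_int (R i) * of_int (R i) \<le> 2 * d i * of_int (R i)"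
    using le by (simp add: power2_eq_square)
  have RC: "of_int (R i) \<le> C"
  proof (cases "R i = 0")
    case True then show ?thesis using \<epsilon>(1) d_pos[OF i] by (simp add: C_def)
  next
    case False
    then have "of_int (R i) > (0::real)" using R0[of i] by simp
    then have "\<epsilon> * of_int (R i) \<le> 2 * d i" using 1 by (simp only: mult_le_cancel_right_pos)
    then show ?thesis using \<epsilon>(1) by (simp add: C_def field_simps)
  qed
  have "?s \<le> 2 * (d i * of_int (R i)) / \<epsilon>" using le \<epsilon>(1) by (simp add: field_simps)
  also have "\<dots> = C * of_int (R i)" by (simp add: C_def)
  also have "\<dots> \<le> C * C" using RC R0[of i] by (intro mult_left_mono) (auto intro: order_trans[of 0 "of_int (R i)"])
  finally have sC: "?s \<le> C * C" .
  have "int m = (\<Sum>m'<m. 1)" by simp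
  also have "\<dots> \<le> (\<Sum>m'<m. \<Sum>k\<in>{1..r}. root_orbit i m' k)"
  proof (rule sum_mono)
    fix m'
    obtain k where k: "root_orbit i m' k \<noteq> 0" using root_nonzero[OF root_root_orbit[OF i]] by blast
    then have "k \<in> {1..r}" using root_support[OF root_root_orbit[OF i]] by blast
    then have "root_orbit i m' k \<le> (\<Sum>k\<in>{1..r}. root_orbit i m' k)" using ones_row by (intro member_le_sum) auto
    then show "1 \<le> (\<Sum>k\<in>{1..r}. root_orbit i m' k)" using k ones_row[of m' k] by simp
  qed
  also have "\<dots> = (\<Sum>k\<in>{1..r}. R k)" by (subst sum.swap) (simp add: R_def)
  also have "\<dots> \<le> (\<Sum>k\<in>{1..r}. R k ^ 2)"
  proof (rule sum_mono)
    fix k show "R k \<le> R k ^ 2"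
      using R0[of k] mult_left_mono[of 1 "R k" "R k"] by (cases "R k = 0") (auto simp: power2_eq_square)
  qed
  finally have "real_of_int (int m) \<le> real_of_int (\<Sum>k\<in>{1..r}. R k ^ 2)" by (simp only: of_int_le_iff)
  then have "real m \<le> ?s" by simp
  then show False using sC by (simp add: m_def) linarith
qed

text \<open>A definition by the sign change, available before the end of the orbit is known;
  \<open>hc_eq\<close> identifies it with \<open>h(i;c)\<close>.\<close>

definition sweeps :: "nat \<Rightarrow> nat" where "sweeps i = (LEAST m. \<not> nonneg (root_orbit i m))"

lemma
  assumes i: "i \<in> {1..r}"
  shows root_orbit_sweeps: "\<not> nonneg (root_orbit i (sweeps i))"
    and root_orbit_before: "m < sweeps i \<Longrightarrow> nonneg (root_orbit i m)"
    and sweeps_le: "\<not> nonneg (root_orbit i m) \<Longrightarrow> sweeps i \<le> m"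
    and sweeps_pos: "sweeps i > 0"
proof -
  show 1: "\<not> nonneg (root_orbit i (sweeps i))" unfolding sweeps_def using negative_root_orbit_exists[OF i] by (rule LeastI_ex)
  show "m < sweeps i \<Longrightarrow> nonneg (root_orbit i m)" unfolding sweeps_def using not_less_Least by blast
  show "\<not> nonneg (root_orbit i m) \<Longrightarrow> sweeps i \<le> m" unfolding sweeps_def by (rule Least_le)
  show "sweeps i > 0" using 1 nonneg_first_root[OF i] by (cases "sweeps i") (auto simp: root_orbit_0)
qed

text \<open>\<open>crossing\<close> for the reversed Coxeter word identifies the root. For the
  weight \<open>?v\<close>, expanding \<open>(1 - c) ?v\<close> gives the first roots with the
  coordinates of \<open>?v\<close> as coefficients; it is also minus the first root of
  \<open>k\<close>, so independence leaves only minus the fundamental weight.\<close>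

lemma final_root_orbit_exists:
  assumes i: "i \<in> {1..r}"
  shows "\<exists>k\<in>{1..r}. root_orbit i (sweeps i) = (\<lambda>x. - first_root k x) \<and> weight_orbit i (sweeps i) = (\<lambda>x. - fund_weight k x)"
proof -
  obtain m where m: "sweeps i = Suc m" using sweeps_pos[OF i] by (cases "sweeps i") auto
  let ?y = "\<lambda>x. - root_orbit i (sweeps i) x"
  have y: "root ?y" "nonneg ?y"
    using root_uminus[OF root_root_orbit[OF i]] root_sign[OF root_root_orbit[OF i, of "sweeps i"]] root_orbit_sweeps[OF i] by auto
  have "root_word (rev cox) ?y = (\<lambda>x. - root_orbit i m x)" unfolding root_word_uminus by (simp add: m root_orbit_Suc)
  moreover have "\<not> nonneg (\<lambda>x. - root_orbit i m x)"
    using not_both_signs[OF root_root_orbit[OF i] root_orbit_before[OF i]] m by simp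
  ultimately have "\<not> nonneg (root_word (rev cox) ?y)" by simp
  then obtain us k vs where uv: "rev cox = us @ k # vs" "root_word vs ?y = simple k"
    using crossing[OF _ y, of "rev cox"] by auto
  have cox: "cox = rev vs @ k # rev us" using arg_cong[OF uv(1), of rev] by simp
  then have vs: "rev vs = [1..<k]" unfolding cox_def by (rule upt_eq_append_ConsD)
  have k: "k \<in> {1..r}" using cox word_simps(1) by auto
  have "word vs" using cox word_simps(1) by auto
  then have "?y = root_word (rev vs) (simple k)" using uv(2) by (metis root_word_rev(1))
  then have yk: "?y = first_root k" by (simp add: vs first_root_def)
  then have qk: "root_orbit i (sweeps i) = (\<lambda>x. - first_root k x)" by (auto simp: fun_eq_iff) (metis minus_minus)
  let ?v = "weight_orbit i (sweeps i)"
  have "weight_orbit i (Suc (sweeps i)) = weight_word cox ?v" by (simp add: weight_orbit_def cpow_Suc(1))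
  then have "wt (root_orbit i (sweeps i)) x = (\<Sum>l\<in>{1..<Suc r}. ?v l * wt (first_root l) x)" for x
    unfolding wt_root_orbit[OF i] cox_def using weight_word_upt[of r ?v] by (simp del: upt_Suc)
  moreover have "{1..<Suc r} = {1..r}" by auto
  moreover have "(\<Sum>l\<in>{1..r}. ?v l * wt (first_root l) x) = wt (\<lambda>x. \<Sum>l\<in>{1..r}. ?v l * first_root l x) x" for x
  proof (cases "x \<in> {1..r}")
    case True
    then show ?thesis
      by (simp only: wt_def if_True) (simp add: coroot_def sum_distrib_left, subst sum.swap, simp add: mult_ac)
  next
    case False then show ?thesis by (simp only: wt_def if_False) simp
  qed
  ultimately have "wt (root_orbit i (sweeps i)) = wt (\<lambda>x. \<Sum>l\<in>{1..r}. ?v l * first_root l x)" by (simp add: fun_eq_iff)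
  then have "root_orbit i (sweeps i) = (\<lambda>x. \<Sum>l\<in>{1..r}. ?v l * first_root l x)"
  proof (rule wt_inj)
    fix x assume "x \<notin> {1..r}"
    then show "root_orbit i (sweeps i) x = (\<Sum>l\<in>{1..r}. ?v l * first_root l x)"
      using root_support[OF root_root_orbit[OF i]] root_support[OF root_first_root] by simp
  qed
  then have *: "(\<Sum>l\<in>{1..r}. ?v l * first_root l x) = - first_root k x" for x using qk by (simp add: fun_eq_iff)
  have "?v l + simple k l = 0" if l: "l \<in> {1..r}" for l
  proof (rule first_root_independent[OF _ l])
    fix x
    have "(\<Sum>l\<in>{1..r}. simple k l * first_root l x) = first_root k x"
      using k by (simp add: fund_weight_def if_distrib[of "\<lambda>y. y * _"] cong: if_cong)
    then show "(\<Sum>l\<in>{1..r}. (?v l + simple k l) * first_root l x) = 0"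
      using * by (simp add: distrib_right sum.distrib)
  qed
  moreover have "?v l + simple k l = 0" if "l \<notin> {1..r}" for l
    using weight_word_support[of "cpow (sweeps i)" l "fund_weight i"] that i k by (auto simp: weight_orbit_def fund_weight_def)
  ultimately have "?v l + simple k l = 0" for l by blast
  then have "?v = (\<lambda>x. - fund_weight k x)" by (simp add: fun_eq_iff add_eq_0_iff2)
  then show ?thesis using qk k by blast
qed

definition end_vertex :: "nat \<Rightarrow> nat" where
  "end_vertex i = (SOME k. k \<in> {1..r} \<and> root_orbit i (sweeps i) = (\<lambda>x. - first_root k x) \<and> weight_orbit i (sweeps i) = (\<lambda>x. - fund_weight k x))"

lemma
  assumes i: "i \<in> {1..r}"
  shows end_vertex: "end_vertex i \<in> {1..r}"
    and root_orbit_final: "root_orbit i (sweeps i) = (\<lambda>x. - first_root (end_vertex i) x)"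
    and weight_orbit_final: "weight_orbit i (sweeps i) = (\<lambda>x. - fund_weight (end_vertex i) x)"
  using someI_ex[OF final_root_orbit_exists[OF i, unfolded Bex_def]] unfolding end_vertex_def by auto

section \<open>Orbits of adjacent vertices end at nearly the same time\<close>

lemma coroot_negative:
  assumes "nonneg y" "y i = 0" "y j > 0" "A i j \<noteq> 0" "i \<in> {1..r}" "j \<in> {1..r}"
  shows "coroot i y < 0"
proof -
  have "i \<noteq> j" using assms by auto
  then have Aij: "A i j < 0" using off_diag[of i j] assms by simp
  have "coroot i y = A i j * y j + (\<Sum>k\<in>{1..r} - {j}. A i k * y k)"
    using assms(6) by (simp add: coroot_def sum.remove)
  moreover have "(\<Sum>k\<in>{1..r} - {j}. A i k * y k) \<le> 0"
  proof (rule sum_nonpos)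
    fix k assume "k \<in> {1..r} - {j}"
    then show "A i k * y k \<le> 0"
      using off_diag[of i k] assms by (cases "k = i") (auto simp: nonneg_def intro: mult_nonpos_nonneg)
  qed
  moreover have "A i j * y j < 0" using Aij assms(3) by (rule mult_neg_pos)
  ultimately show ?thesis by simp
qed

text \<open>Letter \<open>i\<close> occurs once. When it acts, coordinate \<open>i\<close> is still
  \<open>0\<close> and coordinate \<open>j\<close> positive, so it creates a positive coordinate
  that later letters leave alone.\<close>

lemma coefficient_after_reflection:
  assumes x: "root x" "x i = 0" "x j > 0" and A: "A i j \<noteq> 0" "i \<in> {1..r}" "j \<in> {1..r}"
    and w: "word (us @ i # vs)" "i \<notin> set us" "i \<notin> set vs" "j \<notin> set vs"
  shows "root_word (us @ i # vs) x i > 0"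
proof -
  let ?y = "root_word vs x"
  have y: "?y i = 0" "?y j > 0" using w x by (simp_all add: root_word_coord)
  have "root ?y" using root_root_word[OF x(1), of vs] w by simp
  then have "nonneg ?y" using y(2) by (rule nonneg_root)
  then have "coroot i ?y < 0" by (rule coroot_negative[OF _ y A])
  then have "refl i ?y i > 0" using y by (simp add: refl_def)
  then show ?thesis using w by (simp add: root_word_coord)
qed

text \<open>A weight at its end is minus a fundamental weight, so its pairing with a root reads off
  minus a positive multiple of one coordinate. By invariance that pairing equals one at the start,
  which is positive; hence the root is negative. The two inequalities pair the end of
  \<open>i\<close> with the orbit of \<open>j\<close>, and the end of \<open>j\<close> with the next
  root of \<open>i\<close>.\<close>

lemma
  assumes i: "i \<in> {1..r}" and j: "j \<in> {1..r}" and ij: "i < j" and A: "A j i \<noteq> 0"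
  shows sweeps_adjacent: "sweeps j \<le> sweeps i \<and> sweeps i \<le> Suc (sweeps j)"
    and first_root_adjacent: "first_root j i > 0"
proof -
  have A': "A i j \<noteq> 0" using zero_sym[OF i j] A by auto
  have "[1..<j] = [1..<i] @ i # [Suc i..<j]" using ij i by (intro upt_split_Cons) auto
  then show first_root: "first_root j i > 0" unfolding first_root_def
    using i j ij A' coefficient_after_reflection[of "simple j" i j "[1..<i]" "[Suc i..<j]"]
    by (auto simp: root_simple subset_iff)
  have "cox = [1..<j] @ j # [Suc j..<Suc r]" unfolding cox_def using j by (intro upt_split_Cons) auto
  then have cfirst_root: "root_word cox (first_root i) j > 0"
    using i j ij A coefficient_after_reflection[of "first_root i" j i "[1..<j]" "[Suc j..<Suc r]"]
    by (auto simp: root_first_root first_root_above first_root_diag subset_iff)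
  have "pairing (weight_orbit i (sweeps i)) (root_orbit j (sweeps i)) = pairing (fund_weight i) (first_root j)"
    unfolding weight_orbit_def root_orbit_cpow by (simp add: pairing_word)
  then have "- (d (end_vertex i) * of_int (root_orbit j (sweeps i) (end_vertex i))) = d i * of_int (first_root j i)"
    using end_vertex[OF i] i by (simp add: weight_orbit_final[OF i] pairing_uminus pairing_fund)
  moreover have "d i * of_int (first_root j i) > 0" using first_root d_pos[OF i] by simp
  ultimately have "d (end_vertex i) * of_int (root_orbit j (sweeps i) (end_vertex i)) < 0" by linarith
  then have "root_orbit j (sweeps i) (end_vertex i) < 0"
    using d_pos[OF end_vertex[OF i]] by (simp add: mult_less_0_iff)
  then have 1: "\<not> nonneg (root_orbit j (sweeps i))" by (auto simp: nonneg_def not_le)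
  have "root_orbit i (Suc (sweeps j)) = root_word (cpow (sweeps j)) (root_word cox (first_root i))" by (simp add: root_orbit_cpow cpow_Suc(2))
  then have "pairing (weight_orbit j (sweeps j)) (root_orbit i (Suc (sweeps j))) = pairing (fund_weight j) (root_word cox (first_root i))"
    unfolding weight_orbit_def by (simp add: pairing_word)
  then have "- (d (end_vertex j) * of_int (root_orbit i (Suc (sweeps j)) (end_vertex j))) = d j * of_int (root_word cox (first_root i) j)"
    using end_vertex[OF j] j by (simp add: weight_orbit_final[OF j] pairing_uminus pairing_fund)
  moreover have "d j * of_int (root_word cox (first_root i) j) > 0" using cfirst_root d_pos[OF j] by simp
  ultimately have "d (end_vertex j) * of_int (root_orbit i (Suc (sweeps j)) (end_vertex j)) < 0" by linarith
  then have "root_orbit i (Suc (sweeps j)) (end_vertex j) < 0"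
    using d_pos[OF end_vertex[OF j]] by (simp add: mult_less_0_iff)
  then have 2: "\<not> nonneg (root_orbit i (Suc (sweeps j)))" by (auto simp: nonneg_def not_le)
  show "sweeps j \<le> sweeps i \<and> sweeps i \<le> Suc (sweeps j)" using sweeps_le[OF j 1] sweeps_le[OF i 2] by simp
qed

end

section \<open>The longest element\<close>

context cartan
begin

definition posroots :: "(nat \<Rightarrow> int) set" where "posroots = {x. root x \<and> nonneg x}"

lemma finite_posroots: "finite posroots"
proof -
  obtain \<epsilon> where \<epsilon>: "\<epsilon> > 0" "\<And>x. \<epsilon> * (\<Sum>i\<in>{1..r}. of_int (x i ^ 2)) \<le> pairing (wt x) x"
    using form_bound by blast
  define D where "D = (\<Sum>j\<in>{1..r}. d j)"
  define N where "N = \<lceil>2 * D / \<epsilon>\<rceil>"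
  have bound: "x k \<in> {- N..N}" if x: "root x" and k: "k \<in> {1..r}" for x k
  proof -
    obtain j where j: "root_of j x" "j \<in> {1..r}" using x by (auto simp: root_def root_of_def)
    have "d j \<le> D" unfolding D_def using j d_pos by (intro member_le_sum) (auto intro: less_imp_le)
    have "real_of_int (x k ^ 2) \<le> (\<Sum>i\<in>{1..r}. of_int (x i ^ 2))" using k by (intro member_le_sum) auto
    then have "\<epsilon> * real_of_int (x k ^ 2) \<le> \<epsilon> * (\<Sum>i\<in>{1..r}. of_int (x i ^ 2))"
      using \<epsilon>(1) by (intro mult_left_mono) auto
    also have "\<dots> \<le> 2 * D" using \<epsilon>(2)[of x] root_norm[OF j(1)] \<open>d j \<le> D\<close> by simp
    finally have "real_of_int (x k ^ 2) \<le> 2 * D / \<epsilon>" using \<epsilon>(1) by (simp add: field_simps)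
    then have "x k ^ 2 \<le> N" unfolding N_def by (meson le_of_int_ceiling of_int_le_iff order_trans)
    moreover have "\<bar>x k\<bar> \<le> x k ^ 2"
      using mult_left_mono[of 1 "\<bar>x k\<bar>" "\<bar>x k\<bar>"] by (cases "x k = 0") (auto simp: power2_eq_square simp flip: abs_mult)
    ultimately show ?thesis by simp linarith
  qed
  have "posroots \<subseteq> {x. \<forall>k. (k \<in> {1..r} \<longrightarrow> x k \<in> {- N..N}) \<and> (k \<notin> {1..r} \<longrightarrow> x k = 0)}"
    using bound root_support by (auto simp: posroots_def)
  moreover have "finite \<dots>" by (rule finite_set_of_finite_funs) auto
  ultimately show ?thesis by (rule finite_subset)
qed

section \<open>Inversions and reduced words\<close>

definition inversions :: "nat list \<Rightarrow> (nat \<Rightarrow> int) set" where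
  "inversions is = {x \<in> posroots. \<not> nonneg (root_word is x)}"

abbreviation inv_count :: "nat list \<Rightarrow> nat" where "inv_count is \<equiv> card (inversions is)"

lemma finite_inversions: "finite (inversions is)"
  using finite_posroots by (simp add: inversions_def)

lemma refl_simple: "i \<in> {1..r} \<Longrightarrow> refl i (simple i) = (\<lambda>k. - simple i k)"
  by (simp add: refl_eq coroot_simple diag)

lemma nonneg_simple: "nonneg (simple i)" "\<not> nonneg (\<lambda>k. - simple i k)"
  by (auto simp: nonneg_def fund_weight_def not_le)

lemma refl_posroots: "x \<in> posroots \<Longrightarrow> i \<in> {1..r} \<Longrightarrow> x \<noteq> simple i \<Longrightarrow> refl i x \<in> posroots"
  using refl_negative[of x i] root_root_word[of x "[i]"] by (auto simp: posroots_def)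

text \<open>The reflection permutes the positive roots other than its simple root, which becomes the
  one additional inversion.\<close>

lemma inversions_append_up:
  assumes i: "i \<in> {1..r}" and w: "word is" and up: "nonneg (root_word is (simple i))"
  shows "inv_count (is @ [i]) = Suc (inv_count is)"
proof -
  have ne: "x \<noteq> simple i" if "x \<in> inversions is" for x using that up by (auto simp: inversions_def)
  have "inversions (is @ [i]) = insert (simple i) (refl i ` inversions is)"
  proof (intro equalityI subsetI)
    fix x assume x: "x \<in> inversions (is @ [i])"
    show "x \<in> insert (simple i) (refl i ` inversions is)"
    proof (cases "x = simple i")
      case False
      then have "refl i x \<in> inversions is" using x refl_posroots[of x i] i by (auto simp: inversions_def)
      then show ?thesis using i by (auto intro!: image_eqI[of _ _ "refl i x"])
    qed simp
  next
    fix x assume "x \<in> insert (simple i) (refl i ` inversions is)"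
    then consider "x = simple i" | y where "y \<in> inversions is" "x = refl i y" by auto
    then show "x \<in> inversions (is @ [i])"
    proof cases
      case 1
      then show ?thesis
        using i w up not_both_signs[OF root_root_word[OF root_simple(2)[OF i] w] up]
        by (simp add: inversions_def posroots_def root_simple nonneg_simple refl_simple root_word_uminus)
    next
      case 2
      then show ?thesis using ne[of y] refl_posroots[of y i] i by (auto simp: inversions_def)
    qed
  qed
  moreover have "simple i \<notin> refl i ` inversions is"
  proof
    assume "simple i \<in> refl i ` inversions is"
    then obtain y where y: "y \<in> inversions is" "simple i = refl i y" by auto
    then have "y = (\<lambda>k. - simple i k)" using refl_refl[OF i, of y] refl_simple[OF i] by simp
    then show False using y(1) nonneg_simple by (auto simp: inversions_def posroots_def)
  qed
  moreover have "inj_on (refl i) (inversions is)"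
    using refl_refl[OF i] by (metis inj_on_def)
  ultimately show ?thesis using finite_inversions by (simp add: card_image)
qed

definition reduced :: "nat list \<Rightarrow> bool" where
  "reduced is \<longleftrightarrow> word is \<and> (\<forall>js. word js \<longrightarrow> weight_word js = weight_word is \<longrightarrow> length is \<le> length js)"

lemma root_length_eq:
  assumes "i \<in> {1..r}" "k \<in> {1..r}" "word vs" "root_word vs (simple i) = simple k"
  shows "d i = d k"
  using root_norm[OF root_of_root_word[OF root_simple(1)[OF assms(1)] assms(3)]] root_norm[OF root_simple(1)[OF assms(2)]] assms(4)
  by simp

text \<open>Conjugation carries the reflection in a root to the reflection in its image;
  \<open>reduced_appendD\<close> uses this to delete two letters.\<close>

lemma reflection_conjugate:
  assumes i: "i \<in> {1..r}" and k: "k \<in> {1..r}" and w: "word vs" and eq: "root_word vs (simple i) = simple k"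
  shows "simple_refl r A k (weight_word vs (simple_refl r A i v)) = weight_word vs v"
proof -
  have "weight_word vs (simple_root r A i) = simple_root r A k"
    using weight_word_wt[OF w, of "simple i"] i k eq by (simp add: wt_simple)
  moreover have "simple_refl r A i v = (\<lambda>k. 1 * v k + (- v i) * simple_root r A i k)"
    by (simp add: simple_refl_def)
  ultimately have *: "weight_word vs (simple_refl r A i v) = (\<lambda>x. weight_word vs v x - v i * simple_root r A k x)"
    using weight_word_linear[of vs 1 v "- v i" "simple_root r A i"] by simp
  have "d k * of_int (weight_word vs v k) = d i * of_int (v i)"
    using pairing_word[OF w, of v "simple i"] i k eq by (simp add: pairing_simple)
  then have "weight_word vs v k = v i" using root_length_eq[OF i k w eq] d_pos[OF k] by simp
  then show ?thesis unfolding * using k by (auto simp: simple_refl_def simple_root_def diag algebra_simps)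
qed

text \<open>If the simple root \<open>i\<close> became negative, the letter found by
  \<open>crossing\<close> and the final \<open>i\<close> would cancel, and the word would not be
  reduced.\<close>

lemma reduced_appendD:
  assumes "reduced (is @ [i])"
  shows "reduced is" "nonneg (root_word is (simple i))" "i \<in> {1..r}" "word is"
proof -
  show w: "i \<in> {1..r}" "word is" using assms by (auto simp: reduced_def)
  show "reduced is"
    unfolding reduced_def
  proof (intro conjI allI impI)
    fix js assume "word js" "weight_word js = weight_word is"
    then have "word (js @ [i])" "weight_word (js @ [i]) = weight_word (is @ [i])" using w by (auto simp: fun_eq_iff)
    then have "length (is @ [i]) \<le> length (js @ [i])" using assms unfolding reduced_def by blast
    then show "length is \<le> length js" by simp
  qed (rule w)
  show "nonneg (root_word is (simple i))"
  proof (rule ccontr)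
    assume "\<not> nonneg (root_word is (simple i))"
    then obtain us k vs where uv: "is = us @ k # vs" "root_word vs (simple i) = simple k"
      using crossing[OF w(2) root_simple(2)[OF w(1)] nonneg_simple(1)] by blast
    have "weight_word (us @ vs) = weight_word (is @ [i])"
    proof
      fix v
      show "weight_word (us @ vs) v = weight_word (is @ [i]) v"
        using reflection_conjugate[OF w(1) _ _ uv(2)] w uv(1) by simp
    qed
    moreover have "word (us @ vs)" using w uv by auto
    ultimately have "length (is @ [i]) \<le> length (us @ vs)" using assms unfolding reduced_def by blast
    then show False using uv by simp
  qed
qed

lemma reduced_inv_count: "reduced is \<Longrightarrow> inv_count is = length is"
proof (induction "is" rule: rev_induct)
  case Nil
  show ?case by (auto simp: inversions_def posroots_def card_eq_0_iff)
next
  case (snoc i "is")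
  then show ?case using reduced_appendD[OF snoc.prems] inversions_append_up[of i "is"] by simp
qed

lemma weyl_length_reduced:
  assumes "word is"
  obtains js where "reduced js" "weight_word js = weight_word is" "weyl_length r A (weight_word is) = length js"
proof -
  let ?P = "\<lambda>n. \<exists>js. length js = n \<and> word js \<and> weight_word js = weight_word is"
  have "?P (weyl_length r A (weight_word is))" unfolding weyl_length_def by (rule LeastI_ex) (use assms in blast)
  then obtain js where js: "length js = weyl_length r A (weight_word is)" "word js" "weight_word js = weight_word is" by blast
  have "reduced js" unfolding reduced_def
  proof (intro conjI allI impI js(2))
    fix ks assume "word ks" "weight_word ks = weight_word js"
    then show "length js \<le> length ks" unfolding js(1) weyl_length_def using js(3) by (intro Least_le) auto
  qed
  then show ?thesis using that js by simp
qed

lemma root_word_eqI: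
  assumes "word is" "word js" "weight_word is = weight_word js"
  shows "root_word is x = root_word js x"
proof (rule wt_inj)
  show "wt (root_word is x) = wt (root_word js x)" using weight_word_wt[OF assms(1), of x] weight_word_wt[OF assms(2), of x] assms(3) by simp
  show "root_word is x k = root_word js x k" if "k \<notin> {1..r}" for k
    using root_word_support[OF assms(1) that] root_word_support[OF assms(2) that] by simp
qed

text \<open>Inversions depend only on the group element, so a reduced word may be used for the
  count.\<close>

lemma weyl_length_inv_count: "word is \<Longrightarrow> weyl_length r A (weight_word is) = inv_count is"
proof -
  assume w: "word is"
  then obtain js where js: "reduced js" "weight_word js = weight_word is" "weyl_length r A (weight_word is) = length js"
    by (rule weyl_length_reduced)
  then have "inversions js = inversions is"
    using root_word_eqI[OF _ w js(2)] by (auto simp: inversions_def reduced_def)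
  then show ?thesis using js reduced_inv_count[OF js(1)] by simp
qed

text \<open>An element without inversions has length zero.\<close>

lemma weight_word_eq_id:
  assumes "word is" "\<And>x. x \<in> posroots \<Longrightarrow> nonneg (root_word is x)"
  shows "weight_word is v = v"
proof -
  obtain js where js: "reduced js" "weight_word js = weight_word is" "weyl_length r A (weight_word is) = length js"
    using assms(1) by (rule weyl_length_reduced)
  moreover have "inversions is = {}" using assms(2) by (auto simp: inversions_def)
  ultimately have "js = []" using weyl_length_inv_count[OF assms(1)] by simp
  then show ?thesis using js(2) by (metis weight_word_simps(1))
qed

section \<open>The longest element and its action on simple roots\<close>

definition is_longest :: "nat list \<Rightarrow> bool" where
  "is_longest is \<longleftrightarrow> word is \<and> (\<forall>js. word js \<longrightarrow> inv_count js \<le> inv_count is)"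

lemma longest_exists: "\<exists>is. is_longest is"
  unfolding is_longest_def
proof (rule ex_has_greatest_nat[where b = "Suc (card posroots)"])
  show "word []" by simp
  show "\<forall>js. word js \<longrightarrow> inv_count js < Suc (card posroots)"
    using card_mono[OF finite_posroots, of "inversions js" for js] by (auto simp: inversions_def less_Suc_eq_le)
qed

text \<open>A simple root that stayed positive could be appended as a letter and would add an
  inversion; positive roots are nonnegative combinations of simple ones.\<close>

lemma longest_negative:
  assumes l: "is_longest is" and x: "x \<in> posroots"
  shows "nonneg (\<lambda>k. - root_word is x k)" "\<not> nonneg (root_word is x)"
proof -
  have w: "word is" using l by (simp add: is_longest_def)
  have simple: "nonneg (\<lambda>k. - root_word is (simple i) k)" if i: "i \<in> {1..r}" for i
  proof (rule ccontr)
    assume "\<not> ?thesis"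
    then have "nonneg (root_word is (simple i))" using root_sign[OF root_root_word[OF root_simple(2)[OF i] w]] by blast
    then have "inv_count (is @ [i]) = Suc (inv_count is)" by (rule inversions_append_up[OF i w])
    moreover have "word (is @ [i])" using w i by simp
    moreover have "inv_count (is @ [i]) \<le> inv_count is"
      using l \<open>word (is @ [i])\<close> unfolding is_longest_def by blast
    ultimately show False by simp
  qed
  have xs: "x = (\<lambda>k. \<Sum>j\<in>{1..r}. x j * simple j k)"
  proof
    fix k
    show "x k = (\<Sum>j\<in>{1..r}. x j * simple j k)"
      using root_support[of x k] x by (auto simp: posroots_def fund_weight_def if_distrib[of "\<lambda>y. _ * y"] cong: if_cong)
  qed
  have "root_word is x = (\<lambda>k. \<Sum>j\<in>{1..r}. x j * root_word is (simple j) k)" by (subst xs) (rule root_word_sum)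
  moreover have "(\<Sum>j\<in>{1..r}. x j * root_word is (simple j) k) \<le> 0" for k
    using simple x by (intro sum_nonpos mult_nonneg_nonpos) (auto simp: posroots_def nonneg_def)
  ultimately show 1: "nonneg (\<lambda>k. - root_word is x k)" by (simp add: nonneg_def)
  show "\<not> nonneg (root_word is x)"
    using not_both_signs[OF root_root_word[of x "is"]] x w 1 by (auto simp: posroots_def)
qed

lemma longest_product:
  assumes "is_longest is" "is_longest js" "x \<in> posroots"
  shows "nonneg (root_word js (root_word is x))"
proof -
  have w: "word is" "word js" using assms by (auto simp: is_longest_def)
  let ?y = "\<lambda>k. - root_word is x k"
  have "?y \<in> posroots"
    using longest_negative(1)[OF assms(1,3)] root_uminus[OF root_root_word[of x "is"]] assms(3) w by (simp add: posroots_def)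
  then have "nonneg (\<lambda>k. - root_word js ?y k)" by (rule longest_negative(1)[OF assms(2)])
  then show ?thesis by (simp add: root_word_uminus)
qed

lemma longest_rev:
  assumes "is_longest is"
  shows "is_longest (rev is)"
proof -
  have w: "word is" using assms by (simp add: is_longest_def)
  have "inversions (rev is) = posroots"
  proof -
    have "\<not> nonneg (root_word (rev is) x)" if x: "x \<in> posroots" for x
    proof
      assume "nonneg (root_word (rev is) x)"
      then have "root_word (rev is) x \<in> posroots" using x root_root_word[of x "rev is"] w by (simp add: posroots_def)
      then have "\<not> nonneg (root_word is (root_word (rev is) x))" by (rule longest_negative(2)[OF assms])
      then show False using x w by (simp add: posroots_def)
    qed
    then show ?thesis by (auto simp: inversions_def)
  qed
  then show ?thesis using w card_mono[OF finite_posroots] by (auto simp: is_longest_def inversions_def)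
qed

text \<open>One longest element followed by the inverse of another keeps all positive roots
  positive, hence is the identity.\<close>

lemma longest_unique:
  assumes "is_longest is" "is_longest js"
  shows "weight_word is = weight_word js"
proof
  fix v
  have w: "word is" "word js" using assms by (auto simp: is_longest_def)
  have "weight_word (rev js @ is) v = v"
    using longest_product[OF assms(1) longest_rev[OF assms(2)]] w by (intro weight_word_eq_id) auto
  then show "weight_word is v = weight_word js v" using weight_word_rev(2)[OF w(2), of "weight_word is v"] by simp
qed

definition longest_word :: "nat list" where "longest_word = (SOME is. is_longest is)"

lemma longest_word: "is_longest longest_word" "word longest_word"
proof -
  show "is_longest longest_word" unfolding longest_word_def using longest_exists by (rule someI_ex)
  then show "word longest_word" by (simp add: is_longest_def)
qed

lemma weight_word_longest_word_longest_word: "weight_word longest_word (weight_word longest_word v) = v"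
  using weight_word_eq_id[of "longest_word @ longest_word" v] longest_product[OF longest_word(1) longest_word(1)] longest_word(2) by simp

lemma root_word_longest_word_longest_word: "root_word longest_word (root_word longest_word x) = x"
  using root_word_eqI[of "longest_word @ longest_word" "[]" x] weight_word_longest_word_longest_word longest_word(2) by (simp add: fun_eq_iff)

lemma longest_element_eq: "longest_element r A = weight_word longest_word"
  unfolding longest_element_def
proof (rule the_equality)
  show "weight_word longest_word \<in> weyl_group r A \<and> (\<forall>v\<in>weyl_group r A. weyl_length r A v \<le> weyl_length r A (weight_word longest_word))"
    using longest_word by (auto simp: weyl_group_def weyl_length_inv_count is_longest_def)
next
  fix w assume w: "w \<in> weyl_group r A \<and> (\<forall>v\<in>weyl_group r A. weyl_length r A v \<le> weyl_length r A w)"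
  then obtain "is" where "is": "word is" "w = weight_word is" by (auto simp: weyl_group_def)
  have "is_longest is" unfolding is_longest_def
  proof (intro conjI allI impI)
    fix js assume "word js"
    then have "weyl_length r A (weight_word js) \<le> weyl_length r A (weight_word is)" using w "is" by (auto simp: weyl_group_def)
    then show "inv_count js \<le> inv_count is" using \<open>word js\<close> "is" by (simp add: weyl_length_inv_count)
  qed (rule "is")
  then show "w = weight_word longest_word" using longest_unique[OF _ longest_word(1)] "is" by blast
qed

text \<open>Minus the longest element is an involution preserving positive roots. Applied to the
  expansion of the image \<open>x\<close> of the simple root \<open>i\<close>, it writes that simple
  root as a nonnegative combination of the positive roots \<open>y j\<close>; integrality forces any
  \<open>y k\<close> with \<open>x k > 0\<close> to equal it.\<close>

lemma longest_word_simple: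
  assumes i: "i \<in> {1..r}"
  shows "\<exists>k\<in>{1..r}. root_word longest_word (simple i) = (\<lambda>x. - simple k x)"
proof -
  have simple_pos: "simple k \<in> posroots" if "k \<in> {1..r}" for k
    using that by (simp add: posroots_def root_simple nonneg_simple)
  define x where "x = (\<lambda>k. - root_word longest_word (simple i) k)"
  define y where "y k = (\<lambda>l. - root_word longest_word (simple k) l)" for k
  have x: "root x" "nonneg x"
    using root_uminus[OF root_root_word[OF root_simple(2)[OF i] longest_word(2)]] longest_negative(1)[OF longest_word(1) simple_pos[OF i]]
    by (auto simp: x_def)
  have y: "root (y k)" "nonneg (y k)" if "k \<in> {1..r}" for k
    using root_uminus[OF root_root_word[OF root_simple(2)[OF that] longest_word(2)]] longest_negative(1)[OF longest_word(1) simple_pos[OF that]]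
    by (auto simp: y_def)
  have "x = (\<lambda>k. \<Sum>j\<in>{1..r}. x j * simple j k)"
  proof
    fix k
    show "x k = (\<Sum>j\<in>{1..r}. x j * simple j k)"
      using root_support[of x k] x by (auto simp: fund_weight_def if_distrib[of "\<lambda>y. _ * y"] cong: if_cong)
  qed
  then have "root_word longest_word x = (\<lambda>l. \<Sum>j\<in>{1..r}. x j * root_word longest_word (simple j) l)" using root_word_sum by metis
  moreover have "root_word longest_word x = (\<lambda>l. - simple i l)" unfolding x_def root_word_uminus root_word_longest_word_longest_word ..
  ultimately have sum: "simple i l = (\<Sum>j\<in>{1..r}. x j * y j l)" for l
    by (simp add: y_def sum_negf fun_eq_iff) (metis minus_minus)
  obtain k where "x k \<noteq> 0" using root_nonzero[OF x(1)] by blast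
  then have k: "k \<in> {1..r}" "x k > 0" using root_support[OF x(1)] x(2) by (auto simp: nonneg_def order_less_le)
  have le: "x k * y k l \<le> simple i l" for l
    unfolding sum using k x y by (intro member_le_sum) (auto simp: nonneg_def)
  have yl: "y k l = 0" if "l \<noteq> i" for l
  proof -
    have "x k * y k l \<le> 0" using le[of l] that by (simp add: fund_weight_def)
    then have "y k l \<le> 0" using k by (simp add: mult_le_0_iff)
    then show ?thesis using y(2)[OF k(1)] by (simp add: nonneg_def order_antisym)
  qed
  then have "y k i \<noteq> 0" using root_nonzero[OF y(1)[OF k(1)]] by metis
  then have "y k i \<ge> 1" using y(2)[OF k(1)] by (simp add: nonneg_def order_less_le int_one_le_iff_zero_less)
  moreover have "y k i \<le> x k * y k i" using k calculation mult_right_mono[of 1 "x k" "y k i"] by simp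
  moreover have "x k * y k i \<le> 1" using le[of i] by simp
  ultimately have "y k i = 1" by linarith
  then have "y k = simple i" using yl by (auto simp: fund_weight_def)
  then have "root_word longest_word (simple k) = (\<lambda>l. - simple i l)" unfolding y_def by (metis minus_minus)
  then have "root_word longest_word (\<lambda>l. - simple i l) = simple k" using root_word_longest_word_longest_word by metis
  then have "root_word longest_word (simple i) = (\<lambda>l. - simple k l)" unfolding root_word_uminus by (metis minus_minus)
  then show ?thesis using k by blast
qed

definition opposite :: "nat \<Rightarrow> nat" where "opposite i = (SOME k. k \<in> {1..r} \<and> root_word longest_word (simple i) = (\<lambda>x. - simple k x))"

lemma
  assumes i: "i \<in> {1..r}"
  shows opposite_range: "opposite i \<in> {1..r}" and root_word_longest_word_simple: "root_word longest_word (simple i) = (\<lambda>x. - simple (opposite i) x)"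
  using someI_ex[OF longest_word_simple[OF i, unfolded Bex_def]] unfolding opposite_def by auto

lemma simple_inj: "simple i = simple j \<Longrightarrow> i = j"
  by (metis fund_weight_def zero_neq_one)

lemma opposite_opposite: "i \<in> {1..r} \<Longrightarrow> opposite (opposite i) = i"
proof -
  assume i: "i \<in> {1..r}"
  have "simple i = root_word longest_word (root_word longest_word (simple i))" by (simp add: root_word_longest_word_longest_word)
  also have "\<dots> = simple (opposite (opposite i))"
    by (simp add: root_word_longest_word_simple[OF i] root_word_uminus root_word_longest_word_simple[OF opposite_range[OF i]])
  finally show ?thesis using simple_inj by metis
qed

lemma A_opposite:
  assumes i: "i \<in> {1..r}" and j: "j \<in> {1..r}"
  shows "d (opposite j) * of_int (A (opposite j) (opposite i)) = d j * of_int (A j i)"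
proof -
  have p: "pairing (wt (simple i)) (simple j) = d j * of_int (A j i)" if "i \<in> {1..r}" "j \<in> {1..r}" for i j
    using that by (simp add: pairing_simple wt_simple simple_root_def)
  have "pairing (wt (simple i)) (simple j) = pairing (wt (root_word longest_word (simple i))) (root_word longest_word (simple j))"
    using pairing_word[OF longest_word(2), of "wt (simple i)" "simple j"] weight_word_wt[OF longest_word(2)] by simp
  also have "\<dots> = pairing (wt (simple (opposite i))) (simple (opposite j))"
    using wt_linear[of "-1" "simple (opposite i)" 0 "simple i"]
    by (simp add: root_word_longest_word_simple[OF i] root_word_longest_word_simple[OF j] pairing_uminus)
  finally show ?thesis using i j opposite_range by (simp add: p)
qed

lemma d_opposite: "i \<in> {1..r} \<Longrightarrow> d (opposite i) = d i"
  using A_opposite[of i i] opposite_range[of i] by (simp add: diag)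

lemma A_opposite_opposite: "i \<in> {1..r} \<Longrightarrow> j \<in> {1..r} \<Longrightarrow> A (opposite j) (opposite i) = A j i"
  using A_opposite[of i j] d_opposite[of j] d_pos[of j] by simp

text \<open>Fundamental weights are dual to the simple roots, which the longest element permutes up
  to sign without changing their length.\<close>

lemma weight_word_longest_word_fund:
  assumes i: "i \<in> {1..r}"
  shows "weight_word longest_word (fund_weight i) = (\<lambda>k. - fund_weight (opposite i) k)"
proof
  fix l
  show "weight_word longest_word (fund_weight i) l = - fund_weight (opposite i) l"
  proof (cases "l \<in> {1..r}")
    case True
    have "pairing (weight_word longest_word (fund_weight i)) (simple l) = pairing (fund_weight i) (root_word longest_word (simple l))"
      using pairing_word[OF longest_word(2), of "fund_weight i" "root_word longest_word (simple l)"] by (simp add: root_word_longest_word_longest_word)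
    then have "d l * of_int (weight_word longest_word (fund_weight i) l) = - d i * of_int (simple (opposite l) i)"
      using True i by (simp add: pairing_simple root_word_longest_word_simple pairing_uminus pairing_fund)
    also have "\<dots> = d l * of_int (- fund_weight (opposite i) l)"
      using True i opposite_opposite d_opposite[OF i] by (auto simp: fund_weight_def)
    finally show ?thesis using d_pos[OF True] by (metis mult_cancel_left of_int_eq_iff less_irrefl)
  next
    case False
    then show ?thesis using weight_word_support[OF longest_word(2) False, of "fund_weight i"] i opposite_range[OF i]
      by (auto simp: fund_weight_def)
  qed
qed

lemma star_eq: "i \<in> {1..r} \<Longrightarrow> star r A i = opposite i"
  unfolding star_def longest_element_eq
proof (rule the_equality)
  assume i: "i \<in> {1..r}"
  then show "opposite i \<in> {1..r} \<and> weight_word longest_word (fund_weight i) = (\<lambda>k. - fund_weight (opposite i) k)"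
    using opposite_range weight_word_longest_word_fund by simp
  fix j assume "j \<in> {1..r} \<and> weight_word longest_word (fund_weight i) = (\<lambda>k. - fund_weight j k)"
  then have "fund_weight j = fund_weight (opposite i)" using weight_word_longest_word_fund[OF i] by (simp add: fun_eq_iff)
  then show "j = opposite i" by (rule simple_inj)
qed

section \<open>Dominant weights and the number \<open>h(i;c)\<close>\<close>

definition dominant :: "weight \<Rightarrow> bool" where "dominant v \<longleftrightarrow> (\<forall>k\<in>{1..r}. v k \<ge> 0)"

text \<open>The last letter \<open>j\<close> of a reduced word makes its simple root negative under
  the whole word. Dominance of the image then gives \<open>v j \<le> 0\<close>, so
  \<open>v j = 0\<close> and the letter fixes \<open>v\<close>.\<close>

lemma dominant_unique: "reduced is \<Longrightarrow> dominant v \<Longrightarrow> dominant (weight_word is v) \<Longrightarrow> weight_word is v = v"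
proof (induction "is" rule: rev_induct)
  case (snoc j "is")
  note red = reduced_appendD[OF snoc.prems(1)]
  let ?x = "root_word is (simple j)"
  have "root_word (is @ [j]) (simple j) = (\<lambda>k. - ?x k)" using red by (simp add: refl_simple root_word_uminus)
  moreover have "word (is @ [j])" using red by simp
  ultimately have "d j * of_int (v j) = - pairing (weight_word (is @ [j]) v) ?x"
    using pairing_word[of "is @ [j]" v "simple j"] red by (simp add: pairing_simple pairing_uminus)
  moreover have "pairing (weight_word (is @ [j]) v) ?x \<ge> 0"
    unfolding pairing_def using snoc.prems(3) red(2) d_pos
    by (intro sum_nonneg mult_nonneg_nonneg) (auto simp: dominant_def nonneg_def less_imp_le)
  ultimately have "v j \<le> 0" using d_pos[OF red(3)] by (simp add: mult_le_0_iff) (smt (verit) mult_le_0_iff of_int_le_0_iff)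
  then have "v j = 0" using snoc.prems(2) red(3) by (auto simp: dominant_def order_antisym)
  then have "simple_refl r A j v = v" by (simp add: simple_refl_def)
  then show ?case using snoc.IH[OF red(1)] snoc.prems by simp
qed simp

text \<open>Both the power of \<open>c\<close> and the longest element send the fundamental weight
  of \<open>i\<close> to the negative of a fundamental weight; these two fundamental weights are
  dominant and in one orbit.\<close>

lemma end_vertex_eq:
  assumes i: "i \<in> {1..r}"
  shows "end_vertex i = opposite i"
proof -
  let ?w = "cpow (sweeps i) @ rev longest_word"
  have "weight_word (rev longest_word) (\<lambda>k. - fund_weight (opposite i) k) = fund_weight i"
    using weight_word_rev(1)[OF longest_word(2), of "fund_weight i"] by (simp add: weight_word_longest_word_fund[OF i])
  then have "weight_word (rev longest_word) (fund_weight (opposite i)) = (\<lambda>k. - fund_weight i k)"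
    unfolding weight_word_uminus by (metis minus_minus)
  then have eq: "weight_word ?w (fund_weight (opposite i)) = fund_weight (end_vertex i)"
    using weight_orbit_final[OF i] by (simp add: weight_word_uminus weight_orbit_def)
  have "word ?w" using longest_word(2) by simp
  then obtain js where js: "reduced js" "weight_word js = weight_word ?w" using weyl_length_reduced by blast
  have "dominant (fund_weight j)" for j by (simp add: dominant_def fund_weight_def)
  then have "weight_word js (fund_weight (opposite i)) = fund_weight (opposite i)"
    using eq js by (intro dominant_unique) auto
  then show ?thesis using eq js simple_inj by metis
qed

lemma hc_eq:
  assumes i: "i \<in> {1..r}"
  shows "hc r A i = sweeps i"
  unfolding hc_def coxeter_power weight_orbit_def[symmetric] star_eq[OF i]
proof (rule the_equality)
  have "weight_greater r A (weight_orbit i n) (weight_orbit i (Suc n))" if n: "n < sweeps i" for n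
    unfolding weight_greater_def
  proof (intro conjI exI allI)
    have ones_row: "nonneg (root_orbit i n)" by (rule root_orbit_before[OF i n])
    show "weight_orbit i n k - weight_orbit i (Suc n) k = (\<Sum>j\<in>{1..r}. int (nat (root_orbit i n j)) * simple_root r A j k)" for k
    proof -
      have "weight_orbit i n k - weight_orbit i (Suc n) k = wt (root_orbit i n) k" by (simp add: wt_root_orbit[OF i])
      also have "\<dots> = (\<Sum>j\<in>{1..r}. root_orbit i n j * simple_root r A j k)"
        by (auto simp: wt_def coroot_def simple_root_def mult.commute intro: sum.cong)
      finally show ?thesis using ones_row by (simp add: nonneg_def)
    qed
    show "weight_orbit i n \<noteq> weight_orbit i (Suc n)"
    proof
      assume "weight_orbit i n = weight_orbit i (Suc n)"
      then have "wt (root_orbit i n) = wt (\<lambda>_. 0)" by (simp add: wt_root_orbit[OF i] wt_zero)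
      then have "root_orbit i n = (\<lambda>_. 0)" by (rule wt_inj) (simp add: root_support[OF root_root_orbit[OF i]])
      then show False using root_nonzero[OF root_root_orbit[OF i, of n]] by simp
    qed
  qed
  then show "1 \<le> sweeps i \<and> (\<forall>n<sweeps i. weight_greater r A (weight_orbit i n) (weight_orbit i (Suc n))) \<and>
      weight_orbit i (sweeps i) = (\<lambda>k. - fund_weight (opposite i) k)"
    using sweeps_pos[OF i] weight_orbit_final[OF i] end_vertex_eq[OF i] by auto
next
  fix h assume h: "1 \<le> h \<and> (\<forall>n<h. weight_greater r A (weight_orbit i n) (weight_orbit i (Suc n))) \<and>
      weight_orbit i h = (\<lambda>k. - fund_weight (opposite i) k)"
  show "h = sweeps i"
  proof (rule ccontr)
    assume "h \<noteq> sweeps i"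
    then consider "h < sweeps i" | "sweeps i < h" by linarith
    then show False
    proof cases
      case 1
      \<comment> \<open>Equal weights have equal next differences, but the root before
        \<open>sweeps i\<close> is positive and the one at \<open>sweeps i\<close> is not.\<close>
      have "weight_orbit i h = weight_orbit i (sweeps i)" using h weight_orbit_final[OF i] end_vertex_eq[OF i] by simp
      moreover have "weight_orbit i (Suc m) = weight_word cox (weight_orbit i m)" for m by (simp add: weight_orbit_def cpow_Suc(1))
      ultimately have "wt (root_orbit i h) = wt (root_orbit i (sweeps i))" unfolding wt_root_orbit[OF i] by simp
      then have "root_orbit i h = root_orbit i (sweeps i)" by (rule wt_inj) (simp add: root_support[OF root_root_orbit[OF i]])
      then show False using root_orbit_before[OF i 1] root_orbit_sweeps[OF i] by simp
    next
      case 2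
      \<comment> \<open>A longer chain would still decrease at \<open>sweeps i\<close>, making the
        root there nonnegative.\<close>
      then obtain n :: "nat \<Rightarrow> nat" where n: "\<And>k. weight_orbit i (sweeps i) k - weight_orbit i (Suc (sweeps i)) k =
          (\<Sum>j\<in>{1..r}. int (n j) * simple_root r A j k)"
        using h unfolding weight_greater_def by blast
      let ?x = "\<lambda>j. if j \<in> {1..r} then int (n j) else 0"
      have "wt (root_orbit i (sweeps i)) k = wt ?x k" for k
        unfolding wt_root_orbit[OF i] n by (auto simp: wt_def coroot_def simple_root_def mult.commute intro: sum.cong)
      then have "wt (root_orbit i (sweeps i)) = wt ?x" by (rule ext)
      then have "root_orbit i (sweeps i) = ?x" by (rule wt_inj) (auto simp: root_support[OF root_root_orbit[OF i]])
      then have "nonneg (root_orbit i (sweeps i))" by (simp add: nonneg_def)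
      then show False using root_orbit_sweeps[OF i] by simp
    qed
  qed
qed

end

section \<open>Periodicity\<close>

context cartan
begin

definition ht :: "(nat \<Rightarrow> int) \<Rightarrow> int" where "ht x = (\<Sum>k\<in>{1..r}. x k)"

definition ones_row :: "nat \<Rightarrow> nat \<Rightarrow> int" where "ones_row i m = p_vec r A (\<lambda>_ _. 1) i (int m) 1"

lemma p_vec_mesh:
  assumes "i \<in> {1..r}" "k \<ge> 1"
  shows "p_vec r A P i (m0 + int m) k + p_vec r A P i (m0 + int (Suc m)) k =
    mesh_sum (\<lambda>j m. pos_part (p_vec r A P j (m0 + int m) k)) i m"
  using p_vec_step[OF assms, of P "m0 + int m"] by (simp add: mesh_sum_def ac_simps)

lemma ht_pos: "root x \<Longrightarrow> nonneg x \<Longrightarrow> ht x > 0"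
proof -
  assume x: "root x" "nonneg x"
  obtain k where "x k \<noteq> 0" using root_nonzero[OF x(1)] by blast
  then have "k \<in> {1..r}" "x k > 0" using root_support[OF x(1)] x(2) by (auto simp: nonneg_def order_less_le)
  moreover from this have "x k \<le> ht x" unfolding ht_def using x(2) by (intro member_le_sum) (auto simp: nonneg_def)
  ultimately show ?thesis by simp
qed

lemma ht_uminus: "ht (\<lambda>k. - x k) = - ht x"
  by (simp add: ht_def sum_negf)

lemma ht_first_root:
  assumes "i \<in> {1..r}"
  shows "ht (first_root i) = 1 + (\<Sum>l\<in>{1..<i}. - A l i * ht (first_root l))"
proof -
  have "ht (first_root i) = (\<Sum>k\<in>{1..r}. simple i k) + (\<Sum>k\<in>{1..r}. \<Sum>l\<in>{1..<i}. - A l i * first_root l k)"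
    unfolding ht_def sum.distrib[symmetric] by (intro sum.cong refl) (rule first_root_recursion[OF assms])
  also have "(\<Sum>k\<in>{1..r}. simple i k) = 1" using assms by (simp add: fund_weight_def)
  also have "(\<Sum>k\<in>{1..r}. \<Sum>l\<in>{1..<i}. - A l i * first_root l k) = (\<Sum>l\<in>{1..<i}. - A l i * ht (first_root l))"
    by (subst sum.swap) (simp add: ht_def sum_distrib_left)
  finally show ?thesis .
qed

lemma ht_root_orbit_mesh:
  assumes "i \<in> {1..r}"
  shows "ht (root_orbit i m) + ht (root_orbit i (Suc m)) = mesh_sum (\<lambda>j m. ht (root_orbit j m)) i m"
  unfolding ht_def mesh_sum_sum sum.distrib[symmetric] by (intro sum.cong refl) (rule root_orbit_mesh[OF assms])

text \<open>In the hypothesis \<open>final\<close>, the end of \<open>j\<close> lies in the mesh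
  just before the end of \<open>i\<close>. There the last weight of \<open>i\<close> and the last
  root of \<open>j\<close> pair to zero, so \<open>first_root (opposite j)\<close> has no coordinate
  at \<open>opposite i\<close>; by \<open>first_root_adjacent\<close> this excludes
  \<open>opposite i < opposite j\<close>.\<close>

lemma final_order:
  assumes i: "i \<in> {1..r}" and j: "j \<in> {1..r}" and A: "A j i \<noteq> 0"
    and final: "i < j \<and> sweeps i = Suc (sweeps j) \<or> j < i \<and> sweeps i = sweeps j"
  shows "opposite j < opposite i"
proof -
  have "weight_orbit i (sweeps i) = weight_word (cword (sweeps j) j) (fund_weight i)"
    using final weight_orbit_below[OF j, of i "sweeps j"] weight_orbit_above[of j i "sweeps j"] by auto
  then have "pairing (weight_orbit i (sweeps i)) (root_orbit j (sweeps j)) = pairing (fund_weight i) (simple j)"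
    unfolding root_orbit_def using j by (simp add: pairing_word)
  also have "\<dots> = 0" using final i by (auto simp: pairing_fund)
  finally have "d (opposite i) * of_int (first_root (opposite j) (opposite i)) = 0"
    using opposite_range[OF i] end_vertex_eq[OF i] end_vertex_eq[OF j]
    by (simp add: weight_orbit_final[OF i] root_orbit_final[OF j] pairing_uminus pairing_fund)
  then have "first_root (opposite j) (opposite i) = 0" using d_pos[OF opposite_range[OF i]] by simp
  then have "\<not> opposite i < opposite j"
    using first_root_adjacent[OF opposite_range[OF i] opposite_range[OF j]] A_opposite_opposite[OF i j] A by auto
  moreover have "i \<noteq> j" using final by auto
  then have "opposite i \<noteq> opposite j" using opposite_opposite[OF i] opposite_opposite[OF j] by metis
  ultimately show ?thesis by simp
qed

text \<open>Heights of the roots satisfy the same mesh relation without positive parts. The two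
  recursions differ only through neighbours that have reached their ends, and those matter first at
  \<open>m = sweeps i\<close>. The total correction there is at most
  \<open>ht (first_root (opposite i)) - 1\<close>, so the entry stays negative.\<close>

lemma ones_row_values:
  "i \<in> {1..r} \<Longrightarrow> m \<le> sweeps i \<Longrightarrow> (m < sweeps i \<longrightarrow> ones_row i m = ht (root_orbit i m)) \<and> (m = sweeps i \<longrightarrow> ones_row i m < 0)"
proof (induction i m rule: sweep_induct)
  case (less i m)
  have i: "i \<in> {1..r}" by (rule less.prems)
  \<comment> \<open>What the positive part adds when a neighbour has reached its end: it replaces
    the negative height there by \<open>0\<close>.\<close>
  let ?\<delta> = "\<lambda>j k. if k = sweeps j then ht (first_root (opposite j)) else 0"
  have ht_root_orbit: "ht (root_orbit j k) > 0" if "j \<in> {1..r}" "k < sweeps j" for j k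
    using ht_pos root_root_orbit root_orbit_before that by blast
  have ht_root_orbit_final: "ht (root_orbit j (sweeps j)) = - ht (first_root (opposite j))" if "j \<in> {1..r}" for j
    using end_vertex_eq[OF that] by (simp add: root_orbit_final[OF that] ht_uminus)
  have pp: "pos_part (ones_row j k) = ht (root_orbit j k) + ?\<delta> j k"
    if j: "j \<in> {1..r}" and k: "k \<le> sweeps j" "k < m \<or> k = m \<and> j < i" for j k
  proof (cases "k = sweeps j")
    case True
    then have "ones_row j k < 0" using less.IH[OF k(2) j k(1)] by simp
    then show ?thesis using True ht_root_orbit_final[OF j] by simp
  next
    case False
    then have "ones_row j k = ht (root_orbit j k)" using less.IH[OF k(2) j k(1)] k(1) by simp
    then show ?thesis using ht_root_orbit[OF j, of k] False k(1) by simp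
  qed
  show ?case
  proof (cases m)
    case 0
    have "ones_row i 0 = 1 + (\<Sum>j\<in>{1..<i}. - A j i * pos_part (ones_row j 0))"
      using p_vec_initial[OF i, of 1 "\<lambda>_ _. 1"] by (simp add: ones_row_def)
    also have "(\<Sum>j\<in>{1..<i}. - A j i * pos_part (ones_row j 0)) = (\<Sum>j\<in>{1..<i}. - A j i * ht (first_root j))"
    proof (intro sum.cong refl)
      fix j assume "j \<in> {1..<i}"
      then show "- A j i * pos_part (ones_row j 0) = - A j i * ht (first_root j)"
        using pp[of j 0] sweeps_pos[of j] 0 i by (simp add: root_orbit_0)
    qed
    finally show ?thesis using sweeps_pos[OF i] 0 by (simp add: ht_first_root[OF i] root_orbit_0)
  next
    case (Suc k)
    have nb: "pos_part (ones_row j k) = ht (root_orbit j k) + ?\<delta> j k \<and> k \<le> sweeps j \<and> (m < sweeps i \<longrightarrow> k < sweeps j)"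
      if "j \<in> {i<..r}" "A j i \<noteq> 0" for j
      using pp[of j k] sweeps_adjacent[OF i, of j] that less.prems Suc by auto
    have nb': "pos_part (ones_row j (Suc k)) = ht (root_orbit j (Suc k)) + ?\<delta> j (Suc k) \<and> (m < sweeps i \<longrightarrow> Suc k < sweeps j)"
      if "j \<in> {1..<i}" "A j i \<noteq> 0" for j
      using pp[of j m] sweeps_adjacent[of j i] zero_sym[of i j] that less.prems Suc by fastforce
    have "ones_row i k + ones_row i m = mesh_sum (\<lambda>j k. pos_part (ones_row j k)) i k"
      using p_vec_mesh[OF i, of 1 "\<lambda>_ _. 1" 0 k] Suc by (simp add: ones_row_def)
    also have "\<dots> = mesh_sum (\<lambda>j k. ht (root_orbit j k) + ?\<delta> j k) i k"
      using nb nb' by (intro mesh_sum_cong) blast+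
    also have "\<dots> = ht (root_orbit i k) + ht (root_orbit i m) + mesh_sum ?\<delta> i k"
      unfolding mesh_sum_add using ht_root_orbit_mesh[OF i, of k] Suc by simp
    finally have n: "ones_row i m = ht (root_orbit i m) + mesh_sum ?\<delta> i k"
      using less.IH[of k i] less.prems Suc by simp
    show ?thesis
    proof (cases "m = sweeps i")
      case False
      have "mesh_sum ?\<delta> i k = mesh_sum (\<lambda>_ _. 0) i k"
        using nb nb' False less.prems by (intro mesh_sum_cong) fastforce+
      then show ?thesis using n False by (simp add: mesh_sum_def)
    next
      case True
      let ?D = "\<lambda>j. ?\<delta> j (if i < j then k else Suc k)"
      let ?s = "opposite i"
      have s: "?s \<in> {1..r}" by (rule opposite_range[OF i])
      have S: "{1..r} - {i} = {i<..r} \<union> {1..<i}" using i by auto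
      have "mesh_sum ?\<delta> i k = (\<Sum>j\<in>{1..r} - {i}. - A j i * ?D j)"
        unfolding S by (subst sum.union_disjoint) (auto simp: mesh_sum_def intro!: arg_cong2[where f = "(+)"] sum.cong)
      also have "\<dots> = (\<Sum>l\<in>{1..r} - {?s}. - A l ?s * ?D (opposite l))"
      proof (rule sum.reindex_bij_witness[where i = opposite and j = opposite])
        fix j assume j: "j \<in> {1..r} - {i}"
        then show "opposite (opposite j) = j" using opposite_opposite by blast
        then show "- A (opposite j) ?s * ?D (opposite (opposite j)) = - A j i * ?D j" using A_opposite_opposite[OF i, of j] j by simp
        show "opposite j \<in> {1..r} - {?s}" using j opposite_range opposite_opposite[OF i] opposite_opposite[of j] by (metis DiffE DiffI singleton_iff)
      next
        fix l assume l: "l \<in> {1..r} - {?s}"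
        then show "opposite (opposite l) = l" using opposite_opposite by blast
        then show "opposite l \<in> {1..r} - {i}" using l opposite_range by (metis DiffE DiffI singleton_iff)
      qed
      \<comment> \<open>By \<open>final_order\<close> only vertices \<open>l < ?s\<close> can carry
        a correction; admitting all of these gives the sum in \<open>ht_first_root\<close>.\<close>
      also have "\<dots> \<le> (\<Sum>l\<in>{1..r} - {?s}. if l < ?s then - A l ?s * ht (first_root l) else 0)"
      proof (rule sum_mono)
        fix l assume l: "l \<in> {1..r} - {?s}"
        have oppositel: "opposite l \<in> {1..r}" "opposite (opposite l) = l" "opposite l \<noteq> i" using l opposite_range opposite_opposite by auto
        have first_rootl: "ht (first_root l) > 0" using l ht_pos root_first_root nonneg_first_root by blast
        have As: "A l ?s \<le> 0" using off_diag[of l ?s] l s by auto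
        show "- A l ?s * ?D (opposite l) \<le> (if l < ?s then - A l ?s * ht (first_root l) else 0)"
        proof (cases "?D (opposite l) = 0 \<or> A l ?s = 0")
          case True
          then show ?thesis using As first_rootl by (auto simp: mult_nonpos_nonneg)
        next
          case False
          then have "A (opposite l) i \<noteq> 0" using A_opposite_opposite[OF s, of l] l opposite_opposite[OF i] by simp
          moreover have "i < opposite l \<and> sweeps i = Suc (sweeps (opposite l)) \<or> opposite l < i \<and> sweeps i = sweeps (opposite l)"
            using False oppositel(3) \<open>m = sweeps i\<close> Suc by (auto split: if_splits)
          ultimately have "opposite (opposite l) < ?s" by (rule final_order[OF i oppositel(1)])
          then show ?thesis using False oppositel(2) by (simp split: if_splits)
        qed
      qed
      also have "\<dots> = (\<Sum>l\<in>{1..<?s}. - A l ?s * ht (first_root l))"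
        using s by (intro sum.mono_neutral_cong_right) auto
      also have "\<dots> = ht (first_root ?s) - 1" by (simp add: ht_first_root[OF s])
      finally have "ones_row i m < 0" using n ht_root_orbit_final[OF i] True by simp
      then show ?thesis using True by simp
    qed
  qed
qed

lemma coxeter_region: "coxeter_region r A sweeps opposite ones_row weight_orbit"
proof
  show "sweeps j \<le> sweeps i \<and> sweeps i \<le> Suc (sweeps j)"
    if "i \<in> {1..r}" "j \<in> {1..r}" "i < j" "A j i \<noteq> 0" for i j by (rule sweeps_adjacent[OF that])
  fix i assume i: "i \<in> {1..r}"
  show "sweeps i > 0" by (rule sweeps_pos[OF i])
  show "ones_row i m + ones_row i (Suc m) = mesh_sum (\<lambda>j k. pos_part (ones_row j k)) i m" for m
    using p_vec_mesh[OF i, of 1 "\<lambda>_ _. 1" 0 m] by (simp add: ones_row_def)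
  show "(\<Sum>j\<in>{1..<i}. - A j i * pos_part (ones_row j 0)) \<le> ones_row i 0"
    using p_vec_initial[OF i, of 1 "\<lambda>_ _. 1"] by (simp add: ones_row_def)
  show "ones_row i m > 0" if "m < sweeps i" for m
    using ones_row_values[OF i, of m] ht_pos[OF root_root_orbit[OF i] root_orbit_before[OF i]] that by simp
  show "ones_row i (sweeps i) < 0" using ones_row_values[OF i, of "sweeps i"] by simp
  show "opposite i \<in> {1..r}" by (rule opposite_range[OF i])
  fix k assume "k \<in> {1..r}"
  show "weight_orbit i 0 k = (if k = i then 1 else 0)" by (simp add: weight_orbit_def cpow_def fund_weight_def)
  show "weight_orbit i m k + weight_orbit i (Suc m) k = mesh_sum (\<lambda>j m. weight_orbit j m k) i m" for m by (rule weight_orbit_mesh[OF i])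
  show "weight_orbit i (sweeps i) k = (if k = opposite i then - 1 else 0)"
    using end_vertex_eq[OF i] by (simp add: weight_orbit_final[OF i] fund_weight_def)
qed

lemma frieze_periodicity:
  assumes f: "frieze_pattern r l A P f" and i: "i \<in> {1..r}"
  shows "f (Inl (i, m0 + int (sweeps i) + 1)) = f (Inl (opposite i, m0))"
proof -
  \<comment> \<open>The start is moved to \<open>m0\<close>: the mesh relation of the given rows is
    invariant under translation in \<open>m\<close>, and the row of ones is started afresh.\<close>
  define p where "p = (\<lambda>i m k. p_vec r A P i (m0 + int m) k)"
  interpret coxeter_region r A sweeps opposite ones_row weight_orbit by (rule coxeter_region)
  interpret region_data r A sweeps opposite ones_row weight_orbit l p
    by unfold_locales (simp only: p_def, rule p_vec_mesh, auto)
  let ?u = "\<lambda>i m. real_of_int (f (Inl (i, m0 + int m)))"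
  let ?q = "\<lambda>k. real_of_int (f (Inr k))"
  have "?u i (Suc (sweeps i)) = ?u (opposite i) 0"
  proof (rule region_periodicity[OF _ i])
    show "positive l ?q" using f by (simp add: frieze_pattern_def positive_def)
    fix j m assume j: "j \<in> {1..r}"
    show "?u j m > 0" using f j by (simp add: frieze_pattern_def)
    have "f (Inl (j, m0 + int m)) * f (Inl (j, m0 + int m + 1)) =
          (\<Prod>k\<in>{1..l}. f (Inr k) ^ nat (pos_part (p_vec r A P j (m0 + int m) k))) +
          (\<Prod>k\<in>{1..l}. f (Inr k) ^ nat (pos_part (- p_vec r A P j (m0 + int m) k))) *
          (\<Prod>x\<in>{j+1..r}. f (Inl (x, m0 + int m)) ^ nat (- A x j)) *
          (\<Prod>x\<in>{1..<j}. f (Inl (x, m0 + int m + 1)) ^ nat (- A x j))"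
      using f j unfolding frieze_pattern_def by blast
    moreover have "{j+1..r} = {j<..r}" by auto
    ultimately have "real_of_int (f (Inl (j, m0 + int m)) * f (Inl (j, m0 + int m + 1))) = real_of_int (
          (\<Prod>k\<in>{1..l}. f (Inr k) ^ nat (pos_part (p j m k))) +
          (\<Prod>k\<in>{1..l}. f (Inr k) ^ nat (pos_part (- p j m k))) *
          (\<Prod>x\<in>{j<..r}. f (Inl (x, m0 + int m)) ^ nat (- A x j)) *
          (\<Prod>x\<in>{1..<j}. f (Inl (x, m0 + int m + 1)) ^ nat (- A x j)))"
      by (simp only: p_def)
    then
    show "?u j m * ?u j (Suc m) = cf ?q j m + cf' ?q j m * mesh_prod ?u j m"
      by (simp add: cf_def cf'_def mesh_prod_def ac_simps)
  qed
  then show ?thesis by (simp add: ac_simps)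
qed

end

theorem theorem1p7:
  fixes r l :: nat
    and A P :: "nat \<Rightarrow> nat \<Rightarrow> int"
    and f :: "nat \<times> int + nat \<Rightarrow> int"
  assumes "cartan_matrix_finite_type r A"
    and "indecomposable r A"
    and "frieze_pattern r l A P f"
  shows "\<forall>i\<in>{1..r}. \<forall>m :: int. f (Inl (F_map r A (i, m))) = f (Inl (i, m))"
proof (intro ballI allI)
  fix i m assume i: "i \<in> {1..r}"
  obtain d :: "nat \<Rightarrow> real" where "cartan r A d"
    using assms(1) unfolding cartan_matrix_finite_type_def cartan_def by blast
  then interpret cartan r A d .
  have "F_map r A (i, m) = (opposite i, m + int (sweeps (opposite i)) + 1)"
    using opposite_range[OF i] by (simp add: F_map_def star_eq[OF i] hc_eq)
  \<comment> \<open>\<open>F_map\<close> adds the \<open>h\<close> of the target vertex, so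
    periodicity is applied at \<open>opposite i\<close>, whose orbit ends at
    \<open>i\<close>.\<close>
  then show "f (Inl (F_map r A (i, m))) = f (Inl (i, m))"
    using frieze_periodicity[OF assms(3) opposite_range[OF i], of m] by (simp add: opposite_opposite[OF i])
qed

end
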